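(* Consider the contextual MNL bandit with arbitrary (possibly non-uniform) rewards $r_{ti}\in[0,1]$, arbitrary (adversarial) features with $\|x_{ti}\|_2\le1$, $\|\mathbf w^\star\|_2\le1$, instance constant $\kappa>0$, and $v_0$ a fixed positive constant. Let $\delta\in(0,1]$. Then with probability at least $1-\delta$, the algorithm OFU-MNL+ described below satisfies $$\mathrm{Reg}_T(\mathbf w^\star)=\tilde O\Big(d\sqrt T+\frac{d^2}{\kappa}\Big),$$ where $\tilde O$ hides a constant depending only on $v_0$ and factors polylogarithmic in $T$, $K$, $d$ and $1/\delta$.
   Context: Contextual MNL bandit. Known $v_0>0$; $\mathcal S=\{S\subseteq[N]:|S|\le K\}$. At round $t$ the environment reveals $x_{ti}\in\mathbb R^d$ with $\|x_{ti}\|_2\le 1$ and $r_{ti}\in[0,1]$ for $i\in[N]$ (possibly adversarially); the learner picks $S_t\in\mathcal S$ and observes a one-hot $(y_{ti})_{i\in S_t\cup\{0\}}$ with $\Pr(y_{ti}=1)=p_t(i\mid S_t,\mathbf w^\star)$, where $p_t(i\mid S,\mathbf w)=\frac{\exp(x_{ti}^\top\mathbf w)}{v_0+\sum_{j\in S}\exp(x_{tj}^\top\mathbf w)}$ ($i\in S$), $p_t(0\mid S,\mathbf w)=\frac{v_0}{v_0+\sum_{j\in S}\exp(x_{tj}^\top\mathbf w)}$. $R_t(S,\mathbf w)=\sum_{i\in S}p_t(i\mid S,\mathbf w)r_{ti}$, $S_t^\star\in\arg\max_{S}R_t(S,\mathbf w^\star)$, $\mathrm{Reg}_T(\mathbf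 w^\star)=\sum_{t=1}^T(R_t(S_t^\star,\mathbf w^\star)-R_t(S_t,\mathbf w^\star))$. $\mathcal W=\{\mathbf w:\|\mathbf w\|_2\le1\}$; $\kappa>0$ satisfies $p_t(i\mid S,\mathbf w)p_t(0\mid S,\mathbf w)\ge\kappa$ for all $t$, $S\in\mathcal S$, $i\in S$, $\mathbf w\in\mathcal W$. Algorithm OFU-MNL+: $\eta=\tfrac12\log(K+1)+2$, $\lambda=84\sqrt2 d\eta$, $c=7\eta/6$, $\beta_t(\delta)=\frac{4\eta}{\lambda}+\sqrt{2\eta[11(3\log(1+(K+1)t)+3)\log(2\sqrt{1+2t}/\delta)+2+\sqrt6 c d\log(1+\frac{t+1}{2\lambda})]+4\lambda}$. Loss $\ell_t(\mathbf w)=-\sum_{i\in S_t\cup\{0\}}y_{ti}\log p_t(i\mid S_t,\mathbf w)$; $\mathcal G_t(\mathbf w)=\sum_{i\in S_t}p_t(i\mid S_t,\mathbf w)x_{ti}x_{ti}^\top-\sum_{i,j\in S_t}p_t(i\mid S_t,\mathbf w)p_t(j\mid S_t,\mathbf w)x_{ti}x_{tj}^\top$. Initialize $H_1=\lambda I_d$, $\mathbf w_1\in\mathcal W$. At round $t$: compute $\alpha_{ti}=x_{ti}^\top\mathbf w_t+\beta_t(\delta)\|x_{ti}\|_{H_t^{-1}}$ for all $i$; offer $S_t\in\arg\max_{S\in\mathcal S}\tilde R_t(S)$ where $\tilde R_t(S)=\frac{\sum_{i\in S}e^{\alpha_{ti}}r_{ti}}{v_0+\sum_{j\in S}e^{\alpha_{tj}}}$;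 observe $y_t$; set $\tilde H_t=H_t+\eta\mathcal G_t(\mathbf w_t)$, $\mathbf w_{t+1}=\arg\min_{\mathbf w\in\mathcal W}\langle\nabla\ell_t(\mathbf w_t),\mathbf w\rangle+\frac1{2\eta}\|\mathbf w-\mathbf w_t\|^2_{\tilde H_t}$, $H_{t+1}=H_t+\mathcal G_t(\mathbf w_{t+1})$. *)

theory Defs
  imports "Jordan_Normal_Form.Gauss_Jordan_Elimination" "HOL-Probability.Probability_Mass_Function"
begin

(* Vectors in R^d are JNF vectors of dimension d, matrices are d x d JNF matrices.
   Items are 1..N, item 0 is the outside option.
   A history is the list of past (offered assortment, chosen item) pairs,
   stored in REVERSE order (most recent round first). *)

type_synonym hist = "(nat set \<times> nat) list"

definition vnorm :: "real Matrix.vec \<Rightarrow> real" where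
  "vnorm x = sqrt (scalar_prod x x)"

definition Wset :: "nat \<Rightarrow> real Matrix.vec set" where
  "Wset d = {w \<in> carrier_vec d. vnorm w \<le> 1}"

definition Assorts :: "nat \<Rightarrow> nat \<Rightarrow> nat set set" where
  "Assorts N K = {S. S \<subseteq> {1..N} \<and> card S \<le> K}"

definition mnl_prob :: "real \<Rightarrow> (nat \<Rightarrow> real Matrix.vec) \<Rightarrow> nat set \<Rightarrow> real Matrix.vec \<Rightarrow> nat \<Rightarrow> real" where
  "mnl_prob v0 x S w i =
     (if i = 0 then v0 else exp (scalar_prod (x i) w)) / (v0 + (\<Sum>j\<in>S. exp (scalar_prod (x j) w)))"

definition exp_rev :: "real \<Rightarrow> (nat \<Rightarrow> real Matrix.vec) \<Rightarrow> (nat \<Rightarrow> real) \<Rightarrow> nat set \<Rightarrow> real Matrix.vec \<Rightarrow> real" where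
  "exp_rev v0 x r S w = (\<Sum>i\<in>S. mnl_prob v0 x S w i * r i)"

definition onehot :: "nat \<Rightarrow> nat \<Rightarrow> real" where
  "onehot c i = (if i = c then 1 else 0)"

definition mnl_loss :: "real \<Rightarrow> (nat \<Rightarrow> real Matrix.vec) \<Rightarrow> nat set \<Rightarrow> nat \<Rightarrow> real Matrix.vec \<Rightarrow> real" where
  "mnl_loss v0 x S c w = - (\<Sum>i\<in>insert 0 S. onehot c i * ln (mnl_prob v0 x S w i))"

definition grad :: "nat \<Rightarrow> (real Matrix.vec \<Rightarrow> real) \<Rightarrow> real Matrix.vec \<Rightarrow> real Matrix.vec" where
  "grad d f w = Matrix.vec d (\<lambda>a. deriv (\<lambda>s. f (w + s \<cdot>\<^sub>v unit_vec d a)) 0)"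

definition Gmat :: "nat \<Rightarrow> real \<Rightarrow> (nat \<Rightarrow> real Matrix.vec) \<Rightarrow> nat set \<Rightarrow> real Matrix.vec \<Rightarrow> real mat" where
  "Gmat d v0 x S w = Matrix.mat d d (\<lambda>(a, b).
      (\<Sum>i\<in>S. mnl_prob v0 x S w i * (vec_index (x i) a) * (vec_index (x i) b))
    - (\<Sum>i\<in>S. \<Sum>j\<in>S. mnl_prob v0 x S w i * mnl_prob v0 x S w j * (vec_index (x i) a) * (vec_index (x j) b)))"

definition hnorm_sq :: "real mat \<Rightarrow> real Matrix.vec \<Rightarrow> real" where
  "hnorm_sq H v = scalar_prod v (mult_mat_vec H v)"

definition inv_norm :: "real mat \<Rightarrow> real Matrix.vec \<Rightarrow> real" where
  "inv_norm H x = sqrt (scalar_prod x (mult_mat_vec (the (mat_inverse H)) x))"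

definition eta :: "nat \<Rightarrow> real" where
  "eta K = ln (real K + 1) / 2 + 2"

definition lam :: "nat \<Rightarrow> nat \<Rightarrow> real" where
  "lam d K = 84 * sqrt 2 * real d * eta K"

definition cconst :: "nat \<Rightarrow> real" where
  "cconst K = 7 * eta K / 6"

definition beta :: "nat \<Rightarrow> nat \<Rightarrow> real \<Rightarrow> nat \<Rightarrow> real" where
  "beta d K \<delta> t = 4 * eta K / lam d K
     + sqrt (2 * eta K * (11 * (3 * ln (1 + (real K + 1) * real t) + 3) * ln (2 * sqrt (1 + 2 * real t) / \<delta>)
               + 2 + sqrt 6 * cconst K * real d * ln (1 + (real t + 1) / (2 * lam d K)))
             + 4 * lam d K)"

(* the environment: given the (reversed) history of past rounds, it reveals the features
   x_{ti} and rewards r_{ti} of the current round (adaptive adversary) *)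
type_synonym env = "hist \<Rightarrow> (nat \<Rightarrow> real Matrix.vec) \<times> (nat \<Rightarrow> real)"

primrec alg_state :: "nat \<Rightarrow> nat \<Rightarrow> real \<Rightarrow> env \<Rightarrow> real Matrix.vec \<Rightarrow> hist \<Rightarrow> real Matrix.vec \<times> real mat" where
  "alg_state d K v0 E w1 [] = (w1, lam d K \<cdot>\<^sub>m 1\<^sub>m d)"
| "alg_state d K v0 E w1 (sc # h) =
     (let (w, H) = alg_state d K v0 E w1 h;
          x = fst (E h); S = fst sc; c = snd sc;
          Ht = H + eta K \<cdot>\<^sub>m Gmat d v0 x S w;
          g = grad d (mnl_loss v0 x S c) w;
          obj = (\<lambda>u. scalar_prod g u + hnorm_sq Ht (u - w) / (2 * eta K));
          w' = (SOME u. u \<in> Wset d \<and> (\<forall>v\<in>Wset d. obj u \<le> obj v))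
      in (w', H + Gmat d v0 x S w'))"

(* optimistic index alpha_{ti} at the round following history h (round t = length h + 1) *)
definition ucb_alpha :: "nat \<Rightarrow> nat \<Rightarrow> real \<Rightarrow> real \<Rightarrow> env \<Rightarrow> real Matrix.vec \<Rightarrow> hist \<Rightarrow> nat \<Rightarrow> real" where
  "ucb_alpha d K v0 \<delta> E w1 h i =
     (let (w, H) = alg_state d K v0 E w1 h; x = fst (E h)
      in scalar_prod (x i) w + beta d K \<delta> (length h + 1) * inv_norm H (x i))"

definition opt_rev :: "nat \<Rightarrow> nat \<Rightarrow> real \<Rightarrow> real \<Rightarrow> env \<Rightarrow> real Matrix.vec \<Rightarrow> hist \<Rightarrow> nat set \<Rightarrow> real" where
  "opt_rev d K v0 \<delta> E w1 h S =
     (\<Sum>i\<in>S. exp (ucb_alpha d K v0 \<delta> E w1 h i) * snd (E h) i)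
       / (v0 + (\<Sum>j\<in>S. exp (ucb_alpha d K v0 \<delta> E w1 h j)))"

definition choice_pmf :: "real \<Rightarrow> (nat \<Rightarrow> real Matrix.vec) \<Rightarrow> nat set \<Rightarrow> real Matrix.vec \<Rightarrow> nat pmf" where
  "choice_pmf v0 x S w = embed_pmf (\<lambda>i. if i \<in> insert 0 S then mnl_prob v0 x S w i else 0)"

primrec traj :: "real \<Rightarrow> env \<Rightarrow> (hist \<Rightarrow> nat set) \<Rightarrow> real Matrix.vec \<Rightarrow> nat \<Rightarrow> hist pmf" where
  "traj v0 E pick wstar 0 = return_pmf []"
| "traj v0 E pick wstar (Suc n) =
     bind_pmf (traj v0 E pick wstar n)
       (\<lambda>h. map_pmf (\<lambda>c. (pick h, c) # h) (choice_pmf v0 (fst (E h)) (pick h) wstar))"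

primrec regret :: "real \<Rightarrow> nat \<Rightarrow> nat \<Rightarrow> env \<Rightarrow> real Matrix.vec \<Rightarrow> hist \<Rightarrow> real" where
  "regret v0 N K E wstar [] = 0"
| "regret v0 N K E wstar (sc # h) = regret v0 N K E wstar h
     + (Max ((\<lambda>S. exp_rev v0 (fst (E h)) (snd (E h)) S wstar) ` Assorts N K)
        - exp_rev v0 (fst (E h)) (snd (E h)) (fst sc) wstar)"

end

theory Submission
  imports Defs "Jordan_Normal_Form.Determinant"
begin

text \<open>
  Write \<open>H\<close> for the regularised Hessian, \<open>w'\<close> for the iterate after observing \<open>c\<close>, and \<open>D\<close> for
  the Bregman divergence of log-sum-exp.  With \<open>V = ln (p' / p)\<close> one has \<open>D = E [exp V - 1 - V]\<close>.
  This single formula gives both the strong convexity of the loss with the exact constant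
  \<open>1 / (2\<eta>)\<close> and the bound on the third order error of the surrogate loss, so that one mirror step satisfies
  \<open>\<parallel>w* - w'\<parallel>\<^sup>2 (in H') \<le> \<parallel>w* - w\<parallel>\<^sup>2 (in H) + 2\<eta> ln (p'(c) / p*(c)) - \<parallel>w' - w\<parallel>\<^sup>2 (in H) / 2\<close>.

  Exponentiating, the factor \<open>1 / p*(c)\<close> cancels against the law of \<open>c\<close>: what remains is an
  expectation under the current iterate, and it is absorbed by the growth of \<open>ln det H\<close>.  Hence
  \<open>exp (\<parallel>w* - w\<parallel>\<^sup>2 / (2\<eta>) - (7/5) \<eta> ln det H)\<close> is a supermartingale, and Markov's inequality with a
  union bound over the rounds yields the confidence radius \<open>\<beta>\<close>, without any Gaussian mixture.

  On the confidence event the indices are optimistic, and discarding items whose reward is below the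
  optimal revenue shows that the optimistic revenue dominates the optimal one.  If all index errors
  in the offered set are at most \<open>1\<close>, the regret of the round is of order
  \<open>\<beta> sqrt (\<Sum>i. p*(i) \<parallel>z i - y\<parallel>\<^sup>2)\<close> in the norm of \<open>H\<close> inverse, for any centre \<open>y\<close>; otherwise the
  trivial bound \<open>1\<close> is at most a squared index error, of order \<open>\<beta>\<^sup>2 / \<kappa>\<close> times that sum.
  The elliptical potential \<open>ln det H\<close> controls both sums.
\<close>

section \<open>Quadratic forms and rank-one updates\<close>

text \<open>The curvature of the loss is a covariance of features, so \<open>ln det H\<close>
  controls only distances of features to a common centre, while the index bonus uses uncentred
  norms. Passing from one to the other costs a factor \<open>1 / \<kappa>\<close>, which is
  affordable only in the lower order term. The leading term avoids it because choice probabilities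
  do not change when all utilities shift together: only differences of index errors matter, and any
  centre cancels in them (\<open>mean_shift_le\<close>).

  A second obstacle is that the new iterate, and with it the matrix added to \<open>H\<close>,
  depends on the observed choice. The growth of \<open>ln det H\<close> is therefore random given
  the past. It is bounded below by a multiple of the feature spread at the current iterate, which is
  not random. Because \<open>lam d K\<close> is at least \<open>117 * eta K\<close>, one step moves
  the iterate by at most \<open>2 / 117\<close>, so this change of law costs a factor near 1; the
  change of centre costs nothing because the mean minimises the spread.\<close>

unbundle no inner_syntax
no_notation vec_nth (infixl "$" 90)
no_notation fps_nth (infixl "$" 75)

abbreviation rmat_det :: "real mat \<Rightarrow> real" where "rmat_det \<equiv> Determinant.det"

definition bform :: "real mat \<Rightarrow> real Matrix.vec \<Rightarrow> real Matrix.vec \<Rightarrow> real" where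
  "bform H u v = u \<bullet> (H *\<^sub>v v)"

text \<open>No sign of \<open>c\<close> is assumed: \<open>c = 0\<close> forces
  \<open>b = 0\<close>, and \<open>c < 0\<close> is impossible. This covers forms that are only
  semidefinite, as in \<open>det_le_power\<close>.\<close>

lemma discriminant_bound:
  fixes a b c :: real
  assumes "\<And>t. 0 \<le> a + 2 * b * t + c * t\<^sup>2"
  shows "b\<^sup>2 \<le> a * c"
proof (cases "c = 0")
  case True
  show ?thesis
  proof (cases "b = 0")
    case False
    have "0 \<le> a + 2 * b * (- (a + 1) / (2 * b))" using assms[of "- (a+1)/(2*b)"] True by simp
    also have "\<dots> = -1" using False by (simp add: field_simps)
    finally show ?thesis by simp
  qed (use assms[of 0] True in simp)
next
  case False
  have "0 \<le> c"
  proof (rule ccontr)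
    assume "\<not> 0 \<le> c"
    hence c: "c < 0" by simp
    \<comment> \<open>Chosen so that the bracket factored out below equals \<open>c\<close> exactly,
      which is negative.\<close>
    define t where "t = 1 + \<bar>a\<bar> / (-c) + 2 * \<bar>b\<bar> / (-c)"
    have "0 \<le> \<bar>a\<bar> / (-c)" "0 \<le> 2 * \<bar>b\<bar> / (-c)" using c by (intro divide_nonneg_pos; simp)+
    hence t1: "t \<ge> 1" unfolding t_def by linarith
    have "a + 2 * b * t + c * t\<^sup>2 \<le> \<bar>a\<bar> * t + 2 * \<bar>b\<bar> * t + c * t\<^sup>2"
      using t1 by (intro add_mono mult_right_mono) (auto simp: mult_le_cancel_left1 intro: order_trans[OF abs_ge_self])
    also have "\<dots> = t * (\<bar>a\<bar> + 2 * \<bar>b\<bar> + c * t)" by (simp add: algebra_simps power2_eq_square)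
    also have "\<bar>a\<bar> + 2 * \<bar>b\<bar> + c * t = c" unfolding t_def using c by (simp add: field_simps)
    also have "t * c < 0" using t1 c by (simp add: mult_pos_neg)
    finally show False using assms[of t] by simp
  qed
  hence c: "0 < c" using False by simp
  have "0 \<le> a + 2 * b * (- b / c) + c * (- b / c)\<^sup>2" by (rule assms)
  also have "\<dots> = a - b\<^sup>2 / c" using c by (simp add: field_simps power2_eq_square)
  finally show ?thesis using c by (simp add: field_simps)
qed

lemma scalar_prod_sum:
  assumes "v \<in> carrier_vec d"
  shows "u \<bullet> v = (\<Sum>i<d. u $ i * v $ i)"
  using assms by (auto simp: scalar_prod_def atLeast0LessThan)

lemma bform_sum:
  assumes "H \<in> carrier_mat d d" "u \<in> carrier_vec d" "v \<in> carrier_vec d"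
  shows "bform H u v = (\<Sum>i<d. \<Sum>j<d. u $ i * H $$ (i, j) * v $ j)"
  using assms
  by (simp add: bform_def scalar_prod_sum[of _ d] scalar_prod_def sum_distrib_left mult.assoc
      atLeast0LessThan)

lemma bform_add_left:
  assumes "H \<in> carrier_mat d d" "u \<in> carrier_vec d" "u' \<in> carrier_vec d" "v \<in> carrier_vec d"
  shows "bform H (u + u') v = bform H u v + bform H u' v"
  using assms by (simp add: bform_def add_scalar_prod_distrib[of _ d])

lemma bform_add_right:
  assumes "H \<in> carrier_mat d d" "u \<in> carrier_vec d" "u' \<in> carrier_vec d" "v \<in> carrier_vec d"
  shows "bform H v (u + u') = bform H v u + bform H v u'"
  using assms by (simp add: bform_def mult_add_distrib_mat_vec scalar_prod_add_distrib[of _ d])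

lemma bform_minus_right:
  assumes "H \<in> carrier_mat d d" "u \<in> carrier_vec d" "u' \<in> carrier_vec d" "v \<in> carrier_vec d"
  shows "bform H v (u - u') = bform H v u - bform H v u'"
  using assms by (simp add: bform_def mult_minus_distrib_mat_vec scalar_prod_minus_distrib[of _ d])

lemma bform_smult_left:
  assumes "H \<in> carrier_mat d d" "u \<in> carrier_vec d" "v \<in> carrier_vec d"
  shows "bform H (c \<cdot>\<^sub>v u) v = c * bform H u v"
  using assms by (simp add: bform_def)

lemma bform_smult_right:
  assumes "H \<in> carrier_mat d d" "u \<in> carrier_vec d" "v \<in> carrier_vec d"
  shows "bform H u (c \<cdot>\<^sub>v v) = c * bform H u v"
  using assms by (simp add: bform_def mult_mat_vec)

lemma bform_add_mat:
  assumes "H \<in> carrier_mat d d" "G \<in> carrier_mat d d" "u \<in> carrier_vec d" "v \<in> carrier_vec d"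
  shows "bform (H + G) u v = bform H u v + bform G u v"
  using assms by (simp add: bform_sum[of _ d] algebra_simps sum.distrib)

lemma bform_smult_mat:
  assumes "H \<in> carrier_mat d d" "u \<in> carrier_vec d" "v \<in> carrier_vec d"
  shows "bform (c \<cdot>\<^sub>m H) u v = c * bform H u v"
  using assms by (simp add: bform_sum[of _ d] sum_distrib_left algebra_simps)

lemma bform_one: "u \<in> carrier_vec d \<Longrightarrow> v \<in> carrier_vec d \<Longrightarrow> bform (1\<^sub>m d) u v = u \<bullet> v"
  by (simp add: bform_def)

lemma bform_unit:
  assumes "H \<in> carrier_mat d d" "i < d" "j < d"
  shows "bform H (unit_vec d i) (unit_vec d j) = H $$ (i, j)"
  using assms by (simp add: bform_def scalar_prod_left_unit[of _ d])

definition sym_form :: "nat \<Rightarrow> real mat \<Rightarrow> bool" where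
  "sym_form d H \<longleftrightarrow> H \<in> carrier_mat d d \<and>
     (\<forall>u\<in>carrier_vec d. \<forall>v\<in>carrier_vec d. bform H u v = bform H v u)"

lemma sym_form_carrier: "sym_form d H \<Longrightarrow> H \<in> carrier_mat d d"
  by (simp add: sym_form_def)

lemma bform_commute:
  "sym_form d H \<Longrightarrow> u \<in> carrier_vec d \<Longrightarrow> v \<in> carrier_vec d \<Longrightarrow> bform H u v = bform H v u"
  by (simp add: sym_form_def)

lemma bform_square_add:
  assumes "sym_form d H" "u \<in> carrier_vec d" "v \<in> carrier_vec d"
  shows "bform H (u + s \<cdot>\<^sub>v v) (u + s \<cdot>\<^sub>v v) = bform H u u + 2 * bform H u v * s + bform H v v * s\<^sup>2"
proof -
  have "bform H (u + s \<cdot>\<^sub>v v) (u + s \<cdot>\<^sub>v v)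
      = bform H u u + s * bform H u v + (s * bform H v u + s * (s * bform H v v))"
    using assms sym_form_carrier[OF assms(1)]
    by (simp add: bform_add_left[of _ d] bform_add_right[of _ d] bform_smult_left[of _ d]
        bform_smult_right[of _ d] algebra_simps)
  thus ?thesis using bform_commute[OF assms(1), of v u] assms
    by (simp add: algebra_simps power2_eq_square)
qed

lemma bform_Cauchy_Schwarz:
  assumes "sym_form d H" "\<And>v. v \<in> carrier_vec d \<Longrightarrow> 0 \<le> bform H v v"
    and "u \<in> carrier_vec d" "v \<in> carrier_vec d"
  shows "(bform H u v)\<^sup>2 \<le> bform H u u * bform H v v"
proof (rule discriminant_bound)
  fix t
  have "u + t \<cdot>\<^sub>v v \<in> carrier_vec d" using assms by simp
  from assms(2)[OF this] show "0 \<le> bform H u u + 2 * bform H u v * t + bform H v v * t\<^sup>2"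
    by (simp add: bform_square_add[OF assms(1,3,4)])
qed

text \<open>The constant \<open>l\<close> is explicit because it survives updates and bounds the
  dual norm. Positivity of the determinant is carried along as a component: it gives invertibility
  and a meaningful \<open>ln det\<close>, and the rank-one determinant formula preserves it, which
  takes the place of a spectral argument.\<close>

definition pos_def :: "nat \<Rightarrow> real \<Rightarrow> real mat \<Rightarrow> bool" where
  "pos_def d l H \<longleftrightarrow> sym_form d H \<and> 0 < l \<and> 0 < rmat_det H \<and>
     (\<forall>v\<in>carrier_vec d. l * (v \<bullet> v) \<le> bform H v v)"

lemma scalar_prod_self_nonneg: "0 \<le> (v :: real Matrix.vec) \<bullet> v"
  by (simp add: scalar_prod_def sum_nonneg)

lemma scalar_Cauchy_Schwarz:
  assumes "u \<in> carrier_vec d" "v \<in> carrier_vec d"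
  shows "(u \<bullet> v)\<^sup>2 \<le> (u \<bullet> u) * (v \<bullet> (v :: real Matrix.vec))"
proof -
  have s: "sym_form d (1\<^sub>m d)"
    unfolding sym_form_def by (auto simp: bform_one intro: comm_scalar_prod)
  show ?thesis
    using bform_Cauchy_Schwarz[OF s _ assms] assms scalar_prod_self_nonneg
    by (simp add: bform_one)
qed

context
  fixes d l H assumes H: "pos_def d l H"
begin

lemma pos_def_sym: "sym_form d H" using H by (simp add: pos_def_def)
lemma pos_def_carrier: "H \<in> carrier_mat d d" using pos_def_sym by (rule sym_form_carrier)
lemma pos_def_pos: "0 < l" using H by (simp add: pos_def_def)
lemma pos_def_det: "0 < rmat_det H" using H by (simp add: pos_def_def)
lemma pos_def_lower: "v \<in> carrier_vec d \<Longrightarrow> l * (v \<bullet> v) \<le> bform H v v"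
  using H by (simp add: pos_def_def)
lemma pos_def_nonneg: "v \<in> carrier_vec d \<Longrightarrow> 0 \<le> bform H v v"
  using pos_def_lower[of v] pos_def_pos scalar_prod_self_nonneg[of v]
  by (meson mult_nonneg_nonneg less_imp_le order_trans)

lemma pos_def_inverse:
  "the (mat_inverse H) \<in> carrier_mat d d" "H * the (mat_inverse H) = 1\<^sub>m d"
proof -
  have "H \<in> Units (ring_mat TYPE(real) d ())"
    using det_non_zero_imp_unit[OF pos_def_carrier] pos_def_det by simp
  then obtain B where "mat_inverse H = Some B"
    using mat_inverse(1)[OF pos_def_carrier, of "()"] by (cases "mat_inverse H") auto
  from mat_inverse(2)[OF pos_def_carrier this] this
  show "the (mat_inverse H) \<in> carrier_mat d d" "H * the (mat_inverse H) = 1\<^sub>m d"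
    by auto
qed

end

section \<open>The dual norm given by the inverse matrix\<close>

definition isq :: "real mat \<Rightarrow> real Matrix.vec \<Rightarrow> real" where
  "isq H z = bform (the (mat_inverse H)) z z"

lemma inv_norm_isq: "inv_norm H z = sqrt (isq H z)"
  by (simp add: inv_norm_def isq_def bform_def)

context
  fixes d l H assumes H: "pos_def d l H"
begin

text \<open>With \<open>y\<close> the preimage of \<open>z\<close> under \<open>H\<close>, the dual
  norm of \<open>z\<close> is the \<open>H\<close>-norm of \<open>y\<close>. Later arguments apply
  Cauchy-Schwarz for \<open>H\<close> to this vector in place of computing with the inverse.\<close>

lemma isq_dual:
  assumes z: "z \<in> carrier_vec d"
  obtains y where "y \<in> carrier_vec d" "H *\<^sub>v y = z" "isq H z = z \<bullet> y" "isq H z = bform H y y"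
proof -
  define B where "B = the (mat_inverse H)"
  have B: "B \<in> carrier_mat d d" "H * B = 1\<^sub>m d"
    using pos_def_inverse[OF H] by (auto simp: B_def)
  define y where "y = B *\<^sub>v z"
  have y: "y \<in> carrier_vec d" using B z by (auto simp: y_def)
  have Hy: "H *\<^sub>v y = z"
    unfolding y_def using assoc_mult_mat_vec[OF pos_def_carrier[OF H] B(1) z] B z by simp
  have 1: "isq H z = z \<bullet> y" by (simp add: isq_def bform_def y_def B_def)
  have "bform H y y = y \<bullet> z" by (simp add: bform_def Hy)
  also have "\<dots> = z \<bullet> y" using y z by (rule comm_scalar_prod)
  finally show ?thesis using that y Hy 1 by simp
qed

lemma isq_nonneg: "z \<in> carrier_vec d \<Longrightarrow> 0 \<le> isq H z"
  by (metis isq_dual pos_def_nonneg[OF H])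

lemma isq_Cauchy_Schwarz:
  assumes z: "z \<in> carrier_vec d" and v: "v \<in> carrier_vec d"
  shows "(z \<bullet> v)\<^sup>2 \<le> isq H z * bform H v v"
proof -
  obtain y where y: "y \<in> carrier_vec d" "H *\<^sub>v y = z" "isq H z = bform H y y"
    using isq_dual[OF z] by metis
  have "z \<bullet> v = v \<bullet> z" using z v by (rule comm_scalar_prod)
  also have "\<dots> = bform H v y" by (simp add: bform_def y)
  also have "\<dots> = bform H y v" using bform_commute[OF pos_def_sym[OF H]] y v by simp
  finally show ?thesis
    using bform_Cauchy_Schwarz[OF pos_def_sym[OF H] pos_def_nonneg[OF H] y(1) v] y by simp
qed

text \<open>Cauchy-Schwarz for \<open>z\<close> and its preimage \<open>y\<close>, combined with
  \<open>l * (y \<bullet> y) \<le> isq H z\<close>, is quadratic in \<open>isq H z\<close> on the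
  left and linear on the right; one factor cancels.\<close>

lemma isq_upper:
  assumes z: "z \<in> carrier_vec d"
  shows "isq H z \<le> (z \<bullet> z) / l"
proof -
  obtain y where y: "y \<in> carrier_vec d" "isq H z = z \<bullet> y" "isq H z = bform H y y"
    using isq_dual[OF z] by metis
  have l: "0 < l" using pos_def_pos[OF H] .
  have 1: "l * (y \<bullet> y) \<le> isq H z" using pos_def_lower[OF H y(1)] y by simp
  have "isq H z * (l * isq H z) = l * (z \<bullet> y)\<^sup>2" by (simp add: y(2) power2_eq_square)
  also have "\<dots> \<le> l * ((z \<bullet> z) * (y \<bullet> y))"
    using scalar_Cauchy_Schwarz[OF z y(1)] l by simp
  also have "\<dots> = (z \<bullet> z) * (l * (y \<bullet> y))" by simp
  also have "\<dots> \<le> (z \<bullet> z) * isq H z" using 1 scalar_prod_self_nonneg by (intro mult_left_mono) auto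
  finally have "isq H z * (l * isq H z) \<le> isq H z * (z \<bullet> z)" by (simp add: mult.commute)
  hence "isq H z = 0 \<or> l * isq H z \<le> z \<bullet> z"
    using isq_nonneg[OF z] by (auto simp: mult_le_cancel_left)
  thus ?thesis using l scalar_prod_self_nonneg[of z] by (auto simp: field_simps)
qed

text \<open>Young's inequality for dual norms. With \<open>e = eta K\<close> it charges the movement
  of the iterate to the negative quadratic term of the mirror step.\<close>

lemma linear_minus_quadratic_le:
  assumes z: "z \<in> carrier_vec d" and u: "u \<in> carrier_vec d" and e: "0 < e"
  shows "z \<bullet> u - bform H u u / (4 * e) \<le> e * isq H z"
proof -
  have a: "(z \<bullet> u)\<^sup>2 \<le> isq H z * bform H u u" using isq_Cauchy_Schwarz[OF z u] .
  have nn: "0 \<le> isq H z" "0 \<le> bform H u u" using isq_nonneg[OF z] pos_def_nonneg[OF H u] by auto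
  have "z \<bullet> u \<le> sqrt (isq H z * bform H u u)" by (rule real_le_rsqrt[OF a])
  also have "\<dots> = sqrt ((2 * e * isq H z) * (bform H u u / (2*e)))" using e by simp
  also have "\<dots> \<le> (2 * e * isq H z + bform H u u / (2*e)) / 2"
    using nn e by (intro arith_geo_mean_sqrt) auto
  also have "\<dots> = e * isq H z + bform H u u / (4 * e)" using e by (simp add: field_simps)
  finally show ?thesis by simp
qed

end

text \<open>Two triangular factorisations of the block matrix with rows \<open>(1, y)\<close> and \<open>(-z, 1)\<close>.\<close>
lemma det_one_plus_rank_one:
  fixes y z :: "real Matrix.vec"
  assumes y: "y \<in> carrier_vec d" and z: "z \<in> carrier_vec d"
  shows "rmat_det (Matrix.mat d d (\<lambda>(a, b). (if a = b then 1 else 0) + y $ a * z $ b)) = 1 + z \<bullet> y"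
proof -
  define Y where "Y = Matrix.mat d 1 (\<lambda>(a, _). y $ a)"
  define Z where "Z = Matrix.mat 1 d (\<lambda>(_, b). - z $ b)"
  define R where "R = Matrix.mat d d (\<lambda>(a, b). (if a = b then 1 else 0) + y $ a * z $ b)"
  define c where "c = Matrix.mat 1 1 (\<lambda>_. 1 + z \<bullet> y)"
  have car: "Y \<in> carrier_mat d 1" "Z \<in> carrier_mat 1 d" "R \<in> carrier_mat d d" "c \<in> carrier_mat 1 1"
    by (auto simp: Y_def Z_def R_def c_def)
  have YZ: "Y * Z = Matrix.mat d d (\<lambda>(a, b). - (y $ a * z $ b))"
    by (rule eq_matI) (auto simp: Y_def Z_def scalar_prod_def)
  have ZY: "Z * Y = Matrix.mat 1 1 (\<lambda>_. - (z \<bullet> y))"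
    using y z by (intro eq_matI) (auto simp: Y_def Z_def scalar_prod_def sum_negf)
  have RYZ: "R + Y * Z = 1\<^sub>m d" unfolding YZ by (rule eq_matI) (auto simp: R_def)
  have ZYc: "Z * Y + c = 1\<^sub>m 1" unfolding ZY by (rule eq_matI) (auto simp: c_def)
  have 1: "four_block_mat (1\<^sub>m d) (0\<^sub>m d 1) Z (1\<^sub>m 1) * four_block_mat (1\<^sub>m d) Y (0\<^sub>m 1 d) c
      = four_block_mat (1\<^sub>m d) Y Z (1\<^sub>m 1)"
    using car by (subst mult_four_block_mat[of _ d d _ 1 _ 1 _ _ d _ 1]) (auto simp: ZYc)
  have 2: "four_block_mat R Y (0\<^sub>m 1 d) (1\<^sub>m 1) * four_block_mat (1\<^sub>m d) (0\<^sub>m d 1) Z (1\<^sub>m 1)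
      = four_block_mat (1\<^sub>m d) Y Z (1\<^sub>m 1)"
    using car by (subst mult_four_block_mat[of _ d d _ 1 _ 1 _ _ d _ 1]) (auto simp: RYZ)
  have L: "rmat_det (four_block_mat (1\<^sub>m d) (0\<^sub>m d 1) Z (1\<^sub>m 1)) = 1"
    using car by (subst det_four_block_mat_upper_right_zero[of _ d _ 1]) auto
  have U: "rmat_det (four_block_mat (1\<^sub>m d) Y (0\<^sub>m 1 d) c) = rmat_det c"
    using car by (subst det_four_block_mat_lower_left_zero[of _ d _ 1]) auto
  have V: "rmat_det (four_block_mat R Y (0\<^sub>m 1 d) (1\<^sub>m 1)) = rmat_det R"
    using car by (subst det_four_block_mat_lower_left_zero[of _ d _ 1]) auto
  have fb: "four_block_mat (1\<^sub>m d) (0\<^sub>m d 1) Z (1\<^sub>m 1) \<in> carrier_mat (d + 1) (d + 1)"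
     "four_block_mat (1\<^sub>m d) Y (0\<^sub>m 1 d) c \<in> carrier_mat (d + 1) (d + 1)"
     "four_block_mat R Y (0\<^sub>m 1 d) (1\<^sub>m 1) \<in> carrier_mat (d + 1) (d + 1)"
    using car by (auto simp: four_block_carrier_mat)
  have "rmat_det c = rmat_det (four_block_mat (1\<^sub>m d) Y Z (1\<^sub>m 1))"
    unfolding 1[symmetric] det_mult[OF fb(1,2)] L U by simp
  also have "\<dots> = rmat_det R"
    unfolding 2[symmetric] det_mult[OF fb(3,1)] L V by simp
  finally have "rmat_det R = rmat_det c" by simp
  also have "rmat_det c = 1 + z \<bullet> y" using det_single[of c] by (simp add: c_def)
  finally show ?thesis by (simp add: R_def)
qed

section \<open>Rank-one updates and the growth of the log-determinant\<close>

definition rank1_update :: "nat \<Rightarrow> real mat \<Rightarrow> real \<Rightarrow> real Matrix.vec \<Rightarrow> real mat" where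
  "rank1_update d H c z = Matrix.mat d d (\<lambda>(a, b). H $$ (a, b) + c * z $ a * z $ b)"

lemma bform_rank1_update:
  assumes "H \<in> carrier_mat d d" "z \<in> carrier_vec d" "u \<in> carrier_vec d" "v \<in> carrier_vec d"
  shows "bform (rank1_update d H c z) u v = bform H u v + c * (z \<bullet> u) * (z \<bullet> v)"
proof -
  have car: "rank1_update d H c z \<in> carrier_mat d d" by (simp add: rank1_update_def)
  have "bform (rank1_update d H c z) u v = (\<Sum>i<d. \<Sum>j<d. u $ i * H $$ (i, j) * v $ j)
     + (\<Sum>i<d. \<Sum>j<d. c * ((z $ i * u $ i) * (z $ j * v $ j)))"
    unfolding bform_sum[OF car assms(3,4)] sum.distrib[symmetric]
    by (intro sum.cong refl) (simp add: rank1_update_def algebra_simps)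
  also have "(\<Sum>i<d. \<Sum>j<d. c * ((z $ i * u $ i) * (z $ j * v $ j))) = c * (z \<bullet> u) * (z \<bullet> v)"
    using assms by (simp add: scalar_prod_sum[of _ d] sum_product sum_distrib_left
        sum_distrib_right mult_ac)
  finally show ?thesis using bform_sum[OF assms(1,3,4)] by simp
qed

text \<open>Factor \<open>H + c z z^T\<close> as \<open>H (I + c y z^T)\<close> with
  \<open>H y = z\<close>; the second factor is covered by
  \<open>det_one_plus_rank_one\<close>.\<close>

lemma det_rank1_update:
  assumes H: "pos_def d l H" and z: "z \<in> carrier_vec d"
  shows "rmat_det (rank1_update d H c z) = rmat_det H * (1 + c * isq H z)"
proof -
  obtain y where y: "y \<in> carrier_vec d" "H *\<^sub>v y = z" "isq H z = z \<bullet> y"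
    using isq_dual[OF H z] by metis
  have Hc: "H \<in> carrier_mat d d" using pos_def_carrier[OF H] .
  define R where "R = Matrix.mat d d (\<lambda>(a, b). (if a = b then 1 else 0) + (c \<cdot>\<^sub>v y) $ a * z $ b)"
  have R: "R \<in> carrier_mat d d" by (simp add: R_def)
  have "rank1_update d H c z = H * R"
  proof (rule eq_matI)
    fix i j assume ij: "i < dim_row (H * R)" "j < dim_col (H * R)"
    hence ij': "i < d" "j < d" using Hc R by auto
    have "(H * R) $$ (i, j) = (\<Sum>k<d. H $$ (i, k) * ((if k = j then 1 else 0) + c * y $ k * z $ j))"
      using ij' Hc y(1) by (auto simp: R_def scalar_prod_def atLeast0LessThan intro!: sum.cong)
    also have "\<dots> = (\<Sum>k<d. (if k = j then H $$ (i, k) else 0)) + c * (\<Sum>k<d. H $$ (i, k) * y $ k) * z $ j"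
      by (simp add: distrib_left sum.distrib sum_distrib_left sum_distrib_right mult_ac
          if_distrib[of "\<lambda>x. _ * x"] cong: if_cong)
    also have "(\<Sum>k<d. (if k = j then H $$ (i, k) else 0)) = H $$ (i, j)"
      using ij' by simp
    also have "(\<Sum>k<d. H $$ (i, k) * y $ k) = z $ i"
      unfolding y(2)[symmetric] using ij' Hc y(1)
      by (auto simp: scalar_prod_def atLeast0LessThan intro!: sum.cong)
    finally show "rank1_update d H c z $$ (i, j) = (H * R) $$ (i, j)"
      using ij' by (simp add: rank1_update_def)
  qed (use Hc R in \<open>auto simp: rank1_update_def\<close>)
  hence "rmat_det (rank1_update d H c z) = rmat_det H * rmat_det R"
    using det_mult[OF Hc R] by simp
  also have "rmat_det R = 1 + z \<bullet> (c \<cdot>\<^sub>v y)"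
    unfolding R_def using y z by (intro det_one_plus_rank_one) auto
  also have "z \<bullet> (c \<cdot>\<^sub>v y) = c * isq H z" using y z by simp
  finally show ?thesis .
qed

lemma pos_def_rank1_update:
  assumes H: "pos_def d l H" and z: "z \<in> carrier_vec d" and c: "0 \<le> c"
  shows "pos_def d l (rank1_update d H c z)"
proof -
  have Hc: "H \<in> carrier_mat d d" using pos_def_carrier[OF H] .
  have "0 < rmat_det (rank1_update d H c z)"
    unfolding det_rank1_update[OF H z] using pos_def_det[OF H] isq_nonneg[OF H z] c
    by (intro mult_pos_pos add_pos_nonneg) auto
  moreover have "l * (v \<bullet> v) \<le> bform (rank1_update d H c z) v v" if v: "v \<in> carrier_vec d" for v
    unfolding bform_rank1_update[OF Hc z v v] using pos_def_lower[OF H v] c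
    by (simp add: add_increasing2 mult.assoc)
  moreover have "sym_form d (rank1_update d H c z)"
    unfolding sym_form_def using Hc z bform_commute[OF pos_def_sym[OF H]]
    by (auto simp: bform_rank1_update[of _ d]) (auto simp: rank1_update_def)
  ultimately show ?thesis using pos_def_pos[OF H] by (simp add: pos_def_def)
qed

text \<open>Inversion reverses the order of forms. Cauchy-Schwarz in \<open>H'\<close> is tested on
  the \<open>H\<close>-preimage of \<open>z\<close>, and one factor \<open>isq H z\<close>
  cancels.\<close>

lemma isq_antimono:
  assumes H: "pos_def d l H" and H': "pos_def d l' H'" and z: "z \<in> carrier_vec d" and r: "0 \<le> r"
    and le: "\<And>v. v \<in> carrier_vec d \<Longrightarrow> bform H' v v \<le> r * bform H v v"
  shows "isq H z \<le> r * isq H' z"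
proof -
  obtain y where y: "y \<in> carrier_vec d" "isq H z = z \<bullet> y" "isq H z = bform H y y"
    using isq_dual[OF H z] by metis
  have "isq H z * isq H z = (z \<bullet> y)\<^sup>2" by (simp add: y(2) power2_eq_square)
  also have "\<dots> \<le> isq H' z * bform H' y y" by (rule isq_Cauchy_Schwarz[OF H' z y(1)])
  also have "\<dots> \<le> isq H' z * (r * isq H z)"
    using le[OF y(1)] isq_nonneg[OF H' z] by (intro mult_left_mono) (auto simp: y(3))
  finally have "isq H z * isq H z \<le> isq H z * (r * isq H' z)" by (simp add: algebra_simps)
  thus ?thesis using isq_nonneg[OF H z] isq_nonneg[OF H' z] r
    by (cases "isq H z = 0") (auto simp: mult_le_cancel_left)
qed

text \<open>The head of the list is the update applied last, so the tail yields the matrix just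
  before it; this is the shape the telescoping of \<open>ln det\<close> needs.\<close>

primrec rank1_updates :: "nat \<Rightarrow> real mat \<Rightarrow> (real \<times> real Matrix.vec) list \<Rightarrow> real mat" where
  "rank1_updates d H [] = H"
| "rank1_updates d H (cz # L) = rank1_update d (rank1_updates d H L) (fst cz) (snd cz)"

lemma rank1_updates:
  assumes H: "pos_def d l H" and L: "\<And>c z. (c, z) \<in> set L \<Longrightarrow> 0 \<le> c \<and> z \<in> carrier_vec d"
  shows "pos_def d l (rank1_updates d H L)"
    and "u \<in> carrier_vec d \<Longrightarrow> v \<in> carrier_vec d \<Longrightarrow>
      bform (rank1_updates d H L) u v = bform H u v + (\<Sum>(c, z)\<leftarrow>L. c * (z \<bullet> u) * (z \<bullet> v))"
proof -
  have "pos_def d l (rank1_updates d H L) \<and> (\<forall>u\<in>carrier_vec d. \<forall>v\<in>carrier_vec d.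
      bform (rank1_updates d H L) u v = bform H u v + (\<Sum>(c, z)\<leftarrow>L. c * (z \<bullet> u) * (z \<bullet> v)))"
    using L
  proof (induction L)
    case (Cons cz L)
    obtain c z where cz: "cz = (c, z)" by force
    have "0 \<le> c" "z \<in> carrier_vec d" using Cons.prems[of c z] by (auto simp: cz)
    moreover have IH: "pos_def d l (rank1_updates d H L)"
        "\<forall>u\<in>carrier_vec d. \<forall>v\<in>carrier_vec d. bform (rank1_updates d H L) u v
          = bform H u v + (\<Sum>(c, z)\<leftarrow>L. c * (z \<bullet> u) * (z \<bullet> v))"
      using Cons.IH Cons.prems by auto
    ultimately show ?case
      by (simp add: cz pos_def_rank1_update bform_rank1_update[OF pos_def_carrier[OF IH(1)]])
  qed (use H in auto)
  thus "pos_def d l (rank1_updates d H L)"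
    and "u \<in> carrier_vec d \<Longrightarrow> v \<in> carrier_vec d \<Longrightarrow>
      bform (rank1_updates d H L) u v = bform H u v + (\<Sum>(c, z)\<leftarrow>L. c * (z \<bullet> u) * (z \<bullet> v))"
    by auto
qed

text \<open>All terms are measured in the initial \<open>H\<close>, although the determinant grows
  through the intermediate matrices. The factor \<open>r\<close> converts between these norms, and
  \<open>1 + q\<close> covers the gap between \<open>x\<close> and \<open>ln (1 + x)\<close> for
  \<open>0 \<le> x \<le> q\<close>.\<close>

lemma ln_det_rank1_updates_ge:
  assumes H: "pos_def d l H" and L: "\<And>c z. (c, z) \<in> set L \<Longrightarrow> 0 \<le> c \<and> z \<in> carrier_vec d"
    and r: "1 \<le> r" and q: "0 \<le> q"
    and le: "\<And>v. v \<in> carrier_vec d \<Longrightarrow> bform (rank1_updates d H L) v v \<le> r * bform H v v"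
    and small: "\<And>c z. (c, z) \<in> set L \<Longrightarrow> c * (z \<bullet> z) \<le> q * l"
  shows "(\<Sum>(c, z)\<leftarrow>L. c * isq H z) \<le> r * (1 + q) * (ln (rmat_det (rank1_updates d H L)) - ln (rmat_det H))"
  using L le small
proof (induction L)
  case (Cons cz L)
  obtain c z where cz: "cz = (c, z)" by force
  have c: "0 \<le> c" and z: "z \<in> carrier_vec d" using Cons.prems(1)[of c z] by (auto simp: cz)
  have L': "(c, z) \<in> set L \<Longrightarrow> 0 \<le> c \<and> z \<in> carrier_vec d" for c z
    using Cons.prems(1)[of c z] by simp
  define H1 where "H1 = rank1_updates d H L"
  have H1: "pos_def d l H1" using rank1_updates(1)[OF H L'] by (simp add: H1_def)
  \<comment> \<open>Later updates only add nonnegative terms, so the bound assumed of the final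
    matrix is inherited by the intermediate ones.\<close>
  have le1: "bform H1 v v \<le> r * bform H v v" if v: "v \<in> carrier_vec d" for v
  proof -
    have "bform (rank1_updates d H (cz # L)) v v = bform H1 v v + c * (z \<bullet> v) * (z \<bullet> v)"
      by (simp add: cz H1_def[symmetric] bform_rank1_update[OF pos_def_carrier[OF H1] z v v])
    moreover have "0 \<le> c * (z \<bullet> v) * (z \<bullet> v)" using c by (simp add: mult.assoc)
    ultimately show ?thesis using Cons.prems(2)[OF v] by linarith
  qed
  have IH: "(\<Sum>(c, z)\<leftarrow>L. c * isq H z) \<le> r * (1 + q) * (ln (rmat_det H1) - ln (rmat_det H))"
    using Cons.IH[OF L' le1[unfolded H1_def]] Cons.prems(3) by (simp add: H1_def)
  define x where "x = c * isq H1 z"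
  have x0: "0 \<le> x" using c isq_nonneg[OF H1 z] by (simp add: x_def)
  have xq: "x \<le> q"
  proof -
    have "x \<le> c * ((z \<bullet> z) / l)" unfolding x_def using isq_upper[OF H1 z] c by (intro mult_left_mono) auto
    also have "\<dots> \<le> q" using Cons.prems(3)[of c z] pos_def_pos[OF H] by (simp add: cz field_simps)
    finally show ?thesis .
  qed
  have "c * isq H z \<le> c * (r * isq H1 z)"
    using isq_antimono[OF H H1 z _ le1] r c by (intro mult_left_mono) auto
  also have "\<dots> = r * x" by (simp add: x_def)
  also have "\<dots> \<le> r * ((1 + q) * ln (1 + x))"
  proof -
    have "ln (1 / (1 + x)) \<le> 1 / (1 + x) - 1" using x0 by (intro ln_le_minus_one) auto
    hence "x / (1 + x) \<le> ln (1 + x)" using x0 by (simp add: ln_div field_simps)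
    hence "x \<le> (1 + x) * ln (1 + x)" using x0 by (simp add: field_simps)
    also have "\<dots> \<le> (1 + q) * ln (1 + x)" using x0 xq by (intro mult_right_mono) auto
    finally show ?thesis using r by simp
  qed
  also have "ln (1 + x) = ln (rmat_det (rank1_update d H1 c z)) - ln (rmat_det H1)"
    unfolding det_rank1_update[OF H1 z] x_def[symmetric] using pos_def_det[OF H1] x0
    by (simp add: ln_mult)
  finally have "c * isq H z \<le> r * (1 + q) * (ln (rmat_det (rank1_update d H1 c z)) - ln (rmat_det H1))"
    by simp
  with IH have "c * isq H z + (\<Sum>(c, z)\<leftarrow>L. c * isq H z) \<le>
     r * (1 + q) * (ln (rmat_det (rank1_update d H1 c z)) - ln (rmat_det H1)) + r * (1 + q) * (ln (rmat_det H1) - ln (rmat_det H))"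
    by linarith
  also have "\<dots> = r * (1 + q) * (ln (rmat_det (rank1_update d H1 c z)) - ln (rmat_det H))"
    by (simp add: algebra_simps)
  finally show ?case by (simp add: cz H1_def)
qed simp

lemma bform_eqI:
  assumes "A \<in> carrier_mat d d" "B \<in> carrier_mat d d"
    "\<And>u v. u \<in> carrier_vec d \<Longrightarrow> v \<in> carrier_vec d \<Longrightarrow> bform A u v = bform B u v"
  shows "A = B"
proof (rule eq_matI)
  fix i j assume "i < dim_row B" "j < dim_col B"
  hence "i < d" "j < d" using assms by auto
  thus "A $$ (i, j) = B $$ (i, j)"
    using assms(3)[of "unit_vec d i" "unit_vec d j"] assms(1,2) by (simp add: bform_unit)
qed (use assms in auto)

text \<open>
  A Cholesky elimination completes \<open>H\<close> to a multiple of the identity by rank-one updates, which can only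
  increase the determinant; after the step for index \<open>k\<close> the rows from \<open>k\<close> on are those of that multiple.
\<close>
lemma det_le_power:
  assumes H: "pos_def d l H" and le: "\<And>v. v \<in> carrier_vec d \<Longrightarrow> bform H v v \<le> c * (v \<bullet> v)"
  shows "rmat_det H \<le> c ^ d"
proof -
  have "rmat_det H \<le> c ^ d" if "k \<le> d" "pos_def d l H"
     "\<And>v. v \<in> carrier_vec d \<Longrightarrow> bform H v v \<le> c * (v \<bullet> v)"
     "\<And>i j. i < d \<Longrightarrow> j < d \<Longrightarrow> k \<le> i \<Longrightarrow> H $$ (i, j) = (if i = j then c else 0)" for k H
    using that
  proof (induction k arbitrary: H)
    case 0
    have "H = c \<cdot>\<^sub>m 1\<^sub>m d"
      using 0(4) pos_def_carrier[OF 0(2)] by (intro eq_matI) auto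
    thus ?case by simp
  next
    case (Suc k)
    note H = Suc.prems(2)
    have Hc: "H \<in> carrier_mat d d" using pos_def_carrier[OF H] .
    \<comment> \<open>The semidefinite defect between \<open>H\<close> and the target multiple of
      the identity, to be removed row by row.\<close>
    define A where "A = c \<cdot>\<^sub>m 1\<^sub>m d + (-1) \<cdot>\<^sub>m H"
    have Ac: "A \<in> carrier_mat d d" using Hc by (simp add: A_def)
    have Ab: "bform A u v = c * (u \<bullet> v) - bform H u v"
      if "u \<in> carrier_vec d" "v \<in> carrier_vec d" for u v
      using that Hc by (simp add: A_def bform_add_mat[of _ d] bform_smult_mat[of _ d] bform_one)
    have As: "sym_form d A"
      unfolding sym_form_def using Ac Ab bform_commute[OF pos_def_sym[OF H]]
      by (auto simp: comm_scalar_prod[of _ d])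
    have Ann: "0 \<le> bform A v v" if "v \<in> carrier_vec d" for v
      using Suc.prems(3)[OF that] that by (simp add: Ab)
    have CS: "(bform A u v)\<^sup>2 \<le> bform A u u * bform A v v"
      if "u \<in> carrier_vec d" "v \<in> carrier_vec d" for u v
      using bform_Cauchy_Schwarz[OF As Ann that] .
    define e :: "real Matrix.vec" where "e = unit_vec d k"
    have kd: "k < d" using Suc.prems(1) by simp
    have e: "e \<in> carrier_vec d" by (simp add: e_def)
    define a where "a = bform A e e"
    have a0: "0 \<le> a" using Ann[OF e] by (simp add: a_def)
    define z where "z = A *\<^sub>v e"
    have z: "z \<in> carrier_vec d" using Ac e by (auto simp: z_def)
    have zb: "z \<bullet> v = bform A v e" if "v \<in> carrier_vec d" for v
      using z that by (simp add: bform_def z_def[symmetric] comm_scalar_prod[of _ d])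
    \<comment> \<open>A Schur complement step: subtracting \<open>z z^T / a\<close> from the defect
      clears its row \<open>k\<close>. If \<open>a = 0\<close>, division by zero makes the update
      trivial, and Cauchy-Schwarz shows that this row vanishes already.\<close>
    define H' where "H' = rank1_update d H (1 / a) z"
    have H': "pos_def d l H'" unfolding H'_def using a0 by (intro pos_def_rank1_update[OF H z]) simp
    have "rmat_det H * 1 \<le> rmat_det H * (1 + (1 / a) * isq H z)"
      using pos_def_det[OF H] isq_nonneg[OF H z] a0 by (intro mult_left_mono) auto
    hence "rmat_det H \<le> rmat_det H'" unfolding H'_def det_rank1_update[OF H z] by simp
    also have "rmat_det H' \<le> c ^ d"
    proof (rule Suc.IH[OF _ H'])
      show "k \<le> d" using kd by simp
    next
      fix v :: "real Matrix.vec" assume v: "v \<in> carrier_vec d"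
      \<comment> \<open>Cauchy-Schwarz for the defect against \<open>e\<close> says precisely that
        the remaining defect is still semidefinite.\<close>
      have "1 / a * (z \<bullet> v) * (z \<bullet> v) \<le> bform A v v"
        using CS[OF v e] a0 Ann[OF v] by (cases "a = 0") (auto simp: zb[OF v] a_def[symmetric] field_simps power2_eq_square)
      thus "bform H' v v \<le> c * (v \<bullet> v)"
        using v by (simp add: H'_def bform_rank1_update[OF Hc z v v] Ab)
    next
      fix i j assume ij: "i < d" "j < d" "k \<le> i"
      have ui: "unit_vec d i \<in> carrier_vec d" "unit_vec d j \<in> carrier_vec d" by auto
      have zi: "z $ i = bform A (unit_vec d i) e"
        using zb[OF ui(1)] ij z by (simp add: scalar_prod_right_unit)
      have zj: "z $ j = bform A e (unit_vec d j)"
        using zb[OF ui(2)] ij z bform_commute[OF As ui(2) e] by (simp add: scalar_prod_right_unit)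
      have Aij: "bform A (unit_vec d i) (unit_vec d j) = (if i = j then c else 0) - H $$ (i, j)"
        using Ab[OF ui] ij Hc by (auto simp: bform_unit)
      have Hij: "H' $$ (i, j) = H $$ (i, j) + 1 / a * z $ i * z $ j"
        using ij by (simp add: H'_def rank1_update_def)
      have "1 / a * z $ i * z $ j = bform A (unit_vec d i) (unit_vec d j)"
      proof (cases "i = k")
        case True
        hence zi': "z $ i = a" using zi by (simp add: a_def e_def)
        have Aj: "bform A (unit_vec d i) (unit_vec d j) = z $ j" using True zj by (simp add: e_def)
        show ?thesis
        proof (cases "a = 0")
          case True
          have "(z $ j)\<^sup>2 \<le> 0" using CS[OF e ui(2)] True by (simp add: zj a_def[symmetric])
          thus ?thesis using True Aj by simp
        qed (use zi' Aj in simp)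
      next
        case False
        \<comment> \<open>Row \<open>i\<close> of the defect was cleared earlier, and the update
          leaves it alone because \<open>z $ i = 0\<close>.\<close>
        hence i: "Suc k \<le> i" using ij by simp
        have "z $ i = (if i = k then c else 0) - H $$ (i, k)"
          using zi Ab[OF ui(1) e] ij kd Hc unfolding e_def by (auto simp: bform_unit)
        hence "z $ i = 0" using Suc.prems(4)[OF ij(1) kd i] False by simp
        moreover have "bform A (unit_vec d i) (unit_vec d j) = 0"
          using Aij Suc.prems(4)[OF ij(1,2) i] by simp
        ultimately show ?thesis by simp
      qed
      thus "H' $$ (i, j) = (if i = j then c else 0)" unfolding Hij Aij by simp
    qed
    finally show ?case .
  qed
  from this[of d H] H le show ?thesis by auto
qed

section \<open>Log-sum-exp and its Bregman divergence\<close>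

lemma exp_minus_lower_cubic:
  fixes s :: real
  assumes "0 \<le> s"
  shows "1 - s + s\<^sup>2 / 2 - s ^ 3 / 6 \<le> exp (- s)"
proof -
  define f0 where "f0 = (\<lambda>s::real. exp (-s) - (1 - s + s\<^sup>2 / 2 - s ^ 3 / 6))"
  have "f0 0 \<le> f0 s"
  proof (rule DERIV_nonneg_imp_nondecreasing[OF assms])
    fix x :: real assume "0 \<le> x"
    have "(f0 has_real_derivative (- exp (-x) + 1 - x + x\<^sup>2 / 2)) (at x)"
      unfolding f0_def by (auto intro!: derivative_eq_intros simp: power2_eq_square power3_eq_cube field_simps)
    moreover have "0 \<le> - exp (-x) + 1 - x + x\<^sup>2 / 2"
    proof -
      have e: "1 + x + x\<^sup>2 / 2 \<le> exp x" using exp_lower_Taylor_quadratic[OF \<open>0 \<le> x\<close>] .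
      have pos: "0 \<le> 1 - x + x\<^sup>2 / 2" using sum_power2_ge_zero[of "1 - x" 1]
        by (simp add: power2_eq_square algebra_simps)
      \<comment> \<open>The two quadratics multiply to at least 1, so the lower bound for
        \<open>exp x\<close> turns into the upper bound for \<open>exp (-x)\<close>.\<close>
      have "(1 - x + x\<^sup>2 / 2) * (1 + x + x\<^sup>2 / 2) = 1 + (x\<^sup>2)\<^sup>2 / 4"
        by (simp add: field_simps power2_eq_square)
      hence "1 \<le> (1 - x + x\<^sup>2 / 2) * (1 + x + x\<^sup>2 / 2)" by simp
      also have "\<dots> \<le> (1 - x + x\<^sup>2 / 2) * exp x" using e pos by (intro mult_left_mono) auto
      finally have "exp (-x) \<le> 1 - x + x\<^sup>2 / 2" by (simp add: exp_minus field_simps)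
      thus ?thesis by simp
    qed
    ultimately show "\<exists>y. (f0 has_real_derivative y) (at x) \<and> 0 \<le> y" by blast
  qed
  thus ?thesis by (simp add: f0_def)
qed

text \<open>For \<open>V \<ge> 0\<close> the quadratic Taylor bound suffices. With
  \<open>s = - V\<close>, the cubic bound gives the coefficient \<open>1/2 - s/6\<close>, at least
  \<open>1/4\<close> up to \<open>s = 3/2\<close>. Beyond that \<open>exp (- s)\<close> is dropped,
  which leaves the polynomial condition \<open>root\<close>.\<close>

lemma exp_remainder_ge:
  fixes V m c :: real
  assumes "- m \<le> V" "c \<le> 1 / 4"
    and root: "\<And>s. 3 / 2 \<le> s \<Longrightarrow> s \<le> m \<Longrightarrow> c * s\<^sup>2 \<le> s - 1"
  shows "c * V\<^sup>2 \<le> exp V - 1 - V"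
proof (cases "0 \<le> V")
  case True
  have "c * V\<^sup>2 \<le> V\<^sup>2 / 2" using assms(2) mult_right_mono[of c "1/2" "V\<^sup>2"] by simp
  thus ?thesis using exp_lower_Taylor_quadratic[OF True] by simp
next
  case False
  define s where "s = - V"
  have s: "0 \<le> s" "s \<le> m" using False assms(1) by (auto simp: s_def)
  show ?thesis
  proof (cases "s \<le> 3 / 2")
    case True
    have "c * s\<^sup>2 \<le> (1/2 - s / 6) * s\<^sup>2" using True assms(2) by (intro mult_right_mono) auto
    also have "\<dots> = s\<^sup>2 / 2 - s ^ 3 / 6" by (simp add: algebra_simps power2_eq_square power3_eq_cube)
    finally show ?thesis using exp_minus_lower_cubic[OF s(1)] by (simp add: s_def)
  next
    case False
    hence "c * s\<^sup>2 \<le> s - 1" using root s by simp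
    moreover have "0 \<le> exp (- s)" by simp
    ultimately have "c * s\<^sup>2 \<le> exp (- s) - 1 + s" by linarith
    thus ?thesis by (simp add: s_def)
  qed
qed

text \<open>\<open>3 / 16\<close> is \<open>(m - 1) / m^2\<close> at \<open>m = 4\<close>, the most
  that \<open>root\<close> allows there. Its reciprocal \<open>16 / 3\<close> is the lower bound for
  \<open>2 * eta 3\<close> that follows from \<open>ln 4 \<ge> 4/3\<close>.\<close>

lemma exp_remainder_ge_4: "-4 \<le> (V::real) \<Longrightarrow> 3 / 16 * V\<^sup>2 \<le> exp V - 1 - V"
proof (rule exp_remainder_ge[of 4])
  fix s :: real assume "3 / 2 \<le> s" "s \<le> 4"
  hence "0 \<le> (3 * s - 4) * (4 - s)" by (intro mult_nonneg_nonneg) auto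
  thus "3 / 16 * s\<^sup>2 \<le> s - 1" by (simp add: algebra_simps power2_eq_square)
qed auto

text \<open>The constant is dictated by its reciprocal: \<open>14 / 3\<close> is the lower bound for
  \<open>2 * eta 1\<close> that follows from \<open>ln 2 \<ge> 2/3\<close>.\<close>

lemma exp_remainder_ge_2: "-2 \<le> (V::real) \<Longrightarrow> 3 / 14 * V\<^sup>2 \<le> exp V - 1 - V"
proof (rule exp_remainder_ge[of 2])
  fix s :: real assume "3 / 2 \<le> s" "s \<le> 2"
  hence "0 \<le> (s - 3/2) * (2 - s)" by (intro mult_nonneg_nonneg) auto
  moreover have "(s - 3/2) * (2 - s) = 7/2 * s - 3 - s\<^sup>2" by (simp add: field_simps power2_eq_square)
  ultimately have "s\<^sup>2 \<le> 7/2 * s - 3" by linarith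
  thus "3 / 14 * s\<^sup>2 \<le> s - 1" using \<open>3 / 2 \<le> s\<close> by simp
qed auto

lemma exp_remainder_le:
  fixes V :: real
  assumes "\<bar>V\<bar> \<le> 1"
  shows "exp V - 1 - V \<le> V\<^sup>2"
proof (cases "0 \<le> V")
  case True
  thus ?thesis using exp_bound[of V] assms by simp
next
  case False
  define s where "s = - V"
  have s: "0 \<le> s" "s \<le> 1" using False assms by (auto simp: s_def)
  have e: "1 + s + s\<^sup>2 / 2 \<le> exp s" using exp_lower_Taylor_quadratic[OF s(1)] .
  have "1 \<le> (1 - s + s\<^sup>2) * (1 + s + s\<^sup>2 / 2)"
  proof -
    have "(1 - s + s\<^sup>2) * (1 + s + s\<^sup>2 / 2) = 1 + s\<^sup>2 / 2 + s^3 / 2 + s^4/2"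
      by (simp add: field_simps power2_eq_square power3_eq_cube power4_eq_xxxx)
    thus ?thesis using s by simp
  qed
  also have "\<dots> \<le> (1 - s + s\<^sup>2) * exp s" using e s by (intro mult_left_mono) auto
  finally have "exp V \<le> 1 - s + s\<^sup>2" by (simp add: exp_minus field_simps s_def)
  thus ?thesis by (simp add: s_def)
qed

section \<open>Softmax laws and the divergence of log-sum-exp\<close>

definition softmax :: "'i set \<Rightarrow> ('i \<Rightarrow> real) \<Rightarrow> ('i \<Rightarrow> real) \<Rightarrow> 'i \<Rightarrow> real" where
  "softmax I b \<theta> i = b i * exp (\<theta> i) / (\<Sum>j\<in>I. b j * exp (\<theta> j))"

definition lse :: "'i set \<Rightarrow> ('i \<Rightarrow> real) \<Rightarrow> ('i \<Rightarrow> real) \<Rightarrow> real" where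
  "lse I b \<theta> = ln (\<Sum>j\<in>I. b j * exp (\<theta> j))"

definition lse_bregman :: "'i set \<Rightarrow> ('i \<Rightarrow> real) \<Rightarrow> ('i \<Rightarrow> real) \<Rightarrow> ('i \<Rightarrow> real) \<Rightarrow> real" where
  "lse_bregman I b \<theta>' \<theta> = lse I b \<theta>' - lse I b \<theta> - (\<Sum>i\<in>I. softmax I b \<theta> i * (\<theta>' i - \<theta> i))"

locale choice_model =
  fixes I :: "'i set" and b :: "'i \<Rightarrow> real"
  assumes fin: "finite I" and ne: "I \<noteq> {}" and b_pos: "i \<in> I \<Longrightarrow> 0 < b i"
begin

abbreviation "p \<equiv> softmax I b"
abbreviation "D \<equiv> lse_bregman I b"

lemma Z_pos: "0 < (\<Sum>j\<in>I. b j * exp (\<theta> j))"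
  using fin ne b_pos by (intro sum_pos) auto

lemma p_pos: "i \<in> I \<Longrightarrow> 0 < p \<theta> i"
  using Z_pos[of \<theta>] b_pos by (simp add: softmax_def)

lemma p_sum: "(\<Sum>i\<in>I. p \<theta> i) = 1"
  using Z_pos[of \<theta>] by (simp add: softmax_def sum_divide_distrib[symmetric])

lemma p_le_1: "i \<in> I \<Longrightarrow> p \<theta> i \<le> 1"
  unfolding p_sum[of \<theta>, symmetric] using fin p_pos[THEN less_imp_le] by (intro member_le_sum) auto

lemma p_ratio:
  assumes "i \<in> I"
  shows "p \<theta>' i = p \<theta> i * exp (\<theta>' i - \<theta> i - (lse I b \<theta>' - lse I b \<theta>))"
  using Z_pos[of \<theta>'] Z_pos[of \<theta>]
  by (simp add: softmax_def lse_def exp_diff exp_minus)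

lemma ln_p: "i \<in> I \<Longrightarrow> ln (p \<theta> i) = ln (b i) + \<theta> i - lse I b \<theta>"
  using Z_pos[of \<theta>] b_pos[of i] by (simp add: softmax_def lse_def ln_div ln_mult)

text \<open>Under the law at the base point, \<open>exp V\<close> has mean 1 because the new
  probabilities sum to 1, and \<open>V\<close> has mean \<open>- D\<close>.\<close>

lemma D_eq:
  defines "V \<equiv> \<lambda>\<theta>' \<theta> i. \<theta>' i - \<theta> i - (lse I b \<theta>' - lse I b \<theta>)"
  shows "D \<theta>' \<theta> = (\<Sum>i\<in>I. p \<theta> i * (exp (V \<theta>' \<theta> i) - 1 - V \<theta>' \<theta> i))"
proof -
  define k where "k = lse I b \<theta>' - lse I b \<theta>"
  have "(\<Sum>i\<in>I. p \<theta> i * (exp (V \<theta>' \<theta> i) - 1 - V \<theta>' \<theta> i))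
     = (\<Sum>i\<in>I. p \<theta> i * exp (V \<theta>' \<theta> i)) - (\<Sum>i\<in>I. p \<theta> i) - (\<Sum>i\<in>I. p \<theta> i * (\<theta>' i - \<theta> i)) + (\<Sum>i\<in>I. p \<theta> i) * k"
    by (simp add: V_def k_def algebra_simps sum.distrib sum_subtractf sum_distrib_left)
  also have "(\<Sum>i\<in>I. p \<theta> i * exp (V \<theta>' \<theta> i)) = (\<Sum>i\<in>I. p \<theta>' i)"
    unfolding V_def by (intro sum.cong refl p_ratio[symmetric])
  finally show ?thesis by (simp add: p_sum lse_bregman_def k_def)
qed

lemma D_nonneg: "0 \<le> D \<theta>' \<theta>"
  unfolding D_eq
proof (intro sum_nonneg mult_nonneg_nonneg)
  fix i assume "i \<in> I"
  thus "0 \<le> p \<theta> i" using p_pos less_imp_le by blast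
  show "0 \<le> exp (\<theta>' i - \<theta> i - (lse I b \<theta>' - lse I b \<theta>)) - 1 - (\<theta>' i - \<theta> i - (lse I b \<theta>' - lse I b \<theta>))"
    using exp_ge_add_one_self[of "\<theta>' i - \<theta> i - (lse I b \<theta>' - lse I b \<theta>)"] by linarith
qed

lemma lse_diff_le:
  assumes "\<And>i. i \<in> I \<Longrightarrow> \<theta>' i - \<theta> i \<le> r"
  shows "lse I b \<theta>' - lse I b \<theta> \<le> r"
proof -
  have "(\<Sum>j\<in>I. b j * exp (\<theta>' j)) \<le> (\<Sum>j\<in>I. exp r * (b j * exp (\<theta> j)))"
  proof (rule sum_mono)
    fix j assume j: "j \<in> I"
    have "b j * exp (\<theta>' j) \<le> b j * exp (r + \<theta> j)"
      using assms[OF j] b_pos[OF j] by (intro mult_left_mono) auto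
    thus "b j * exp (\<theta>' j) \<le> exp r * (b j * exp (\<theta> j))" by (simp add: exp_add algebra_simps)
  qed
  also have "\<dots> = exp r * (\<Sum>j\<in>I. b j * exp (\<theta> j))" by (simp add: sum_distrib_left)
  finally have "ln (\<Sum>j\<in>I. b j * exp (\<theta>' j)) \<le> ln (exp r * (\<Sum>j\<in>I. b j * exp (\<theta> j)))"
    using Z_pos by (intro ln_mono) auto
  thus ?thesis using Z_pos[of \<theta>] by (simp add: lse_def ln_mult)
qed

lemma log_ratio_bound:
  assumes "\<And>i. i \<in> I \<Longrightarrow> \<bar>\<theta>' i - \<theta> i\<bar> \<le> r" and "i \<in> I"
  shows "\<bar>\<theta>' i - \<theta> i - (lse I b \<theta>' - lse I b \<theta>)\<bar> \<le> 2 * r"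
proof -
  have "lse I b \<theta>' - lse I b \<theta> \<le> r" using assms(1) by (intro lse_diff_le) (simp add: abs_le_iff)
  moreover have "lse I b \<theta> - lse I b \<theta>' \<le> r" using assms(1)
    by (intro lse_diff_le) (simp add: abs_le_iff)
  ultimately show ?thesis using assms(1)[OF assms(2)] by linarith
qed

lemma p_le_exp:
  assumes "\<And>i. i \<in> I \<Longrightarrow> \<bar>\<theta>' i - \<theta> i\<bar> \<le> r" and "i \<in> I"
  shows "p \<theta>' i \<le> exp (2 * r) * p \<theta> i"
  unfolding p_ratio[OF assms(2), of \<theta>' \<theta>] using log_ratio_bound[of \<theta>' \<theta> r i, OF assms] p_pos[OF assms(2), of \<theta>]
  by (simp add: mult.commute abs_le_iff)

lemma D_upper:
  assumes "\<And>i. i \<in> I \<Longrightarrow> \<bar>\<theta>' i - \<theta> i\<bar> \<le> r" and "r \<le> 1 / 2"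
  shows "D \<theta>' \<theta> \<le> 4 * r\<^sup>2"
proof -
  have "D \<theta>' \<theta> \<le> (\<Sum>i\<in>I. p \<theta> i * (2 * r)\<^sup>2)"
    unfolding D_eq
  proof (rule sum_mono)
    fix i assume i: "i \<in> I"
    define V where "V = \<theta>' i - \<theta> i - (lse I b \<theta>' - lse I b \<theta>)"
    have V: "\<bar>V\<bar> \<le> 2 * r" unfolding V_def by (rule log_ratio_bound[of \<theta>' \<theta> r i, OF assms(1) i])
    have "exp V - 1 - V \<le> V\<^sup>2" using V assms(2) by (intro exp_remainder_le) auto
    also have "\<dots> \<le> (2 * r)\<^sup>2" using power_mono[OF V, of 2] by simp
    finally show "p \<theta> i * (exp V - 1 - V) \<le> p \<theta> i * (2 * r)\<^sup>2"
      using p_pos[OF i, of \<theta>] by simp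
  qed
  thus ?thesis by (simp add: sum_distrib_right[symmetric] p_sum)
qed

lemma variance_le:
  "(\<Sum>i\<in>I. p \<theta> i * (u i)\<^sup>2) - (\<Sum>i\<in>I. p \<theta> i * u i)\<^sup>2 \<le> (\<Sum>i\<in>I. p \<theta> i * (u i - k)\<^sup>2)"
proof -
  have "(\<Sum>i\<in>I. p \<theta> i * (u i - k)\<^sup>2)
      = (\<Sum>i\<in>I. p \<theta> i * (u i)\<^sup>2) - 2 * k * (\<Sum>i\<in>I. p \<theta> i * u i) + k\<^sup>2 * (\<Sum>i\<in>I. p \<theta> i)"
    by (simp add: power2_diff algebra_simps sum.distrib sum_subtractf sum_distrib_left)
  moreover have "0 \<le> ((\<Sum>i\<in>I. p \<theta> i * u i) - k)\<^sup>2" by simp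
  ultimately show ?thesis by (simp add: p_sum power2_diff algebra_simps)
qed

text \<open>\<open>V\<close> is not centred, but the variance is at most the mean square deviation
  about any constant, here the change of log-sum-exp.\<close>

lemma D_lower:
  assumes m: "\<And>i. i \<in> I \<Longrightarrow> - m \<le> \<theta>' i - \<theta> i - (lse I b \<theta>' - lse I b \<theta>)"
    and c: "\<And>V. - m \<le> V \<Longrightarrow> c * V\<^sup>2 \<le> exp V - 1 - V" and "0 \<le> c"
  shows "c * ((\<Sum>i\<in>I. p \<theta> i * (\<theta>' i - \<theta> i)\<^sup>2) - (\<Sum>i\<in>I. p \<theta> i * (\<theta>' i - \<theta> i))\<^sup>2) \<le> D \<theta>' \<theta>"
proof -
  have "c * ((\<Sum>i\<in>I. p \<theta> i * (\<theta>' i - \<theta> i)\<^sup>2) - (\<Sum>i\<in>I. p \<theta> i * (\<theta>' i - \<theta> i))\<^sup>2)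
    \<le> c * (\<Sum>i\<in>I. p \<theta> i * (\<theta>' i - \<theta> i - (lse I b \<theta>' - lse I b \<theta>))\<^sup>2)"
    using \<open>0 \<le> c\<close> by (intro mult_left_mono variance_le)
  also have "\<dots> \<le> D \<theta>' \<theta>"
    unfolding D_eq sum_distrib_left
  proof (rule sum_mono)
    fix i assume i: "i \<in> I"
    show "c * (p \<theta> i * (\<theta>' i - \<theta> i - (lse I b \<theta>' - lse I b \<theta>))\<^sup>2) \<le>
      p \<theta> i * (exp (\<theta>' i - \<theta> i - (lse I b \<theta>' - lse I b \<theta>)) - 1 - (\<theta>' i - \<theta> i - (lse I b \<theta>' - lse I b \<theta>)))"
      using mult_left_mono[OF c[OF m[OF i]], of "p \<theta> i"] p_pos[OF i, of \<theta>] by (simp add: mult_ac)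
  qed
  finally show ?thesis .
qed

text \<open>The mean of \<open>v\<close> under the new law is compared with its first order
  expansion at the old one. Since \<open>u i - U = V i + D\<close>, the error is the mean of
  \<open>v * (D - (exp V - 1 - V))\<close>, and both \<open>D\<close> and
  \<open>exp V - 1 - V\<close> have mean \<open>D\<close>. No third derivative has to be
  estimated.\<close>

lemma third_order_bound:
  fixes \<theta> \<theta>' :: "'i \<Rightarrow> real"
  assumes "\<And>i. i \<in> I \<Longrightarrow> \<bar>v i\<bar> \<le> M"
  defines "u \<equiv> \<lambda>i. \<theta>' i - \<theta> i"
  shows "\<bar>(\<Sum>i\<in>I. p \<theta> i * v i)
      + ((\<Sum>i\<in>I. p \<theta> i * v i * u i) - (\<Sum>i\<in>I. p \<theta> i * v i) * (\<Sum>i\<in>I. p \<theta> i * u i))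
      - (\<Sum>i\<in>I. p \<theta>' i * v i)\<bar> \<le> 2 * M * D \<theta>' \<theta>"
proof -
  define V where "V i = \<theta>' i - \<theta> i - (lse I b \<theta>' - lse I b \<theta>)" for i
  define U where "U = (\<Sum>i\<in>I. p \<theta> i * u i)"
  have uV: "u i - U = V i + D \<theta>' \<theta>" for i by (simp add: V_def u_def U_def lse_bregman_def)
  define R where "R = (\<Sum>i\<in>I. p \<theta> i * v i * (D \<theta>' \<theta> - (exp (V i) - 1 - V i)))"
  have "(\<Sum>i\<in>I. p \<theta> i * v i)
      + ((\<Sum>i\<in>I. p \<theta> i * v i * u i) - (\<Sum>i\<in>I. p \<theta> i * v i) * U) - (\<Sum>i\<in>I. p \<theta>' i * v i)
    = (\<Sum>i\<in>I. p \<theta> i * v i + (p \<theta> i * v i * u i - p \<theta> i * v i * U) - p \<theta> i * exp (V i) * v i)"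
    by (simp add: sum.distrib sum_subtractf sum_distrib_right V_def p_ratio[symmetric])
  also have "\<dots> = R"
    unfolding R_def
  proof (intro sum.cong refl)
    fix i
    have "p \<theta> i * v i + (p \<theta> i * v i * u i - p \<theta> i * v i * U) - p \<theta> i * exp (V i) * v i
      = p \<theta> i * v i * (1 + (u i - U) - exp (V i))" by (simp add: algebra_simps)
    thus "p \<theta> i * v i + (p \<theta> i * v i * u i - p \<theta> i * v i * U) - p \<theta> i * exp (V i) * v i
       = p \<theta> i * v i * (D \<theta>' \<theta> - (exp (V i) - 1 - V i))" unfolding uV by (simp add: algebra_simps)
  qed
  finally have eq: "(\<Sum>i\<in>I. p \<theta> i * v i)
      + ((\<Sum>i\<in>I. p \<theta> i * v i * u i) - (\<Sum>i\<in>I. p \<theta> i * v i) * U) - (\<Sum>i\<in>I. p \<theta>' i * v i) = R" .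
  have "\<bar>R\<bar> \<le> (\<Sum>i\<in>I. p \<theta> i * M * (D \<theta>' \<theta> + (exp (V i) - 1 - V i)))"
    unfolding R_def
  proof (rule order_trans[OF sum_abs], rule sum_mono)
    fix i assume i: "i \<in> I"
    have "0 \<le> exp (V i) - 1 - V i" using exp_ge_add_one_self[of "V i"] by linarith
    hence e: "\<bar>D \<theta>' \<theta> - (exp (V i) - 1 - V i)\<bar> \<le> D \<theta>' \<theta> + (exp (V i) - 1 - V i)"
      using D_nonneg[of \<theta>' \<theta>] by linarith
    have M: "\<bar>v i\<bar> \<le> M" "0 \<le> M" using assms(1)[OF i] by auto
    have f: "\<bar>p \<theta> i\<bar> * \<bar>v i\<bar> \<le> p \<theta> i * M" "0 \<le> p \<theta> i * M"
      using M p_pos[OF i, of \<theta>] by (auto intro: mult_left_mono)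
    show "\<bar>p \<theta> i * v i * (D \<theta>' \<theta> - (exp (V i) - 1 - V i))\<bar>
       \<le> p \<theta> i * M * (D \<theta>' \<theta> + (exp (V i) - 1 - V i))"
      unfolding abs_mult by (rule mult_mono[OF f(1) e f(2)]) simp
  qed
  also have "\<dots> = (\<Sum>i\<in>I. M * D \<theta>' \<theta> * p \<theta> i + M * (p \<theta> i * (exp (V i) - 1 - V i)))"
    by (intro sum.cong refl) (simp only: distrib_left mult_ac)
  also have "\<dots> = M * D \<theta>' \<theta> * (\<Sum>i\<in>I. p \<theta> i) + M * (\<Sum>i\<in>I. p \<theta> i * (exp (V i) - 1 - V i))"
    by (simp only: sum.distrib sum_distrib_left)
  also have "(\<Sum>i\<in>I. p \<theta> i * (exp (V i) - 1 - V i)) = D \<theta>' \<theta>" by (simp add: D_eq V_def)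
  finally show ?thesis unfolding eq[unfolded U_def] by (simp add: p_sum)
qed

end

section \<open>One round of the multinomial logit model\<close>

lemma vnorm_nonneg: "0 \<le> vnorm v"
  by (simp add: vnorm_def scalar_prod_self_nonneg)

lemma vnorm_sq: "(vnorm v)\<^sup>2 = v \<bullet> v"
  by (simp add: vnorm_def scalar_prod_self_nonneg)

lemma scalar_prod_le_vnorm:
  assumes "u \<in> carrier_vec d" "v \<in> carrier_vec d"
  shows "\<bar>u \<bullet> v\<bar> \<le> vnorm u * vnorm v"
proof (rule power2_le_imp_le)
  show "\<bar>u \<bullet> v\<bar>\<^sup>2 \<le> (vnorm u * vnorm v)\<^sup>2"
    using scalar_Cauchy_Schwarz[OF assms] by (simp add: power_mult_distrib vnorm_sq)
qed (simp add: vnorm_nonneg)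

lemma Wset_carrier: "w \<in> Wset d \<Longrightarrow> w \<in> carrier_vec d"
  by (simp add: Wset_def)

locale mnl_round =
  fixes d :: nat and v0 :: real and x :: "nat \<Rightarrow> real Matrix.vec" and S :: "nat set"
  assumes v0: "0 < v0" and finS: "finite S" and S0: "0 \<notin> S"
    and x_car: "i \<in> S \<Longrightarrow> x i \<in> carrier_vec d" and x_norm: "i \<in> S \<Longrightarrow> vnorm (x i) \<le> 1"
begin

text \<open>
  The outside option is treated as an item with base weight \<open>v0\<close> and feature \<open>0\<close>, whatever the
  environment reveals for index \<open>0\<close>.
\<close>
definition "bw i = (if i = 0 then v0 else (1::real))"
definition "z i = (if i = 0 then 0\<^sub>v d else x i)"
definition "\<theta> w i = z i \<bullet> w"

abbreviation "I \<equiv> insert 0 S"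

sublocale choice_model I bw
  by unfold_locales (use finS v0 in \<open>auto simp: bw_def\<close>)

abbreviation "P w \<equiv> p (\<theta> w)"

lemma z_car [simp]: "i \<in> I \<Longrightarrow> z i \<in> carrier_vec d"
  using x_car by (auto simp: z_def)

lemma z_norm: "i \<in> I \<Longrightarrow> vnorm (z i) \<le> 1"
  using x_norm by (auto simp: z_def vnorm_def)

lemma z_le: "i \<in> I \<Longrightarrow> v \<in> carrier_vec d \<Longrightarrow> \<bar>z i \<bullet> v\<bar> \<le> vnorm v"
  using scalar_prod_le_vnorm[OF z_car, of i v] mult_right_mono[OF z_norm, of i "vnorm v"] vnorm_nonneg[of v]
  by simp

lemma z_le_W: "i \<in> I \<Longrightarrow> w \<in> Wset d \<Longrightarrow> \<bar>z i \<bullet> w\<bar> \<le> 1"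
  using z_le[of i w] by (auto simp: Wset_def)

lemma theta_diff: "i \<in> I \<Longrightarrow> a \<in> carrier_vec d \<Longrightarrow> a' \<in> carrier_vec d \<Longrightarrow> \<theta> a i - \<theta> a' i = z i \<bullet> (a - a')"
  by (simp add: \<theta>_def scalar_prod_minus_distrib[OF z_car])

lemma theta_diff_le:
  "i \<in> I \<Longrightarrow> a \<in> carrier_vec d \<Longrightarrow> a' \<in> carrier_vec d \<Longrightarrow> \<bar>\<theta> a i - \<theta> a' i\<bar> \<le> vnorm (a - a')"
  using z_le[of i "a - a'"] by (simp add: theta_diff)

lemma theta_diff_W: "i \<in> I \<Longrightarrow> a \<in> Wset d \<Longrightarrow> a' \<in> Wset d \<Longrightarrow> \<bar>\<theta> a i - \<theta> a' i\<bar> \<le> 2"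
  using z_le_W[of i a] z_le_W[of i a'] by (simp add: \<theta>_def)

lemma mnl_prob_eq:
  assumes "w \<in> carrier_vec d" "i \<in> I"
  shows "mnl_prob v0 x S w i = P w i"
proof -
  have "(\<Sum>j\<in>S. bw j * exp (\<theta> w j)) = (\<Sum>j\<in>S. exp (x j \<bullet> w))"
    using S0 by (intro sum.cong refl) (auto simp: bw_def \<theta>_def z_def)
  thus ?thesis using assms S0 finS
    by (auto simp: mnl_prob_def softmax_def bw_def \<theta>_def z_def)
qed

section \<open>Mean feature and the Hessian as a covariance\<close>

definition "zbar w = Matrix.vec d (\<lambda>a. \<Sum>i\<in>I. P w i * z i $ a)"
definition "zc w i = z i - zbar w"

lemma zbar_car [simp]: "zbar w \<in> carrier_vec d" by (simp add: zbar_def)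
lemma zc_car [simp]: "i \<in> I \<Longrightarrow> zc w i \<in> carrier_vec d" by (simp add: zc_def)

lemma zbar_prod:
  assumes "v \<in> carrier_vec d"
  shows "zbar w \<bullet> v = (\<Sum>i\<in>I. P w i * (z i \<bullet> v))"
proof -
  have "zbar w \<bullet> v = (\<Sum>a<d. \<Sum>i\<in>I. P w i * (z i $ a * v $ a))"
    using assms by (simp add: scalar_prod_sum[of _ d] zbar_def sum_distrib_right mult.assoc)
  also have "\<dots> = (\<Sum>i\<in>I. P w i * (z i \<bullet> v))"
    using assms by (subst sum.swap) (simp only: scalar_prod_sum[of v d] sum_distrib_left)
  finally show ?thesis .
qed

lemma zc_prod: "i \<in> I \<Longrightarrow> v \<in> carrier_vec d \<Longrightarrow> zc w i \<bullet> v = z i \<bullet> v - zbar w \<bullet> v"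
  by (simp add: zc_def minus_scalar_prod_distrib[of _ d])

lemma zbar_norm: "vnorm (zbar w) \<le> 1"
proof -
  have "(vnorm (zbar w))\<^sup>2 = (\<Sum>i\<in>I. P w i * (z i \<bullet> zbar w))" by (simp only: vnorm_sq zbar_prod[OF zbar_car])
  also have "\<dots> \<le> (\<Sum>i\<in>I. P w i * vnorm (zbar w))"
    using z_le[OF _ zbar_car, of _ w] p_pos[of _ "\<theta> w"] by (intro sum_mono mult_left_mono) (auto simp: abs_le_iff less_imp_le)
  also have "\<dots> = 1 * vnorm (zbar w)" by (simp only: sum_distrib_right[symmetric] p_sum)
  finally show ?thesis using vnorm_nonneg[of "zbar w"]
    by (cases "vnorm (zbar w) = 0") (auto simp: power2_eq_square mult_le_cancel_left)
qed

lemma zc_norm: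
  assumes i: "i \<in> I"
  shows "zc w i \<bullet> zc w i \<le> 4"
proof -
  have "zc w i \<bullet> zc w i = z i \<bullet> zc w i - zbar w \<bullet> zc w i" by (rule zc_prod[OF i zc_car[OF i]])
  moreover have "\<bar>z i \<bullet> zc w i\<bar> \<le> vnorm (zc w i)" by (rule z_le[OF i zc_car[OF i]])
  moreover have "\<bar>zbar w \<bullet> zc w i\<bar> \<le> vnorm (zc w i)"
    using scalar_prod_le_vnorm[OF zbar_car zc_car[OF i], of w w] mult_right_mono[OF zbar_norm vnorm_nonneg, of w "zc w i"] by simp
  ultimately have a: "(vnorm (zc w i))\<^sup>2 \<le> 2 * vnorm (zc w i)" unfolding vnorm_sq by linarith
  have "vnorm (zc w i) \<le> 2"
    using a vnorm_nonneg[of "zc w i"] by (cases "vnorm (zc w i) = 0") (auto simp: power2_eq_square)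
  hence "(vnorm (zc w i))\<^sup>2 \<le> 2\<^sup>2" using vnorm_nonneg by (intro power_mono) auto
  thus ?thesis by (simp add: vnorm_sq)
qed

lemma Gmat_car [simp]: "Gmat d v0 x S w \<in> carrier_mat d d" by (simp add: Gmat_def)

text \<open>The outside option has feature 0, so including it changes neither sum, and
  \<open>Gmat\<close> becomes the covariance of the features under a genuine probability
  law.\<close>

lemma bform_Gmat:
  assumes w: "w \<in> carrier_vec d" and u: "u \<in> carrier_vec d" and v: "v \<in> carrier_vec d"
  shows "bform (Gmat d v0 x S w) u v
     = (\<Sum>i\<in>I. P w i * (z i \<bullet> u) * (z i \<bullet> v)) - (zbar w \<bullet> u) * (zbar w \<bullet> v)"
proof -
  have zx: "z i = x i" "mnl_prob v0 x S w i = P w i" if "i \<in> S" for i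
    using that S0 mnl_prob_eq[OF w, of i] by (auto simp: z_def)
  have z0: "z 0 \<bullet> u = 0" "z 0 \<bullet> v = 0" using u v by (auto simp: z_def)
  have G: "Gmat d v0 x S w $$ (a, b) = (\<Sum>i\<in>S. P w i * z i $ a * z i $ b) -
       (\<Sum>i\<in>S. \<Sum>j\<in>S. P w i * P w j * z i $ a * z j $ b)" if "a < d" "b < d" for a b
    using that by (simp add: Gmat_def zx)
  have e1: "(\<Sum>a<d. \<Sum>b<d. u $ a * (\<Sum>i\<in>S. P w i * z i $ a * z i $ b) * v $ b)
      = (\<Sum>i\<in>S. P w i * (z i \<bullet> u) * (z i \<bullet> v))"
  proof -
    have "(\<Sum>a<d. \<Sum>b<d. u $ a * (\<Sum>i\<in>S. P w i * z i $ a * z i $ b) * v $ b)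
      = (\<Sum>a<d. \<Sum>b<d. \<Sum>i\<in>S. P w i * ((z i $ a * u $ a) * (z i $ b * v $ b)))"
      by (simp add: sum_distrib_left sum_distrib_right mult_ac)
    also have "\<dots> = (\<Sum>a<d. \<Sum>i\<in>S. \<Sum>b<d. P w i * ((z i $ a * u $ a) * (z i $ b * v $ b)))"
      by (intro sum.cong refl sum.swap)
    also have "\<dots> = (\<Sum>i\<in>S. \<Sum>a<d. \<Sum>b<d. P w i * ((z i $ a * u $ a) * (z i $ b * v $ b)))"
      by (rule sum.swap)
    also have "\<dots> = (\<Sum>i\<in>S. P w i * (z i \<bullet> u) * (z i \<bullet> v))"
      using u v by (intro sum.cong refl)
        (simp add: scalar_prod_sum[of _ d] sum_product sum_distrib_left sum_distrib_right mult_ac)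
    finally show ?thesis .
  qed
  have zS: "zbar w \<bullet> y = (\<Sum>i\<in>S. P w i * (z i \<bullet> y))" if "y \<in> carrier_vec d" for y
    using finS S0 that by (simp add: zbar_prod) (simp add: z_def)
  have e2: "(\<Sum>a<d. \<Sum>b<d. u $ a * (\<Sum>i\<in>S. \<Sum>j\<in>S. P w i * P w j * z i $ a * z j $ b) * v $ b)
      = (zbar w \<bullet> u) * (zbar w \<bullet> v)"
  proof -
    define f where "f a = (\<Sum>i\<in>S. P w i * z i $ a)" for a
    have "(\<Sum>a<d. \<Sum>b<d. u $ a * (\<Sum>i\<in>S. \<Sum>j\<in>S. P w i * P w j * z i $ a * z j $ b) * v $ b)
       = (\<Sum>a<d. \<Sum>b<d. (f a * u $ a) * (f b * v $ b))"
    proof (intro sum.cong refl)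
      fix a b
      have "(\<Sum>i\<in>S. \<Sum>j\<in>S. P w i * P w j * z i $ a * z j $ b) = f a * f b"
        by (simp add: f_def sum_product mult_ac)
      thus "u $ a * (\<Sum>i\<in>S. \<Sum>j\<in>S. P w i * P w j * z i $ a * z j $ b) * v $ b
         = (f a * u $ a) * (f b * v $ b)" by (simp only: mult_ac)
    qed
    also have "\<dots> = (\<Sum>a<d. f a * u $ a) * (\<Sum>b<d. f b * v $ b)" by (simp add: sum_product)
    also have "(\<Sum>a<d. f a * u $ a) = zbar w \<bullet> u"
      using u S0 finS by (auto simp: scalar_prod_sum[of _ d] zbar_def f_def z_def intro!: sum.cong)
    also have "(\<Sum>a<d. f a * v $ a) = zbar w \<bullet> v"
      using v S0 finS by (auto simp: scalar_prod_sum[of _ d] zbar_def f_def z_def intro!: sum.cong)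
    finally show ?thesis .
  qed
  have "bform (Gmat d v0 x S w) u v = (\<Sum>i\<in>S. P w i * (z i \<bullet> u) * (z i \<bullet> v)) - (zbar w \<bullet> u) * (zbar w \<bullet> v)"
    unfolding e1[symmetric] e2[symmetric] sum_subtractf[symmetric] bform_sum[OF Gmat_car u v]
    by (intro sum.cong refl) (simp add: G algebra_simps)
  also have "(\<Sum>i\<in>S. P w i * (z i \<bullet> u) * (z i \<bullet> v)) = (\<Sum>i\<in>I. P w i * (z i \<bullet> u) * (z i \<bullet> v))"
    using finS S0 z0 by simp
  finally show ?thesis .
qed

text \<open>In centred form the Hessian is a nonnegative combination of squares, hence a sequence of
  rank-one updates.\<close>

lemma bform_Gmat_centered:
  assumes w: "w \<in> carrier_vec d" and u: "u \<in> carrier_vec d" and v: "v \<in> carrier_vec d"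
  shows "bform (Gmat d v0 x S w) u v = (\<Sum>i\<in>I. P w i * (zc w i \<bullet> u) * (zc w i \<bullet> v))"
proof -
  have "(\<Sum>i\<in>I. P w i * (zc w i \<bullet> u) * (zc w i \<bullet> v))
     = (\<Sum>i\<in>I. P w i * (z i \<bullet> u) * (z i \<bullet> v) - (P w i * (z i \<bullet> u)) * (zbar w \<bullet> v)
          - (P w i * (z i \<bullet> v)) * (zbar w \<bullet> u) + P w i * ((zbar w \<bullet> u) * (zbar w \<bullet> v)))"
    using u v by (intro sum.cong refl) (simp add: zc_prod algebra_simps)
  also have "\<dots> = (\<Sum>i\<in>I. P w i * (z i \<bullet> u) * (z i \<bullet> v)) - (zbar w \<bullet> u) * (zbar w \<bullet> v)"
    by (simp only: sum.distrib sum_subtractf sum_distrib_right[symmetric] zbar_prod[OF u, symmetric]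
        zbar_prod[OF v, symmetric] p_sum) simp
  finally show ?thesis using bform_Gmat[OF assms] by simp
qed

lemma bform_Gmat_le:
  assumes "w \<in> carrier_vec d" "v \<in> carrier_vec d"
  shows "bform (Gmat d v0 x S w) v v \<le> v \<bullet> v"
proof -
  have "bform (Gmat d v0 x S w) v v \<le> (\<Sum>i\<in>I. P w i * (z i \<bullet> v)\<^sup>2)"
    using assms by (simp add: bform_Gmat power2_eq_square mult.assoc)
  also have "\<dots> \<le> (\<Sum>i\<in>I. P w i * (vnorm v)\<^sup>2)"
  proof (intro sum_mono mult_left_mono)
    fix i assume i: "i \<in> I"
    show "(z i \<bullet> v)\<^sup>2 \<le> (vnorm v)\<^sup>2"
      using power_mono[OF z_le[OF i assms(2)], of 2] by simp
    show "0 \<le> P w i" using p_pos[OF i, of "\<theta> w"] by simp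
  qed
  also have "\<dots> = v \<bullet> v" by (simp only: sum_distrib_right[symmetric] p_sum vnorm_sq mult_1_left)
  finally show ?thesis .
qed

text \<open>The centre is a free parameter so that the law can change while the centre stays
  fixed.\<close>

definition "spread H w y = (\<Sum>i\<in>I. P w i * isq H (z i - y))"

text \<open>The covariance is added one rank-one term at a time. Here \<open>r = 1 + 1 / l\<close>,
  since the Hessian is at most the identity, and \<open>q = 4 / l\<close>, since centred features
  have norm at most 2. For \<open>l \<ge> 200\<close> the product \<open>r * (1 + q)\<close> is
  below \<open>21 / 20\<close>.\<close>

lemma potential_step:
  assumes H: "pos_def d l H" and l: "200 \<le> l" and w: "w \<in> carrier_vec d"
  shows "pos_def d l (H + Gmat d v0 x S w)"
    and "spread H w (zbar w) \<le> 21 / 20 * (ln (rmat_det (H + Gmat d v0 x S w)) - ln (rmat_det H))"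
proof -
  obtain xs where xs: "set xs = I" "distinct xs" using finite_distinct_list[OF fin] by blast
  define L where "L = map (\<lambda>i. (P w i, zc w i)) xs"
  have L: "0 \<le> c \<and> y \<in> carrier_vec d" "c * (y \<bullet> y) \<le> 4 / l * l" if cy: "(c, y) \<in> set L" for c y
  proof -
    obtain i where i: "i \<in> I" "c = P w i" "y = zc w i" using cy xs by (auto simp: L_def)
    show "0 \<le> c \<and> y \<in> carrier_vec d" using i p_pos[OF i(1), of "\<theta> w"] by simp
    have "c * (y \<bullet> y) \<le> 1 * 4" unfolding i(2,3)
      using p_le_1[OF i(1), of "\<theta> w"] zc_norm[OF i(1), of w] scalar_prod_self_nonneg
      by (intro mult_mono) auto
    thus "c * (y \<bullet> y) \<le> 4 / l * l" using l by simp
  qed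
  have Hc: "H \<in> carrier_mat d d" using pos_def_carrier[OF H] .
  note R = rank1_updates[OF H, of L, OF L(1)]
  have eq: "rank1_updates d H L = H + Gmat d v0 x S w"
  proof (rule bform_eqI[OF pos_def_carrier[OF R(1)]])
    fix u v :: "real Matrix.vec" assume uv: "u \<in> carrier_vec d" "v \<in> carrier_vec d"
    have "(\<Sum>(c, z)\<leftarrow>L. c * (z \<bullet> u) * (z \<bullet> v)) = bform (Gmat d v0 x S w) u v"
      unfolding L_def bform_Gmat_centered[OF w uv] using xs
      by (simp add: sum_list_distinct_conv_sum_set comp_def)
    thus "bform (rank1_updates d H L) u v = bform (H + Gmat d v0 x S w) u v"
      using R(2)[OF _ uv] Hc uv by (simp add: bform_add_mat[of _ d])
  qed (use Hc in auto)
  show "pos_def d l (H + Gmat d v0 x S w)" using R(1) by (simp add: eq)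
  have le: "bform (rank1_updates d H L) v v \<le> (1 + 1 / l) * bform H v v" if v: "v \<in> carrier_vec d" for v
  proof -
    have "bform (rank1_updates d H L) v v \<le> bform H v v + v \<bullet> v"
      using bform_Gmat_le[OF w v] v Hc by (simp add: eq bform_add_mat[of _ d])
    also have "v \<bullet> v \<le> 1 / l * bform H v v" using pos_def_lower[OF H v] l by (simp add: field_simps)
    finally show ?thesis by (simp add: algebra_simps)
  qed
  have "(\<Sum>(c, z)\<leftarrow>L. c * isq H z) \<le> (1 + 1 / l) * (1 + 4 / l) * (ln (rmat_det (rank1_updates d H L)) - ln (rmat_det H))"
    by (rule ln_det_rank1_updates_ge[OF H L(1) _ _ le L(2)]) (use l in auto)
  moreover have "(\<Sum>(c, z)\<leftarrow>L. c * isq H z) = spread H w (zbar w)"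
    unfolding L_def spread_def zc_def using xs by (simp add: sum_list_distinct_conv_sum_set comp_def)
  ultimately have main: "spread H w (zbar w) \<le> (1 + 1 / l) * (1 + 4 / l) * (ln (rmat_det (H + Gmat d v0 x S w)) - ln (rmat_det H))"
    by (simp add: eq)
  have pos: "0 < (1 + 1 / l) * (1 + 4 / l)" using l by (intro mult_pos_pos add_pos_nonneg) auto
  have "0 \<le> spread H w (zbar w)"
    unfolding spread_def using isq_nonneg[OF H] p_pos[of _ "\<theta> w", THEN less_imp_le]
    by (intro sum_nonneg mult_nonneg_nonneg) auto
  with main have nn: "0 \<le> ln (rmat_det (H + Gmat d v0 x S w)) - ln (rmat_det H)"
    using pos by (meson order_trans zero_le_mult_iff not_le)
  have "(1 + 1 / l) * (1 + 4 / l) \<le> (1 + 1 / 200) * (1 + 4 / 200)"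
    using l by (intro mult_mono add_left_mono divide_left_mono) auto
  also have "\<dots> \<le> 21 / 20" by simp
  finally show "spread H w (zbar w) \<le> 21 / 20 * (ln (rmat_det (H + Gmat d v0 x S w)) - ln (rmat_det H))"
    using main mult_right_mono[OF _ nn] by (meson order_trans)
qed

section \<open>Gradient and curvature of the loss\<close>

lemma ln_P: "i \<in> I \<Longrightarrow> ln (P w i) = ln (bw i) + z i \<bullet> w - lse I bw (\<theta> w)"
  using ln_p[of i "\<theta> w"] by (simp add: \<theta>_def)

lemma mnl_loss_eq:
  assumes "w \<in> carrier_vec d" "c \<in> I"
  shows "mnl_loss v0 x S c w = - ln (P w c)"
proof -
  have "(\<Sum>i\<in>I. onehot c i * ln (mnl_prob v0 x S w i)) = (\<Sum>i\<in>I. if i = c then ln (P w c) else 0)"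
    using assms by (intro sum.cong refl) (auto simp: onehot_def mnl_prob_eq[OF assms(1)])
  also have "\<dots> = ln (P w c)" using assms(2) fin by (simp add: sum.delta)
  finally show ?thesis by (simp only: mnl_loss_def)
qed

lemma grad_mnl_loss:
  assumes w: "w \<in> carrier_vec d" and c: "c \<in> I"
  shows "grad d (mnl_loss v0 x S c) w = zbar w - z c"
proof (rule eq_vecI)
  fix a assume "a < dim_vec (zbar w - z c)"
  hence a: "a < d" using z_car[OF c] by auto
  have prod: "z i \<bullet> (w + s \<cdot>\<^sub>v unit_vec d a) = z i \<bullet> w + s * z i $ a" if "i \<in> I" for i s
    using z_car[OF that] w a by (simp add: scalar_prod_add_distrib[of _ d])
  have loss: "mnl_loss v0 x S c (w + s \<cdot>\<^sub>v unit_vec d a)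
     = ln (\<Sum>j\<in>I. bw j * exp (z j \<bullet> w + s * z j $ a)) - ln (bw c) - (z c \<bullet> w + s * z c $ a)" for s
  proof -
    have "w + s \<cdot>\<^sub>v unit_vec d a \<in> carrier_vec d" using w by simp
    hence "mnl_loss v0 x S c (w + s \<cdot>\<^sub>v unit_vec d a)
      = lse I bw (\<theta> (w + s \<cdot>\<^sub>v unit_vec d a)) - ln (bw c) - z c \<bullet> (w + s \<cdot>\<^sub>v unit_vec d a)"
      using c by (simp add: mnl_loss_eq ln_P)
    moreover have "lse I bw (\<theta> (w + s \<cdot>\<^sub>v unit_vec d a)) = ln (\<Sum>j\<in>I. bw j * exp (z j \<bullet> w + s * z j $ a))"
      unfolding lse_def \<theta>_def by (intro arg_cong[of _ _ ln] sum.cong refl) (simp only: prod)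
    ultimately show ?thesis by (simp only: prod[OF c])
  qed
  have "((\<lambda>s. ln (\<Sum>j\<in>I. bw j * exp (z j \<bullet> w + s * z j $ a)) - ln (bw c) - (z c \<bullet> w + s * z c $ a))
     has_real_derivative
       (\<Sum>j\<in>I. bw j * (exp (z j \<bullet> w + 0 * z j $ a) * z j $ a)) / (\<Sum>j\<in>I. bw j * exp (z j \<bullet> w + 0 * z j $ a)) - z c $ a) (at 0)"
    using Z_pos[of "\<theta> w"]
    by (auto intro!: derivative_eq_intros simp: \<theta>_def mult_ac simp del: sum.insert_if)
  hence "deriv (\<lambda>s. mnl_loss v0 x S c (w + s \<cdot>\<^sub>v unit_vec d a)) 0 =
      (\<Sum>j\<in>I. bw j * (exp (z j \<bullet> w + 0 * z j $ a) * z j $ a)) / (\<Sum>j\<in>I. bw j * exp (z j \<bullet> w + 0 * z j $ a)) - z c $ a"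
    unfolding loss by (rule DERIV_imp_deriv)
  also have "\<dots> = (\<Sum>j\<in>I. P w j * z j $ a) - z c $ a"
    by (simp only: mult_zero_left add_0_right softmax_def \<theta>_def sum_divide_distrib times_divide_eq_left mult.assoc)
  also have "\<dots> = (zbar w - z c) $ a" using a z_car[OF c] by (simp add: zbar_def)
  finally show "grad d (mnl_loss v0 x S c) w $ a = (zbar w - z c) $ a" using a by (simp add: grad_def)
qed (use z_car[OF c] in \<open>auto simp: grad_def\<close>)

text \<open>
  Log-ratios of choice probabilities are at least \<open>-4\<close>, which suffices when \<open>K \<ge> 3\<close>.  For \<open>K \<le> 2\<close> the
  constant \<open>2\<eta>\<close> is too small for this, but then at most one other item competes and the
  log-ratios are at least \<open>-2\<close>.
\<close>
lemma strong_convexity: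
  assumes K: "card S \<le> K" "1 \<le> K" and a: "a \<in> Wset d" and b: "b \<in> Wset d"
  shows "bform (Gmat d v0 x S b) (a - b) (a - b) \<le> 2 * eta K * lse_bregman I bw (\<theta> a) (\<theta> b)"
proof -
  have ca: "a \<in> carrier_vec d" "b \<in> carrier_vec d" using a b by (auto simp: Wset_carrier)
  define u where "u i = \<theta> a i - \<theta> b i" for i
  define V where "V i = u i - (lse I bw (\<theta> a) - lse I bw (\<theta> b))" for i
  have u2: "\<bar>u i\<bar> \<le> 2" if "i \<in> I" for i using theta_diff_W[OF that a b] by (simp add: u_def)
  have ui: "z i \<bullet> (a - b) = u i" if "i \<in> I" for i using theta_diff[OF that ca] by (simp add: u_def)
  have G: "bform (Gmat d v0 x S b) (a - b) (a - b) = (\<Sum>i\<in>I. P b i * (u i)\<^sup>2) - (\<Sum>i\<in>I. P b i * u i)\<^sup>2"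
  proof -
    have "bform (Gmat d v0 x S b) (a - b) (a - b) = (\<Sum>i\<in>I. P b i * (z i \<bullet> (a - b)) * (z i \<bullet> (a - b))) - (\<Sum>i\<in>I. P b i * (z i \<bullet> (a - b))) * (\<Sum>i\<in>I. P b i * (z i \<bullet> (a - b)))"
      using ca by (subst bform_Gmat) (simp_all only: zbar_prod minus_carrier_vec)
    also have "(\<Sum>i\<in>I. P b i * (z i \<bullet> (a - b))) = (\<Sum>i\<in>I. P b i * u i)"
      by (intro sum.cong refl) (simp only: ui)
    also have "(\<Sum>i\<in>I. P b i * (z i \<bullet> (a - b)) * (z i \<bullet> (a - b))) = (\<Sum>i\<in>I. P b i * (u i)\<^sup>2)"
      by (intro sum.cong refl) (simp only: ui power2_eq_square mult.assoc)
    finally show ?thesis by (simp only: power2_eq_square)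
  qed
  have main: "bform (Gmat d v0 x S b) (a - b) (a - b) \<le> 2 * eta K * lse_bregman I bw (\<theta> a) (\<theta> b)"
    if c: "0 < c" "1 / c \<le> 2 * eta K"
      and m: "\<And>i. i \<in> I \<Longrightarrow> - m \<le> V i"
      and e: "\<And>V::real. - m \<le> V \<Longrightarrow> c * V\<^sup>2 \<le> exp V - 1 - V" for c m :: real
  proof -
    have "c * bform (Gmat d v0 x S b) (a - b) (a - b) \<le> lse_bregman I bw (\<theta> a) (\<theta> b)"
      unfolding G u_def using D_lower[of m "\<theta> a" "\<theta> b" c] c(1) m e by (simp add: V_def u_def)
    hence "bform (Gmat d v0 x S b) (a - b) (a - b) \<le> 1 / c * lse_bregman I bw (\<theta> a) (\<theta> b)"
      using c(1) by (simp add: field_simps)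
    also have "\<dots> \<le> 2 * eta K * lse_bregman I bw (\<theta> a) (\<theta> b)"
      using c(2) D_nonneg by (intro mult_right_mono) auto
    finally show ?thesis .
  qed
  show ?thesis
  proof (cases "3 \<le> K")
    case True
    have "ln (2 * 2 :: real) \<le> ln (real K + 1)" using True by (subst ln_le_cancel_iff) auto
    moreover have "ln (2 * 2 :: real) = ln 2 + ln 2" by (subst ln_mult) simp_all
    ultimately have "4 / 3 \<le> ln (real K + 1)" using ln2_ge_two_thirds by linarith
    hence "1 / (3 / 16) \<le> 2 * eta K" by (simp add: eta_def)
    moreover have "- 4 \<le> V i" if "i \<in> I" for i
      using log_ratio_bound[of "\<theta> a" "\<theta> b" 2 i] u2 that unfolding V_def u_def by fastforce
    ultimately show ?thesis by (intro main[of "3/16" 4] exp_remainder_ge_4) auto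
  next
    case False
    have "ln (2 :: real) \<le> ln (real K + 1)" using K by simp
    hence "2 / 3 \<le> ln (real K + 1)" using ln2_ge_two_thirds by linarith
    hence "1 / (3 / 14) \<le> 2 * eta K" by (simp add: eta_def)
    moreover have "- 2 \<le> V i" if i: "i \<in> I" for i
    proof -
      \<comment> \<open>\<open>V i \<ge> -2\<close> says that the normalising sum grows by a factor
        of at most \<open>exp (2 + u i)\<close>, which can be checked summand by summand.\<close>
      have Zb: "lse I bw (\<theta> a) \<le> lse I bw (\<theta> b) + (2 + u i)"
        if "(\<Sum>j\<in>I. bw j * exp (\<theta> a j)) \<le> exp (2 + u i) * (\<Sum>j\<in>I. bw j * exp (\<theta> b j))"
      proof -
        have "ln (\<Sum>j\<in>I. bw j * exp (\<theta> a j)) \<le> ln (exp (2 + u i) * (\<Sum>j\<in>I. bw j * exp (\<theta> b j)))"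
          using that Z_pos by (intro ln_mono) auto
        also have "\<dots> = ln (exp (2 + u i)) + ln (\<Sum>j\<in>I. bw j * exp (\<theta> b j))"
          using Z_pos[of "\<theta> b"] by (simp add: ln_mult)
        finally show ?thesis by (simp add: lse_def)
      qed
      show ?thesis
      proof (cases "i = 0")
        case True
        have "u i = 0" using True ca by (simp add: u_def \<theta>_def z_def)
        moreover have "lse I bw (\<theta> a) - lse I bw (\<theta> b) \<le> 2"
          using u2 by (intro lse_diff_le) (simp add: u_def abs_le_iff)
        ultimately show ?thesis by (simp add: V_def)
      next
        case False
        hence iS: "i \<in> S" using i by simp
        have b1: "\<bar>\<theta> a j\<bar> \<le> 1" "\<bar>\<theta> b j\<bar> \<le> 1" if "j \<in> S" for j
          using z_le_W[of j a] z_le_W[of j b] a b that by (auto simp: \<theta>_def)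
        have bS: "bw j = 1" if "j \<in> S" for j using that S0 by (auto simp: bw_def)
        have th0: "\<theta> a 0 = 0" "\<theta> b 0 = 0" using ca by (auto simp: \<theta>_def z_def)
        have "card (S - {i}) \<le> 1" using finS iS K \<open>\<not> 3 \<le> K\<close> by (simp add: card_Diff_singleton)
        then consider "S = {i}" | j where "j \<noteq> i" "S = {i, j}"
        proof -
          assume *: "S = {i} \<Longrightarrow> thesis" "\<And>j. j \<noteq> i \<Longrightarrow> S = {i, j} \<Longrightarrow> thesis"
          have "S - {i} = {} \<or> (\<exists>j. S - {i} = {j})"
            using \<open>card (S - {i}) \<le> 1\<close> finS by (metis card_1_singletonE card_0_eq finite_Diff le_antisym less_one not_less)
          thus thesis using * iS by (metis Diff_eq_empty_iff insert_Diff insert_absorb Diff_iff singletonI subset_singletonD)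
        qed
        hence "(\<Sum>j\<in>I. bw j * exp (\<theta> a j)) \<le> exp (2 + u i) * (\<Sum>j\<in>I. bw j * exp (\<theta> b j))"
        proof cases
          case 1
          have "(\<Sum>j\<in>I. bw j * exp (\<theta> a j)) = v0 + exp (\<theta> a i)" "(\<Sum>j\<in>I. bw j * exp (\<theta> b j)) = v0 + exp (\<theta> b i)"
            using False unfolding 1 by (auto simp: th0 bw_def)
          moreover have "v0 * 1 \<le> v0 * exp (2 + u i)" using v0 u2[OF i] by (intro mult_left_mono) auto
          moreover have "exp (\<theta> a i) \<le> exp (2 + u i) * exp (\<theta> b i)" by (simp add: u_def exp_add[symmetric])
          ultimately show ?thesis by (simp add: algebra_simps)
        next
          case 2
          have j0: "j \<noteq> 0" "j \<in> S" using S0 2 by auto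
          have "(\<Sum>k\<in>I. bw k * exp (\<theta> a k)) = v0 + exp (\<theta> a i) + exp (\<theta> a j)"
             "(\<Sum>k\<in>I. bw k * exp (\<theta> b k)) = v0 + exp (\<theta> b i) + exp (\<theta> b j)"
            using False j0(1) 2(1) unfolding 2(2) by (auto simp: th0 bw_def)
          moreover have "v0 * 1 \<le> v0 * exp (2 + u i)" using v0 u2[OF i] by (intro mult_left_mono) auto
          \<comment> \<open>The two items are matched crosswise: the weight of \<open>i\<close> at
            \<open>a\<close> against that of \<open>j\<close> at \<open>b\<close>, and conversely.
            All four utilities lie between -1 and 1.\<close>
          moreover have "exp (\<theta> a i) \<le> exp (2 + u i) * exp (\<theta> b j)"
            using b1[OF iS] b1[OF j0(2)] by (simp add: u_def exp_add[symmetric] abs_le_iff)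
          moreover have "exp (\<theta> a j) \<le> exp (2 + u i) * exp (\<theta> b i)"
            using b1[OF iS] b1[OF j0(2)] by (simp add: u_def exp_add[symmetric] abs_le_iff)
          ultimately show ?thesis by (simp add: algebra_simps)
        qed
        from Zb[OF this] show ?thesis by (simp add: V_def)
      qed
    qed
    ultimately show ?thesis by (intro main[of "3/14" 2] exp_remainder_ge_2) auto
  qed
qed

end

section \<open>The mirror descent step\<close>

text \<open>The iterate is selected by \<open>SOME\<close>, so a minimiser must exist. Compactness
  comes from a product of compact sets of coordinates: those below \<open>d\<close> range between -1
  and 1, the others are pinned to 0.\<close>

lemma quadratic_argmin_exists:
  assumes H: "H \<in> carrier_mat d d" and g: "g \<in> carrier_vec d" and w: "w \<in> carrier_vec d"
  shows "\<exists>u\<in>Wset d. \<forall>v\<in>Wset d. g \<bullet> u + hnorm_sq H (u - w) / c \<le> g \<bullet> v + hnorm_sq H (v - w) / c"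
proof -
  define F where "F f = (\<Sum>i<d. g $ i * f i) + (\<Sum>i<d. \<Sum>j<d. (f i - w $ i) * H $$ (i, j) * (f j - w $ j)) / c"
    for f :: "nat \<Rightarrow> real"
  define C where "C = PiE UNIV (\<lambda>i. if i < d then {-1..1::real} else {0}) \<inter> {f. (\<Sum>i<d. (f i)\<^sup>2) \<le> 1}"
  have obj: "g \<bullet> v + hnorm_sq H (v - w) / c = F (\<lambda>i. v $ i)" if v: "v \<in> carrier_vec d" for v
  proof -
    have "hnorm_sq H (v - w) = bform H (v - w) (v - w)" by (simp add: hnorm_sq_def bform_def)
    also have "\<dots> = (\<Sum>i<d. \<Sum>j<d. (v $ i - w $ i) * H $$ (i, j) * (v $ j - w $ j))"
      using v w by (simp add: bform_sum[OF H])
    finally show ?thesis using v by (simp add: F_def scalar_prod_sum[of _ d])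
  qed
  have "compactin (product_topology (\<lambda>i. euclidean) UNIV) (PiE UNIV (\<lambda>i. if i < d then {-1..1::real} else {0}))"
    by (subst compactin_PiE) auto
  hence "compact (PiE UNIV (\<lambda>i. if i < d then {-1..1::real} else {0}))"
    by (simp add: euclidean_product_topology)
  moreover have "closed {f :: nat \<Rightarrow> real. (\<Sum>i<d. (f i)\<^sup>2) \<le> 1}"
    by (intro closed_Collect_le continuous_intros continuous_on_product_coordinates)
  ultimately have "compact C" unfolding C_def by (rule compact_Int_closed)
  moreover have "(\<lambda>_. 0) \<in> C" by (auto simp: C_def)
  moreover have "continuous_on C F"
    unfolding F_def divide_inverse
    by (intro continuous_intros continuous_on_subset[OF continuous_on_product_coordinates] subset_UNIV)
  ultimately obtain f where f: "f \<in> C" "\<And>f'. f' \<in> C \<Longrightarrow> F f \<le> F f'"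
    using continuous_attains_inf[of C F] by blast
  define u where "u = Matrix.vec d f"
  have Fu: "F (\<lambda>i. u $ i) = F f" by (simp add: F_def u_def)
  have "u \<in> Wset d" using f(1) by (simp add: Wset_def u_def vnorm_def scalar_prod_sum[of _ d] C_def power2_eq_square)
  moreover have "F f \<le> F (\<lambda>i. v $ i)" if v: "v \<in> Wset d" for v
  proof -
    define f' where "f' i = (if i < d then v $ i else 0)" for i
    have vc: "v \<in> carrier_vec d" using v by (rule Wset_carrier)
    have "vnorm v \<le> 1" using v by (simp add: Wset_def)
    hence s: "(\<Sum>i<d. (v $ i)\<^sup>2) \<le> 1" using vc by (simp add: vnorm_def scalar_prod_sum[of _ d] power2_eq_square)
    have "\<bar>v $ i\<bar> \<le> 1" if "i < d" for i
    proof -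
      have "(v $ i)\<^sup>2 \<le> (\<Sum>i<d. (v $ i)\<^sup>2)" using that by (intro member_le_sum) auto
      hence "(v $ i)\<^sup>2 \<le> 1" using s by linarith
      thus ?thesis by (simp add: abs_square_le_1)
    qed
    hence "f' \<in> C" using s by (auto simp: C_def f'_def PiE_def abs_le_iff)
    hence "F f \<le> F f'" by (rule f(2))
    also have "F f' = F (\<lambda>i. v $ i)" by (simp add: F_def f'_def)
    finally show ?thesis .
  qed
  ultimately show ?thesis using obj Wset_carrier Fu by (intro bexI[of _ u]) auto
qed

lemma Wset_convex_comb:
  assumes u: "u \<in> Wset d" and v: "v \<in> Wset d" and s: "0 \<le> s" "s \<le> 1"
  shows "u + s \<cdot>\<^sub>v (v - u) \<in> Wset d"
proof -
  have c: "u \<in> carrier_vec d" "v \<in> carrier_vec d" using u v by (auto simp: Wset_carrier)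
  define y where "y = u + s \<cdot>\<^sub>v (v - u)"
  have y: "y \<in> carrier_vec d" using c by (simp add: y_def)
  have "(vnorm y)\<^sup>2 = u \<bullet> y + s * ((v - u) \<bullet> y)"
    using c y unfolding vnorm_sq by (subst (1) y_def) (simp add: add_scalar_prod_distrib[of _ d])
  also have "\<dots> = (1 - s) * (u \<bullet> y) + s * (v \<bullet> y)"
    using c y by (simp add: minus_scalar_prod_distrib[of _ d] algebra_simps)
  also have "\<dots> \<le> (1 - s) * vnorm y + s * vnorm y"
  proof (intro add_mono mult_left_mono)
    have "u \<bullet> y \<le> vnorm u * vnorm y" using scalar_prod_le_vnorm[OF c(1) y] by simp
    also have "\<dots> \<le> 1 * vnorm y" using u vnorm_nonneg by (intro mult_right_mono) (auto simp: Wset_def)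
    finally show "u \<bullet> y \<le> vnorm y" by simp
    have "v \<bullet> y \<le> vnorm v * vnorm y" using scalar_prod_le_vnorm[OF c(2) y] by simp
    also have "\<dots> \<le> 1 * vnorm y" using v vnorm_nonneg by (intro mult_right_mono) (auto simp: Wset_def)
    finally show "v \<bullet> y \<le> vnorm y" by simp
  qed (use s in auto)
  finally have "(vnorm y)\<^sup>2 \<le> vnorm y" by (simp add: algebra_simps)
  hence "vnorm y \<le> 1" using vnorm_nonneg[of y]
    by (cases "vnorm y = 0") (auto simp: power2_eq_square)
  thus ?thesis using y by (simp add: Wset_def y_def)
qed

lemma linear_term_nonneg:
  fixes a b :: real
  assumes "\<And>s. 0 < s \<Longrightarrow> s \<le> 1 \<Longrightarrow> 0 \<le> a * s + b * s\<^sup>2"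
  shows "0 \<le> a"
proof (rule ccontr)
  assume a: "\<not> 0 \<le> a"
  \<comment> \<open>Small enough that \<open>b * s \<le> - a / 2\<close>, so the quadratic term
    cannot offset the negative linear one.\<close>
  define s where "s = min 1 (- a / (2 * (\<bar>b\<bar> + 1)))"
  have "0 < - a / (2 * (\<bar>b\<bar> + 1))" using a by (intro divide_pos_pos) auto
  hence s: "0 < s" "s \<le> 1" by (auto simp: s_def)
  have "b * s \<le> (\<bar>b\<bar> + 1) * (- a / (2 * (\<bar>b\<bar> + 1)))"
    using s by (intro mult_mono) (auto simp: s_def)
  also have "\<dots> = - a / 2" by (simp add: field_simps)
  finally have "a + b * s < 0" using a by linarith
  hence "(a + b * s) * s < 0" using s by (intro mult_neg_pos)
  thus False using assms[OF s] by (simp add: algebra_simps power2_eq_square)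
qed

text \<open>The variational inequality at a constrained minimiser, from moving along the segment
  towards \<open>v\<close>. It is used against the old iterate to bound the step and against the
  true parameter to bound the new error.\<close>

lemma quadratic_argmin_first_order:
  assumes H: "sym_form d H" and g: "g \<in> carrier_vec d" and w: "w \<in> carrier_vec d" and c: "0 < c"
    and u: "u \<in> Wset d" and v: "v \<in> Wset d"
    and min: "\<And>v. v \<in> Wset d \<Longrightarrow> g \<bullet> u + hnorm_sq H (u - w) / (2 * c) \<le> g \<bullet> v + hnorm_sq H (v - w) / (2 * c)"
  shows "0 \<le> c * (g \<bullet> (v - u)) + bform H (u - w) (v - u)"
proof -
  have car: "u \<in> carrier_vec d" "v \<in> carrier_vec d" using u v by (auto simp: Wset_carrier)
  have "0 \<le> g \<bullet> (v - u) + bform H (u - w) (v - u) / c"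
  proof (rule linear_term_nonneg)
    fix s :: real assume s: "0 < s" "s \<le> 1"
    define y where "y = u + s \<cdot>\<^sub>v (v - u)"
    have y: "y \<in> Wset d" unfolding y_def using Wset_convex_comb[OF u v] s by simp
    have gy: "g \<bullet> y = g \<bullet> u + s * (g \<bullet> (v - u))"
      unfolding y_def using car g by (simp add: scalar_prod_add_distrib[of _ d])
    have yw: "y - w = (u - w) + s \<cdot>\<^sub>v (v - u)" unfolding y_def using car w by auto
    have "hnorm_sq H (y - w) = bform H (u - w) (u - w) + 2 * bform H (u - w) (v - u) * s + bform H (v - u) (v - u) * s\<^sup>2"
      unfolding yw hnorm_sq_def bform_def[symmetric] using car w by (intro bform_square_add[OF H]) auto
    moreover have "hnorm_sq H (u - w) = bform H (u - w) (u - w)" by (simp add: hnorm_sq_def bform_def)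
    ultimately have "0 \<le> s * (g \<bullet> (v - u)) + (2 * bform H (u - w) (v - u) * s + bform H (v - u) (v - u) * s\<^sup>2) / (2 * c)"
      using min[OF y] gy by (simp add: add_divide_distrib)
    also have "\<dots> = (g \<bullet> (v - u) + bform H (u - w) (v - u) / c) * s + (bform H (v - u) (v - u) / (2 * c)) * s\<^sup>2"
      using c by (simp add: field_simps)
    finally show "0 \<le> (g \<bullet> (v - u) + bform H (u - w) (v - u) / c) * s + (bform H (v - u) (v - u) / (2 * c)) * s\<^sup>2" .
  qed
  thus ?thesis using c by (simp add: field_simps)
qed

lemma eta_ge_2: "2 \<le> eta K"
  by (simp add: eta_def)

text \<open>\<open>sqrt 2 \<ge> 1.4\<close> and \<open>84 * 1.4 = 117.6\<close>.\<close>

lemma lam_ge: "117 * (real d * eta K) \<le> lam d K"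
proof -
  have "1.4 \<le> sqrt (2::real)" by (rule real_le_rsqrt) (simp add: power2_eq_square)
  hence "117 * (real d * eta K) \<le> (84 * sqrt 2) * (real d * eta K)"
    using eta_ge_2[of K] by (intro mult_right_mono) auto
  thus ?thesis by (simp add: lam_def mult_ac)
qed

lemma lam_ge_eta: "1 \<le> d \<Longrightarrow> 117 * eta K \<le> lam d K"
proof -
  assume "1 \<le> d"
  hence "1 * eta K \<le> real d * eta K" using eta_ge_2[of K] by (intro mult_right_mono) auto
  thus ?thesis using lam_ge[of d K] by simp
qed

lemma lam_ge_200: "1 \<le> d \<Longrightarrow> 200 \<le> lam d K"
  using lam_ge_eta[of d K] eta_ge_2[of K] by simp

context mnl_round
begin

text \<open>The step is short because the gradient pairs with \<open>u\<close> to at most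
  \<open>2 * vnorm u\<close>, while \<open>H\<close> is at least \<open>lam d K\<close> times the
  identity. For the error bound, the optimality condition against \<open>ws\<close> contains the
  linearised gradient \<open>g + G u\<close>. It is exchanged for the gradient at \<open>w'\<close>,
  whose linear term is a loss difference minus \<open>D2\<close>, and by strong convexity this
  \<open>D2\<close> pays for the \<open>Gmat\<close> at \<open>w'\<close> that enters the new
  norm.\<close>

lemma mirror_step:
  fixes K :: nat and w ws w' :: "real Matrix.vec"
  assumes K: "card S \<le> K" "1 \<le> K" and d: "1 \<le> d" and H: "pos_def d (lam d K) H"
    and w: "w \<in> Wset d" and ws: "ws \<in> Wset d" and w': "w' \<in> Wset d" and c: "c \<in> I"
  defines "Ht \<equiv> H + eta K \<cdot>\<^sub>m Gmat d v0 x S w" and "g \<equiv> grad d (mnl_loss v0 x S c) w"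
  assumes min: "\<And>v. v \<in> Wset d \<Longrightarrow>
      g \<bullet> w' + hnorm_sq Ht (w' - w) / (2 * eta K) \<le> g \<bullet> v + hnorm_sq Ht (v - w) / (2 * eta K)"
  shows "vnorm (w' - w) \<le> 2 * eta K / lam d K"
    and "bform (H + Gmat d v0 x S w') (ws - w') (ws - w') \<le> bform H (ws - w) (ws - w)
       + 2 * eta K * (ln (P w' c) - ln (P ws c)) - bform H (w' - w) (w' - w) / 2"
proof -
  have car: "w \<in> carrier_vec d" "ws \<in> carrier_vec d" "w' \<in> carrier_vec d"
    using w ws w' by (auto simp: Wset_carrier)
  have Hc: "H \<in> carrier_mat d d" using pos_def_carrier[OF H] .
  define G where "G = Gmat d v0 x S w"
  have Gc: "G \<in> carrier_mat d d" by (simp add: G_def)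
  define u where "u = w' - w"
  define e where "e = ws - w'"
  have uc: "u \<in> carrier_vec d" "e \<in> carrier_vec d" using car by (auto simp: u_def e_def)
  have eta0: "0 < eta K" using eta_ge_2[of K] by simp
  have l0: "0 < lam d K" using lam_ge_200[OF d, of K] by simp
  have Htc: "Ht \<in> carrier_mat d d" using Hc by (simp add: Ht_def)
  have Hb: "bform Ht a b = bform H a b + eta K * bform G a b"
    if "a \<in> carrier_vec d" "b \<in> carrier_vec d" for a b
    using that Hc Gc by (simp add: Ht_def G_def bform_add_mat[of _ d] bform_smult_mat[of _ d])
  have Gs: "bform G a b = bform G b a" if "a \<in> carrier_vec d" "b \<in> carrier_vec d" for a b
    using that car by (simp add: G_def bform_Gmat_centered mult_ac)
  have Hts: "sym_form d Ht"
    unfolding sym_form_def using Htc Hb Gs bform_commute[OF pos_def_sym[OF H]] by auto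
  have gE: "g = zbar w - z c" unfolding g_def by (rule grad_mnl_loss[OF car(1) c])
  have gc: "g \<in> carrier_vec d" unfolding gE using c by simp
  have gp: "g \<bullet> a = zbar w \<bullet> a - z c \<bullet> a" if "a \<in> carrier_vec d" for a
    unfolding gE using that c by (simp add: minus_scalar_prod_distrib[of _ d])
  note fo = quadratic_argmin_first_order[OF Hts gc car(1) eta0 w' _ min, folded u_def]
  have Gnn: "0 \<le> bform G u u"
    unfolding G_def bform_Gmat_centered[OF car(1) uc(1) uc(1)] using p_pos[of _ "\<theta> w", THEN less_imp_le]
    by (intro sum_nonneg) (simp add: mult.assoc)
  have Hu: "lam d K * (vnorm u)\<^sup>2 \<le> bform H u u" using pos_def_lower[OF H uc(1)] by (simp add: vnorm_sq)
  have "vnorm u \<le> 2 * eta K / lam d K"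
  proof -
    have 1: "0 \<le> eta K * (g \<bullet> (w - w')) + bform Ht u (w - w')" by (rule fo[OF w])
    have 2: "bform Ht u (w - w') = - bform Ht u u"
      using car uc Htc unfolding u_def by (simp add: bform_minus_right[of _ d])
    have 3: "g \<bullet> (w - w') = - (g \<bullet> u)"
      using car gc unfolding u_def by (simp add: scalar_prod_minus_distrib[of _ d])
    have 4: "\<bar>g \<bullet> u\<bar> \<le> 2 * vnorm u"
    proof -
      have "\<bar>zbar w \<bullet> u\<bar> \<le> vnorm u"
        using scalar_prod_le_vnorm[OF zbar_car uc(1), of w] mult_right_mono[OF zbar_norm vnorm_nonneg, of w u] by simp
      thus ?thesis using z_le[OF c uc(1)] gp[OF uc(1)] by linarith
    qed
    have "lam d K * (vnorm u)\<^sup>2 \<le> bform Ht u u"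
      using Hu Gnn eta0 by (simp add: Hb[OF uc(1) uc(1)] add_increasing2)
    also have "\<dots> \<le> eta K * (- (g \<bullet> u))" using 1 2 3 by simp
    also have "\<dots> \<le> eta K * (2 * vnorm u)" using 4 eta0 by (intro mult_left_mono) auto
    finally have "vnorm u * (lam d K * vnorm u) \<le> vnorm u * (2 * eta K)"
      by (simp add: power2_eq_square mult_ac)
    hence "lam d K * vnorm u \<le> 2 * eta K" using vnorm_nonneg[of u] eta0
      by (cases "vnorm u = 0") auto
    thus ?thesis using l0 by (simp add: field_simps)
  qed
  thus small: "vnorm (w' - w) \<le> 2 * eta K / lam d K" by (simp add: u_def)
  have half: "vnorm u \<le> 1 / 2"
  proof -
    have "2 * eta K / lam d K \<le> 1 / 2" using lam_ge_eta[OF d, of K] l0 eta0 by (simp add: field_simps)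
    thus ?thesis using small by (simp add: u_def)
  qed
  define R where "R = (\<Sum>i\<in>I. P w' i * (z i \<bullet> e))"
  define D1 where "D1 = lse_bregman I bw (\<theta> w') (\<theta> w)"
  define D2 where "D2 = lse_bregman I bw (\<theta> ws) (\<theta> w')"
  have th: "\<theta> w' i - \<theta> w i = z i \<bullet> u" "\<theta> ws i - \<theta> w' i = z i \<bullet> e" if "i \<in> I" for i
    using theta_diff[OF that] car by (auto simp: u_def e_def)
  \<comment> \<open>The features vary by at most 2 along \<open>e\<close>, so the general factor
    \<open>2 * M\<close> becomes 4.\<close>
  have third: "g \<bullet> e + bform G u e \<le> R - z c \<bullet> e + 4 * D1"
  proof -
    have v2: "\<bar>z i \<bullet> e\<bar> \<le> 2" if "i \<in> I" for i
      using theta_diff_W[OF that ws w'] th(2)[OF that] by simp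
    have "\<bar>(\<Sum>i\<in>I. P w i * (z i \<bullet> e))
      + ((\<Sum>i\<in>I. P w i * (z i \<bullet> e) * (\<theta> w' i - \<theta> w i)) - (\<Sum>i\<in>I. P w i * (z i \<bullet> e)) * (\<Sum>i\<in>I. P w i * (\<theta> w' i - \<theta> w i)))
      - R\<bar> \<le> 2 * 2 * D1"
      unfolding R_def D1_def by (rule third_order_bound[OF v2])
    moreover have "(\<Sum>i\<in>I. P w i * (z i \<bullet> e)) = zbar w \<bullet> e" using zbar_prod[OF uc(2)] by simp
    moreover have "(\<Sum>i\<in>I. P w i * (z i \<bullet> e) * (\<theta> w' i - \<theta> w i)) = (\<Sum>i\<in>I. P w i * (z i \<bullet> u) * (z i \<bullet> e))"
      by (intro sum.cong refl) (simp only: th(1) mult_ac)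
    moreover have "(\<Sum>i\<in>I. P w i * (\<theta> w' i - \<theta> w i)) = zbar w \<bullet> u"
      unfolding zbar_prod[OF uc(1)] by (intro sum.cong refl) (simp only: th(1))
    moreover have "bform G u e = (\<Sum>i\<in>I. P w i * (z i \<bullet> u) * (z i \<bullet> e)) - (zbar w \<bullet> u) * (zbar w \<bullet> e)"
      unfolding G_def by (rule bform_Gmat[OF car(1) uc])
    ultimately have "\<bar>zbar w \<bullet> e + bform G u e - R\<bar> \<le> 4 * D1" by (simp only: mult_ac)
    thus ?thesis unfolding gp[OF uc(2)] by linarith
  qed
  have breg: "R - z c \<bullet> e = (ln (P w' c) - ln (P ws c)) - D2"
  proof -
    have "(\<Sum>i\<in>I. P w' i * (\<theta> ws i - \<theta> w' i)) = R"
      unfolding R_def by (intro sum.cong refl) (simp only: th(2))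
    hence "D2 = lse I bw (\<theta> ws) - lse I bw (\<theta> w') - R" unfolding D2_def lse_bregman_def by simp
    moreover have "z c \<bullet> e = z c \<bullet> ws - z c \<bullet> w'"
      unfolding e_def using c car by (simp add: scalar_prod_minus_distrib[OF z_car])
    ultimately show ?thesis using ln_P[OF c] by simp
  qed
  have sc: "bform (Gmat d v0 x S w') e e \<le> 2 * eta K * D2"
    unfolding e_def D2_def by (rule strong_convexity[OF K ws w'])
  have D1: "D1 \<le> 4 * (vnorm u)\<^sup>2" unfolding D1_def
    by (rule D_upper[OF _ half]) (use theta_diff_le car in \<open>auto simp: u_def\<close>)
  have sq: "bform H (ws - w) (ws - w) = bform H u u + 2 * bform H u e + bform H e e"
  proof -
    have "ws - w = u + 1 \<cdot>\<^sub>v e" using car unfolding u_def e_def by auto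
    thus ?thesis using bform_square_add[OF pos_def_sym[OF H] uc, of 1] by simp
  qed
  have "0 \<le> eta K * (g \<bullet> e) + bform Ht u e" using fo[OF ws] by (simp add: e_def)
  hence fo': "0 \<le> eta K * (g \<bullet> e + bform G u e) + bform H u e" by (simp add: Hb[OF uc] algebra_simps)
  have "eta K * (g \<bullet> e + bform G u e) \<le> eta K * ((ln (P w' c) - ln (P ws c)) - D2 + 4 * D1)"
    using third breg eta0 by (intro mult_left_mono) auto
  also have "\<dots> = eta K * (ln (P w' c) - ln (P ws c)) - eta K * D2 + 4 * eta K * D1"
    by (simp add: algebra_simps)
  finally have m1: "eta K * (g \<bullet> e + bform G u e) \<le> \<dots>" .
  \<comment> \<open>This uses \<open>64 * eta K \<le> lam d K\<close>. After doubling, the third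
    order error consumes half of the term \<open>- bform H u u\<close> coming from
    \<open>sq\<close>; the other half is kept for the supermartingale.\<close>
  have m2: "4 * eta K * D1 \<le> bform H u u / 4"
  proof -
    have "4 * eta K * D1 \<le> 4 * eta K * (4 * (vnorm u)\<^sup>2)" using D1 eta0 by (intro mult_left_mono) auto
    also have "\<dots> = (16 * eta K) * (vnorm u)\<^sup>2" by simp
    also have "\<dots> \<le> (lam d K / 4) * (vnorm u)\<^sup>2"
      using lam_ge_eta[OF d, of K] eta0 by (intro mult_right_mono) auto
    also have "\<dots> \<le> bform H u u / 4" using Hu by simp
    finally show ?thesis .
  qed
  have "bform (H + Gmat d v0 x S w') e e = bform H e e + bform (Gmat d v0 x S w') e e"
    using Hc uc by (simp add: bform_add_mat[of _ d])
  thus "bform (H + Gmat d v0 x S w') (ws - w') (ws - w') \<le> bform H (ws - w) (ws - w)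
       + 2 * eta K * (ln (P w' c) - ln (P ws c)) - bform H (w' - w) (w' - w) / 2"
    unfolding e_def[symmetric] u_def[symmetric] using sq fo' m1 m2 sc by linarith
qed

end

section \<open>The exponential supermartingale\<close>

lemma sym_form_inverse:
  assumes H: "pos_def d l H"
  shows "sym_form d (the (mat_inverse H))"
proof -
  define B where "B = the (mat_inverse H)"
  have B: "B \<in> carrier_mat d d" "H * B = 1\<^sub>m d"
    using pos_def_inverse[OF H] by (auto simp: B_def)
  have Hc: "H \<in> carrier_mat d d" using pos_def_carrier[OF H] .
  have HB: "H *\<^sub>v (B *\<^sub>v v) = v" if "v \<in> carrier_vec d" for v
    using assoc_mult_mat_vec[OF Hc B(1) that] B that by simp
  have Bc: "B *\<^sub>v v \<in> carrier_vec d" if "v \<in> carrier_vec d" for v using B(1) that by auto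
  have "bform B u v = bform H (B *\<^sub>v v) (B *\<^sub>v u)" if "u \<in> carrier_vec d" "v \<in> carrier_vec d" for u v
    unfolding bform_def HB[OF that(1)] using Bc[OF that(2)] that by (simp add: comm_scalar_prod)
  hence "bform B u v = bform B v u" if "u \<in> carrier_vec d" "v \<in> carrier_vec d" for u v
    using that bform_commute[OF pos_def_sym[OF H] Bc Bc] by simp
  thus ?thesis using B(1) by (simp add: sym_form_def B_def[symmetric])
qed

context mnl_round
begin

section \<open>The spread under a change of centre or of law\<close>

lemma spread_nonneg:
  assumes "pos_def d l H" "y \<in> carrier_vec d"
  shows "0 \<le> spread H w y"
  unfolding spread_def using isq_nonneg[OF assms(1)] p_pos[of _ "\<theta> w", THEN less_imp_le] assms(2)
  by (intro sum_nonneg mult_nonneg_nonneg) auto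

text \<open>Parallel axis identity: the spread about \<open>y\<close> exceeds the spread about the
  mean by exactly \<open>isq H (zbar w - y)\<close>.\<close>

lemma spread_zbar_le:
  assumes H: "pos_def d l H" and y: "y \<in> carrier_vec d"
  shows "spread H w (zbar w) \<le> spread H w y"
proof -
  define B where "B = the (mat_inverse H)"
  have B: "B \<in> carrier_mat d d" using pos_def_inverse[OF H] by (simp add: B_def)
  define q where "q = zbar w - y"
  have q: "q \<in> carrier_vec d" using y by (simp add: q_def)
  define v where "v = B *\<^sub>v q"
  have v: "v \<in> carrier_vec d" using B q by (auto simp: v_def)
  have isq_eq: "isq H (z i - y) = isq H (z i - zbar w) + 2 * (zc w i \<bullet> v) + isq H q" if i: "i \<in> I" for i
  proof -
    have "z i - y = zc w i + 1 \<cdot>\<^sub>v q" using z_car[OF i] y unfolding zc_def q_def by (auto simp: zbar_def)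
    hence "isq H (z i - y) = bform B (zc w i) (zc w i) + 2 * bform B (zc w i) q * 1 + bform B q q * 1\<^sup>2"
      unfolding isq_def B_def[symmetric]
      using bform_square_add[of d B "zc w i" q 1] sym_form_inverse[OF H] zc_car[OF i] q by (simp add: B_def)
    thus ?thesis by (simp add: isq_def B_def[symmetric] zc_def bform_def v_def)
  qed
  have zero: "(\<Sum>i\<in>I. P w i * (zc w i \<bullet> v)) = 0"
  proof -
    have "(\<Sum>i\<in>I. P w i * (zc w i \<bullet> v)) = (\<Sum>i\<in>I. P w i * (z i \<bullet> v) - P w i * (zbar w \<bullet> v))"
      by (intro sum.cong refl) (simp only: zc_prod[OF _ v] right_diff_distrib)
    also have "\<dots> = 0" by (simp only: sum_subtractf zbar_prod[OF v, symmetric] sum_distrib_right[symmetric] p_sum)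
    finally show ?thesis .
  qed
  have "spread H w y = (\<Sum>i\<in>I. P w i * isq H (z i - zbar w) + 2 * (P w i * (zc w i \<bullet> v)) + P w i * isq H q)"
    unfolding spread_def by (intro sum.cong refl) (simp only: isq_eq distrib_left mult_ac)
  also have "\<dots> = spread H w (zbar w) + isq H q"
    by (simp only: sum.distrib sum_distrib_left[symmetric] zero sum_distrib_right[symmetric] p_sum spread_def)
  finally show ?thesis using isq_nonneg[OF H q] by simp
qed

lemma spread_change:
  assumes H: "pos_def d l H" and y: "y \<in> carrier_vec d"
    and r: "\<And>i. i \<in> I \<Longrightarrow> \<bar>\<theta> w i - \<theta> w' i\<bar> \<le> r"
  shows "spread H w y \<le> exp (2 * r) * spread H w' y"
  unfolding spread_def sum_distrib_left
proof (rule sum_mono)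
  fix i assume i: "i \<in> I"
  have "P w i * isq H (z i - y) \<le> (exp (2 * r) * P w' i) * isq H (z i - y)"
    using p_le_exp[of "\<theta> w" "\<theta> w'" r i, OF r i] isq_nonneg[OF H, of "z i - y"] y z_car[OF i]
    by (intro mult_right_mono) auto
  thus "P w i * isq H (z i - y) \<le> exp (2 * r) * (P w' i * isq H (z i - y))" by simp
qed

lemma exp_two_over_117: "exp (2 * (2 / 117 :: real)) \<le> 26 / 25"
  using exp_bound[of "4/117"] by (simp add: power2_eq_square)

text \<open>The next matrix and its determinant depend on \<open>c\<close> through
  \<open>w' c\<close>. The determinant growth is replaced by the lower bound
  \<open>\<Gamma>\<close>, which is free of \<open>c\<close> and can leave the sum over choices;
  what remains is an exponential moment of \<open>isq H (zc w c)\<close> under the current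
  law.\<close>

lemma supermartingale_step:
  fixes K :: nat and w ws :: "real Matrix.vec" and w' :: "nat \<Rightarrow> real Matrix.vec"
  assumes K: "card S \<le> K" "1 \<le> K" and d: "1 \<le> d" and H: "pos_def d (lam d K) H"
    and w: "w \<in> Wset d" and ws: "ws \<in> Wset d" and w': "\<And>c. c \<in> I \<Longrightarrow> w' c \<in> Wset d"
    and min: "\<And>c v. c \<in> I \<Longrightarrow> v \<in> Wset d \<Longrightarrow>
      grad d (mnl_loss v0 x S c) w \<bullet> w' c + hnorm_sq (H + eta K \<cdot>\<^sub>m Gmat d v0 x S w) (w' c - w) / (2 * eta K)
      \<le> grad d (mnl_loss v0 x S c) w \<bullet> v + hnorm_sq (H + eta K \<cdot>\<^sub>m Gmat d v0 x S w) (v - w) / (2 * eta K)"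
  shows "(\<Sum>c\<in>I. P ws c * exp (bform (H + Gmat d v0 x S (w' c)) (ws - w' c) (ws - w' c) / (2 * eta K)
            - 7 / 5 * eta K * ln (rmat_det (H + Gmat d v0 x S (w' c)))))
     \<le> exp (bform H (ws - w) (ws - w) / (2 * eta K) - 7 / 5 * eta K * ln (rmat_det H))"
proof -
  define A where "A = exp (bform H (ws - w) (ws - w) / (2 * eta K) - 7 / 5 * eta K * ln (rmat_det H))"
  define \<Gamma> where "\<Gamma> = spread H w (zbar w)"
  have eta0: "0 < eta K" using eta_ge_2[of K] by simp
  have l0: "0 < lam d K" using lam_ge_200[OF d, of K] by simp
  have wc: "w \<in> carrier_vec d" using w by (rule Wset_carrier)
  have G0: "0 \<le> \<Gamma>" unfolding \<Gamma>_def using spread_nonneg[OF H] by simp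
  have step: "P ws c * exp (bform (H + Gmat d v0 x S (w' c)) (ws - w' c) (ws - w' c) / (2 * eta K)
            - 7 / 5 * eta K * ln (rmat_det (H + Gmat d v0 x S (w' c))))
      \<le> A * exp (- (6 / 5 * eta K * \<Gamma>)) * (P w c * exp (eta K * isq H (zc w c)))" if c: "c \<in> I" for c
  proof -
    have w'c: "w' c \<in> carrier_vec d" using w'[OF c] by (rule Wset_carrier)
    define u where "u = w' c - w"
    have uc: "u \<in> carrier_vec d" using w'c wc by (simp add: u_def)
    define \<Delta> where "\<Delta> = ln (rmat_det (H + Gmat d v0 x S (w' c))) - ln (rmat_det H)"
    define \<Phi>' where "\<Phi>' = bform (H + Gmat d v0 x S (w' c)) (ws - w' c) (ws - w' c)"
    define \<Phi> where "\<Phi> = bform H (ws - w) (ws - w)"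
    note ms = mirror_step[OF K d H w ws w'[OF c] c min[OF c]]
    have small: "vnorm u \<le> 2 / 117"
    proof -
      have "2 * eta K / lam d K \<le> 2 / 117" using lam_ge_eta[OF d, of K] l0 by (simp add: field_simps)
      thus ?thesis using ms(1) by (simp add: u_def)
    qed
    have r: "\<bar>\<theta> w i - \<theta> (w' c) i\<bar> \<le> 2 / 117" if "i \<in> I" for i
      using theta_diff_le[OF that w'c wc] small by (simp add: u_def abs_minus_commute)
    \<comment> \<open>First the centre moves to the new mean, then the law moves to the new iterate,
      and then the potential bound for the matrix actually added applies.\<close>
    have "\<Gamma> \<le> spread H w (zbar (w' c))" unfolding \<Gamma>_def by (rule spread_zbar_le[OF H zbar_car])
    also have "\<dots> \<le> exp (2 * (2 / 117)) * spread H (w' c) (zbar (w' c))"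
      by (rule spread_change[OF H zbar_car r])
    also have "\<dots> \<le> 26 / 25 * (21 / 20 * \<Delta>)"
      using exp_two_over_117 potential_step(2)[OF H lam_ge_200[OF d] w'c] spread_nonneg[OF H zbar_car]
      unfolding \<Delta>_def by (intro mult_mono) auto
    finally have "6 / 5 * \<Gamma> \<le> 7 / 5 * \<Delta>" using G0 by simp
    hence "eta K * (6 / 5 * \<Gamma>) \<le> eta K * (7 / 5 * \<Delta>)" using eta0 by (intro mult_left_mono) auto
    hence D: "6 / 5 * eta K * \<Gamma> \<le> eta K * (7 / 5 * \<Delta>)" by (simp only: mult_ac)
    \<comment> \<open>Convexity of log-sum-exp trades the probability at the new iterate for the one
      at \<open>w\<close>. The extra linear term in \<open>u\<close> is then absorbed by the
      retained quadratic term.\<close>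
    have lnP: "ln (P (w' c) c) \<le> ln (P w c) + zc w c \<bullet> u"
    proof -
      have th: "\<theta> (w' c) i - \<theta> w i = z i \<bullet> u" if "i \<in> I" for i
        using theta_diff[OF that w'c wc] by (simp add: u_def)
      have "0 \<le> lse_bregman I bw (\<theta> (w' c)) (\<theta> w)" by (rule D_nonneg)
      moreover have "(\<Sum>i\<in>I. P w i * (\<theta> (w' c) i - \<theta> w i)) = zbar w \<bullet> u"
        unfolding zbar_prod[OF uc] by (intro sum.cong refl) (simp only: th)
      ultimately have "zbar w \<bullet> u \<le> lse I bw (\<theta> (w' c)) - lse I bw (\<theta> w)"
        unfolding lse_bregman_def by linarith
      moreover have "z c \<bullet> u = z c \<bullet> w' c - z c \<bullet> w"
        unfolding u_def using w'c wc by (rule scalar_prod_minus_distrib[OF z_car[OF c]])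
      ultimately show ?thesis unfolding ln_P[OF c] zc_prod[OF c uc] by linarith
    qed
    have "\<Phi>' \<le> \<Phi> + 2 * eta K * (ln (P (w' c) c) - ln (P ws c)) - bform H u u / 2"
      using ms(2) by (simp add: \<Phi>'_def \<Phi>_def u_def)
    hence "\<Phi>' / (2 * eta K) \<le> (\<Phi> + 2 * eta K * (ln (P (w' c) c) - ln (P ws c)) - bform H u u / 2) / (2 * eta K)"
      using eta0 by (intro divide_right_mono) auto
    also have "\<dots> = \<Phi> / (2 * eta K) + (ln (P (w' c) c) - ln (P ws c)) - bform H u u / (4 * eta K)"
      using eta0 by (simp add: add_divide_distrib diff_divide_distrib)
    finally have "\<Phi>' / (2 * eta K) \<le> \<Phi> / (2 * eta K) + (ln (P (w' c) c) - ln (P ws c)) - bform H u u / (4 * eta K)" .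
    moreover have "zc w c \<bullet> u - bform H u u / (4 * eta K) \<le> eta K * isq H (zc w c)"
      by (rule linear_minus_quadratic_le[OF H zc_car[OF c] uc eta0])
    ultimately have "\<Phi>' / (2 * eta K) + ln (P ws c) \<le> \<Phi> / (2 * eta K) + ln (P w c) + eta K * isq H (zc w c)"
      using lnP by linarith
    moreover have "7 / 5 * eta K * ln (rmat_det (H + Gmat d v0 x S (w' c))) = eta K * (7 / 5 * \<Delta>) + 7 / 5 * eta K * ln (rmat_det H)"
      by (simp add: \<Delta>_def algebra_simps)
    ultimately have "ln (P ws c) + (\<Phi>' / (2 * eta K) - 7 / 5 * eta K * ln (rmat_det (H + Gmat d v0 x S (w' c))))
       \<le> (\<Phi> / (2 * eta K) - 7 / 5 * eta K * ln (rmat_det H)) + (- (6 / 5 * eta K * \<Gamma>)) + (ln (P w c) + eta K * isq H (zc w c))"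
      using D by linarith
    hence "exp (ln (P ws c) + (\<Phi>' / (2 * eta K) - 7 / 5 * eta K * ln (rmat_det (H + Gmat d v0 x S (w' c)))))
       \<le> exp ((\<Phi> / (2 * eta K) - 7 / 5 * eta K * ln (rmat_det H)) + (- (6 / 5 * eta K * \<Gamma>)) + (ln (P w c) + eta K * isq H (zc w c)))"
      by simp
    thus ?thesis using p_pos[OF c] by (simp only: exp_add exp_ln A_def \<Phi>'_def \<Phi>_def mult_ac)
  qed
  \<comment> \<open>With \<open>y = eta K * isq H (zc w c)\<close> at most \<open>1 / 5\<close>,
    \<open>exp y\<close> is at most \<open>1 + 6 / 5 * y\<close>, and the mean of \<open>y\<close>
    is \<open>eta K * \<Gamma>\<close>.\<close>
  have one: "(\<Sum>c\<in>I. P w c * exp (eta K * isq H (zc w c))) \<le> exp (6 / 5 * eta K * \<Gamma>)"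
  proof -
    have "(\<Sum>c\<in>I. P w c * exp (eta K * isq H (zc w c))) \<le> (\<Sum>c\<in>I. P w c + (6 / 5 * eta K) * (P w c * isq H (z c - zbar w)))"
    proof (rule sum_mono)
      fix c assume c: "c \<in> I"
      define y where "y = eta K * isq H (zc w c)"
      have y0: "0 \<le> y" using isq_nonneg[OF H zc_car[OF c]] eta0 by (simp add: y_def)
      have "isq H (zc w c) \<le> 4 / lam d K"
        using isq_upper[OF H zc_car[OF c, of w]] divide_right_mono[OF zc_norm[OF c, of w], of "lam d K"] l0 by simp
      hence "y \<le> eta K * (4 / lam d K)" unfolding y_def using eta0 by (intro mult_left_mono) auto
      also have "\<dots> \<le> 1 / 5" using lam_ge_eta[OF d, of K] l0 eta0 by (simp add: field_simps)
      finally have y1: "y \<le> 1 / 5" .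
      have "exp y \<le> 1 + y + y\<^sup>2" using y0 y1 by (intro exp_bound) auto
      also have "y\<^sup>2 \<le> 1 / 5 * y" unfolding power2_eq_square using y0 y1 by (intro mult_right_mono) auto
      finally have "exp y \<le> 1 + 6 / 5 * y" by simp
      hence "P w c * exp y \<le> P w c * (1 + 6 / 5 * y)" using p_pos[OF c, of "\<theta> w"] by (intro mult_left_mono) auto
      also have "\<dots> = P w c + (6 / 5 * eta K) * (P w c * isq H (z c - zbar w))"
        by (simp add: y_def zc_def algebra_simps)
      finally show "P w c * exp (eta K * isq H (zc w c)) \<le> P w c + (6 / 5 * eta K) * (P w c * isq H (z c - zbar w))"
        by (simp add: y_def)
    qed
    also have "\<dots> = 1 + 6 / 5 * eta K * \<Gamma>"
      by (simp only: sum.distrib p_sum sum_distrib_left[symmetric] \<Gamma>_def spread_def)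
    also have "\<dots> \<le> exp (6 / 5 * eta K * \<Gamma>)" by (rule exp_ge_add_one_self)
    finally show ?thesis .
  qed
  have "(\<Sum>c\<in>I. P ws c * exp (bform (H + Gmat d v0 x S (w' c)) (ws - w' c) (ws - w' c) / (2 * eta K)
            - 7 / 5 * eta K * ln (rmat_det (H + Gmat d v0 x S (w' c)))))
      \<le> (\<Sum>c\<in>I. A * exp (- (6 / 5 * eta K * \<Gamma>)) * (P w c * exp (eta K * isq H (zc w c))))"
    by (rule sum_mono[OF step])
  also have "\<dots> = A * exp (- (6 / 5 * eta K * \<Gamma>)) * (\<Sum>c\<in>I. P w c * exp (eta K * isq H (zc w c)))"
    by (simp only: sum_distrib_left)
  also have "\<dots> \<le> A * exp (- (6 / 5 * eta K * \<Gamma>)) * exp (6 / 5 * eta K * \<Gamma>)"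
    using one by (intro mult_left_mono) (auto simp: A_def)
  also have "\<dots> = A" by (simp add: exp_minus)
  finally show ?thesis by (simp only: A_def)
qed

section \<open>The choice law as a probability mass function\<close>

lemma pmf_choice_pmf:
  assumes w: "w \<in> carrier_vec d"
  shows "pmf (choice_pmf v0 x S w) i = (if i \<in> I then P w i else 0)"
proof -
  define f where "f i = (if i \<in> I then mnl_prob v0 x S w i else 0)" for i
  have f: "f i = (if i \<in> I then P w i else 0)" for i
    using mnl_prob_eq[OF w, of i] by (simp add: f_def)
  have nn: "0 \<le> f i" for i using p_pos[of i "\<theta> w"] by (auto simp: f)
  have "(\<integral>\<^sup>+ i. ennreal (f i) \<partial>count_space UNIV) = (\<Sum>i\<in>I. ennreal (f i))"
    by (rule nn_integral_count_space'[OF fin]) (auto simp: f)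
  also have "\<dots> = ennreal (\<Sum>i\<in>I. f i)" by (rule sum_ennreal) (rule nn)
  also have "(\<Sum>i\<in>I. f i) = (\<Sum>i\<in>I. P w i)" by (intro sum.cong refl) (simp only: f if_True)
  finally have "(\<integral>\<^sup>+ i. ennreal (f i) \<partial>count_space UNIV) = 1" by (simp add: p_sum)
  from pmf_embed_pmf[OF nn this, of i] show ?thesis unfolding f[symmetric] choice_pmf_def f_def .
qed

lemma set_choice_pmf:
  assumes "w \<in> carrier_vec d"
  shows "set_pmf (choice_pmf v0 x S w) \<subseteq> I"
  using pmf_choice_pmf[OF assms] by (auto simp: set_pmf_iff split: if_splits)

lemma nn_integral_choice_pmf:
  assumes "w \<in> carrier_vec d" and "\<And>c. 0 \<le> f c"
  shows "(\<integral>\<^sup>+ c. ennreal (f c) \<partial>measure_pmf (choice_pmf v0 x S w)) = ennreal (\<Sum>c\<in>I. P w c * f c)"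
proof -
  have "(\<integral>\<^sup>+ c. ennreal (f c) \<partial>measure_pmf (choice_pmf v0 x S w))
     = (\<Sum>c\<in>I. ennreal (f c) * ennreal (pmf (choice_pmf v0 x S w) c))"
    using set_choice_pmf[OF assms(1)] by (intro nn_integral_measure_pmf_support[OF fin]) auto
  also have "\<dots> = (\<Sum>c\<in>I. ennreal (P w c * f c))"
    using assms(2) by (intro sum.cong refl) (simp add: pmf_choice_pmf[OF assms(1)] ennreal_mult'[symmetric] mult.commute)
  also have "\<dots> = ennreal (\<Sum>c\<in>I. P w c * f c)"
    using assms(2) p_pos[of _ "\<theta> w", THEN less_imp_le] by (intro sum_ennreal mult_nonneg_nonneg) auto
  finally show ?thesis .
qed

end

section \<open>Trajectories, state invariants and the tail bound\<close>

locale mnl_bandit =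
  fixes v0 :: real and d N K T :: nat and \<delta> \<kappa> :: real and ws w1 :: "real Matrix.vec"
    and E :: env and pick :: "hist \<Rightarrow> nat set"
  assumes v0: "0 < v0" and d: "1 \<le> d" and K: "1 \<le> K" and \<delta>: "0 < \<delta>" "\<delta> \<le> 1" and \<kappa>: "0 < \<kappa>"
    and ws: "ws \<in> Wset d" and w1: "w1 \<in> Wset d"
    and feat: "\<And>h i. length h < T \<Longrightarrow> i \<in> {1..N} \<Longrightarrow>
        fst (E h) i \<in> carrier_vec d \<and> vnorm (fst (E h) i) \<le> 1 \<and> 0 \<le> snd (E h) i \<and> snd (E h) i \<le> 1"
    and kap: "\<And>h S i w. length h < T \<Longrightarrow> S \<in> Assorts N K \<Longrightarrow> i \<in> S \<Longrightarrow> w \<in> Wset d \<Longrightarrow>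
        \<kappa> \<le> mnl_prob v0 (fst (E h)) S w i * mnl_prob v0 (fst (E h)) S w 0"
    and pick: "\<And>h. length h < T \<Longrightarrow> pick h \<in> Assorts N K"
    and pick_max: "\<And>h S. length h < T \<Longrightarrow> S \<in> Assorts N K \<Longrightarrow>
        opt_rev d K v0 \<delta> E w1 h S \<le> opt_rev d K v0 \<delta> E w1 h (pick h)"
begin

abbreviation "wt h \<equiv> fst (alg_state d K v0 E w1 h)"
abbreviation "Ht h \<equiv> snd (alg_state d K v0 E w1 h)"
abbreviation "ft h \<equiv> fst (E h)"
abbreviation "wdev h \<equiv> bform (Ht h) (ws - wt h) (ws - wt h)"

text \<open>States are defined for every list, but the invariants are claimed only for histories in
  which the set \<open>pick\<close> was offered and the choice came from it or was the outside
  option.\<close>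

primrec valid :: "hist \<Rightarrow> bool" where
  "valid [] = True"
| "valid (sc # h) = (valid h \<and> fst sc = pick h \<and> snd sc \<in> insert 0 (pick h))"

lemma ws_car: "ws \<in> carrier_vec d" using ws by (rule Wset_carrier)

lemma eta0: "0 < eta K" using eta_ge_2[of K] by simp
lemma lam0: "0 < lam d K" using lam_ge_200[OF d, of K] by simp

lemma Assorts_round:
  assumes "length h < T" "S \<in> Assorts N K"
  shows "mnl_round d v0 (ft h) S" "card S \<le> K"
  using assms v0 feat[OF assms(1)] unfolding mnl_round_def Assorts_def by (auto intro: finite_subset)

lemma round: "length h < T \<Longrightarrow> mnl_round d v0 (ft h) (pick h)"
  using Assorts_round(1) pick by simp

lemma initial_pos_def: "pos_def d (lam d K) (lam d K \<cdot>\<^sub>m 1\<^sub>m d)"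
proof -
  have "bform (lam d K \<cdot>\<^sub>m 1\<^sub>m d) u v = lam d K * (u \<bullet> v)" if "u \<in> carrier_vec d" "v \<in> carrier_vec d" for u v
    using that by (simp add: bform_smult_mat[of _ d] bform_one)
  thus ?thesis using lam0 by (auto simp: pos_def_def sym_form_def comm_scalar_prod[of _ d])
qed

lemma state_step:
  assumes h: "length h < T" and w: "wt h \<in> Wset d" and H: "pos_def d (lam d K) (Ht h)"
    and c: "c \<in> insert 0 (pick h)"
  defines "w' \<equiv> wt ((pick h, c) # h)"
  defines "obj \<equiv> \<lambda>u. grad d (mnl_loss v0 (ft h) (pick h) c) (wt h) \<bullet> u
      + hnorm_sq (Ht h + eta K \<cdot>\<^sub>m Gmat d v0 (ft h) (pick h) (wt h)) (u - wt h) / (2 * eta K)"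
  shows "w' \<in> Wset d" and "v \<in> Wset d \<Longrightarrow> obj w' \<le> obj v"
    and "Ht ((pick h, c) # h) = Ht h + Gmat d v0 (ft h) (pick h) w'"
proof -
  interpret R: mnl_round d v0 "ft h" "pick h" using round[OF h] .
  have wc: "wt h \<in> carrier_vec d" using w by (rule Wset_carrier)
  have Hc: "Ht h \<in> carrier_mat d d" using pos_def_carrier[OF H] .
  have gc: "grad d (mnl_loss v0 (ft h) (pick h) c) (wt h) \<in> carrier_vec d" by (simp add: grad_def)
  have Gc: "Ht h + eta K \<cdot>\<^sub>m Gmat d v0 (ft h) (pick h) (wt h) \<in> carrier_mat d d" using Hc by simp
  have ex: "\<exists>u. u \<in> Wset d \<and> (\<forall>v\<in>Wset d. obj u \<le> obj v)"
    using quadratic_argmin_exists[OF Gc gc wc, of "2 * eta K"] by (auto simp: obj_def)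
  have w': "w' = (SOME u. u \<in> Wset d \<and> (\<forall>v\<in>Wset d. obj u \<le> obj v))"
    by (simp add: w'_def obj_def split_beta Let_def)
  show "w' \<in> Wset d" "v \<in> Wset d \<Longrightarrow> obj w' \<le> obj v" using someI_ex[OF ex] unfolding w' by auto
  show "Ht ((pick h, c) # h) = Ht h + Gmat d v0 (ft h) (pick h) w'"
    by (simp add: w'_def split_beta Let_def)
qed

text \<open>From here on a played round enters only through \<open>state_step\<close>.\<close>

declare alg_state.simps(2) [simp del]

text \<open>The upper bound grows by one per round because each Hessian is at most the identity; it
  is the input to \<open>det_le_power\<close>.\<close>

lemma state_inv:
  assumes "valid h" "length h \<le> T"
  shows "wt h \<in> Wset d" and "pos_def d (lam d K) (Ht h)"
    and "v \<in> carrier_vec d \<Longrightarrow> bform (Ht h) v v \<le> (lam d K + real (length h)) * (v \<bullet> v)"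
proof -
  have "wt h \<in> Wset d \<and> pos_def d (lam d K) (Ht h) \<and>
      (\<forall>v\<in>carrier_vec d. bform (Ht h) v v \<le> (lam d K + real (length h)) * (v \<bullet> v))"
    using assms
  proof (induction h)
    case Nil
    show ?case using w1 initial_pos_def by (simp add: bform_smult_mat[of _ d] bform_one)
  next
    case (Cons sc h)
    hence IH: "wt h \<in> Wset d" "pos_def d (lam d K) (Ht h)"
      "\<And>v. v \<in> carrier_vec d \<Longrightarrow> bform (Ht h) v v \<le> (lam d K + real (length h)) * (v \<bullet> v)" by auto
    have h: "length h < T" using Cons.prems by simp
    obtain c where sc: "sc = (pick h, c)" "c \<in> insert 0 (pick h)" using Cons.prems by (cases sc) auto
    interpret R: mnl_round d v0 "ft h" "pick h" using round[OF h] .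
    note st = state_step[OF h IH(1,2) sc(2)]
    have wc: "wt (sc # h) \<in> carrier_vec d" using st(1) by (simp add: sc(1) Wset_carrier)
    have Hc: "Ht h \<in> carrier_mat d d" using pos_def_carrier[OF IH(2)] .
    have H': "Ht (sc # h) = Ht h + Gmat d v0 (ft h) (pick h) (wt (sc # h))" using st(3) by (simp only: sc(1))
    have "bform (Ht (sc # h)) v v \<le> (lam d K + real (length (sc # h))) * (v \<bullet> v)" if v: "v \<in> carrier_vec d" for v
      unfolding H' bform_add_mat[OF Hc R.Gmat_car v v]
      using IH(3)[OF v] R.bform_Gmat_le[OF wc v] by (simp add: algebra_simps)
    moreover have "pos_def d (lam d K) (Ht (sc # h))"
      unfolding H' by (rule R.potential_step(1)[OF IH(2) lam_ge_200[OF d] wc])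
    moreover have "wt (sc # h) \<in> Wset d" using st(1) by (simp only: sc(1))
    ultimately show ?case by blast
  qed
  thus "wt h \<in> Wset d" and "pos_def d (lam d K) (Ht h)"
    and "v \<in> carrier_vec d \<Longrightarrow> bform (Ht h) v v \<le> (lam d K + real (length h)) * (v \<bullet> v)" by auto
qed

lemma ln_det_le:
  assumes "valid h" "length h \<le> T"
  shows "ln (rmat_det (Ht h)) \<le> real d * ln (lam d K + real (length h))"
proof -
  have "rmat_det (Ht h) \<le> (lam d K + real (length h)) ^ d"
    using state_inv[OF assms] by (intro det_le_power) auto
  hence "ln (rmat_det (Ht h)) \<le> ln ((lam d K + real (length h)) ^ d)"
    using pos_def_det[OF state_inv(2)[OF assms]] by (intro ln_mono) auto
  thus ?thesis using lam0 by (simp add: ln_realpow)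
qed

lemma traj_valid:
  assumes "n \<le> T" "h \<in> set_pmf (traj v0 E pick ws n)"
  shows "valid h \<and> length h = n"
  using assms
proof (induction n arbitrary: h)
  case (Suc n)
  then obtain h' c where h': "h' \<in> set_pmf (traj v0 E pick ws n)" "h = (pick h', c) # h'"
    "c \<in> set_pmf (choice_pmf v0 (ft h') (pick h') ws)" by auto
  have v: "valid h'" "length h' = n" using Suc.IH[OF _ h'(1)] Suc.prems by auto
  interpret R: mnl_round d v0 "ft h'" "pick h'" using round[of h'] v Suc.prems by simp
  show ?case using h' v R.set_choice_pmf[OF ws_car] by auto
qed auto

text \<open>The coefficient \<open>7 / 5\<close> must be at least
  \<open>6/5 * 21/20 * 26/25 = 1.3104\<close> for the absorption in
  \<open>supermartingale_step\<close>, and at most \<open>7 * sqrt 6 / 12\<close>, about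
  \<open>1.428\<close>, to fit the term \<open>sqrt 6 * cconst K\<close> of
  \<open>beta\<close>.\<close>

definition "\<Psi> h = wdev h / (2 * eta K) - 7 / 5 * eta K * ln (rmat_det (Ht h))"

lemma supermartingale:
  assumes "n \<le> T"
  shows "(\<integral>\<^sup>+ h. ennreal (exp (\<Psi> h)) \<partial>measure_pmf (traj v0 E pick ws n)) \<le> ennreal (exp (\<Psi> []))"
  using assms
proof (induction n)
  case (Suc n)
  have "(\<integral>\<^sup>+ h. ennreal (exp (\<Psi> h)) \<partial>measure_pmf (traj v0 E pick ws (Suc n)))
     = (\<integral>\<^sup>+ h. (\<integral>\<^sup>+ c. ennreal (exp (\<Psi> ((pick h, c) # h))) \<partial>measure_pmf (choice_pmf v0 (ft h) (pick h) ws))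
          \<partial>measure_pmf (traj v0 E pick ws n))"
    by simp
  also have "\<dots> \<le> (\<integral>\<^sup>+ h. ennreal (exp (\<Psi> h)) \<partial>measure_pmf (traj v0 E pick ws n))"
  proof (rule nn_integral_mono_AE, unfold AE_measure_pmf_iff, rule ballI)
    fix h assume "h \<in> set_pmf (traj v0 E pick ws n)"
    hence vh: "valid h" "length h = n" using traj_valid[of n h] Suc.prems by auto
    hence h: "length h < T" "length h \<le> T" using Suc.prems by auto
    interpret R: mnl_round d v0 "ft h" "pick h" using round[OF h(1)] .
    note inv = state_inv[OF vh(1) h(2)]
    note st = state_step[OF h(1) inv(1,2)]
    have "(\<integral>\<^sup>+ c. ennreal (exp (\<Psi> ((pick h, c) # h))) \<partial>measure_pmf (choice_pmf v0 (ft h) (pick h) ws))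
       = ennreal (\<Sum>c\<in>insert 0 (pick h). R.P ws c * exp (\<Psi> ((pick h, c) # h)))"
      by (rule R.nn_integral_choice_pmf[OF ws_car]) simp
    also have "(\<Sum>c\<in>insert 0 (pick h). R.P ws c * exp (\<Psi> ((pick h, c) # h))) \<le> exp (\<Psi> h)"
      unfolding \<Psi>_def
      using R.supermartingale_step[OF Assorts_round(2)[OF h(1) pick[OF h(1)]] K d inv(2,1) ws,
          of "\<lambda>c. wt ((pick h, c) # h)"] st
      by (simp del: sum.insert_if)
    finally show "(\<integral>\<^sup>+ c. ennreal (exp (\<Psi> ((pick h, c) # h))) \<partial>measure_pmf (choice_pmf v0 (ft h) (pick h) ws)) \<le> ennreal (exp (\<Psi> h))"
      by (simp add: ennreal_leI)
  qed
  also have "\<dots> \<le> ennreal (exp (\<Psi> []))" using Suc by simp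
  finally show ?case .
qed simp

lemma supermartingale_tail:
  assumes "n \<le> T"
  shows "measure_pmf.prob (traj v0 E pick ws n) {h. \<Psi> [] + a \<le> \<Psi> h} \<le> exp (- a)"
proof -
  let ?M = "measure_pmf (traj v0 E pick ws n)"
  let ?c = "ennreal (exp (- \<Psi> [] - a))"
  have "emeasure ?M {h\<in>UNIV. 1 \<le> ?c * ennreal (exp (\<Psi> h))}
     \<le> ?c * (\<integral>\<^sup>+ h. ennreal (exp (\<Psi> h)) * indicator UNIV h \<partial>?M)"
    by (rule nn_integral_Markov_inequality) auto
  also have "\<dots> \<le> ?c * ennreal (exp (\<Psi> []))"
    using supermartingale[OF assms] by (intro mult_left_mono) auto
  also have "\<dots> = ennreal (exp (- a))"
    by (simp add: ennreal_mult[symmetric] exp_add[symmetric])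
  also have "{h\<in>UNIV. 1 \<le> ?c * ennreal (exp (\<Psi> h))} = {h. \<Psi> [] + a \<le> \<Psi> h}"
  proof -
    have "1 \<le> ?c * ennreal (exp (\<Psi> h)) \<longleftrightarrow> \<Psi> [] + a \<le> \<Psi> h" for h
    proof -
      have "?c * ennreal (exp (\<Psi> h)) = ennreal (exp (\<Psi> h - \<Psi> [] - a))"
        by (simp add: ennreal_mult[symmetric] exp_add[symmetric] algebra_simps)
      thus ?thesis by (simp add: ennreal_ge_1 algebra_simps)
    qed
    thus ?thesis by auto
  qed
  finally show ?thesis by (simp add: measure_pmf.emeasure_eq_measure)
qed

end

section \<open>Optimism and the regret of one round\<close>

lemma exp_diff_abs_le:
  fixes x y :: real
  assumes "x \<le> 1" "y \<le> 1"
  shows "\<bar>exp x - exp y\<bar> \<le> 3 * \<bar>x - y\<bar>"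
proof -
  have *: "exp x - exp y \<le> 3 * (x - y)" if "y \<le> x" "x \<le> 1" for x y :: real
  proof -
    have "exp x * (1 + (y - x)) \<le> exp x * exp (y - x)" by (intro mult_left_mono exp_ge_add_one_self) auto
    also have "\<dots> = exp y" by (simp add: exp_add[symmetric])
    finally have "exp x - exp y \<le> exp x * (x - y)" by (simp add: algebra_simps)
    also have "exp x \<le> exp 1" using that by simp
    hence "exp x \<le> 3" using exp_le by linarith
    hence "exp x * (x - y) \<le> 3 * (x - y)" using that by (intro mult_right_mono) auto
    finally show ?thesis .
  qed
  show ?thesis using *[of y x] *[of x y] assms by (cases "y \<le> x") (auto simp: abs_if)
qed

text \<open>Revenue is not monotone in the utilities, but \<open>R * v0\<close> equals the sum of
  \<open>exp (a i) * (r i - R)\<close> over \<open>S\<close>. Dropping items with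
  \<open>r i < R\<close> removes only negative terms, and raising the other weights increases
  nonnegative ones.\<close>

lemma optimistic_revenue:
  fixes a b r :: "'i \<Rightarrow> real"
  assumes fin: "finite S" and v0: "0 < v0" and ab: "\<And>i. i \<in> S \<Longrightarrow> a i \<le> b i"
  defines "R \<equiv> (\<Sum>i\<in>S. exp (a i) * r i) / (v0 + (\<Sum>i\<in>S. exp (a i)))"
  shows "R \<le> (\<Sum>i\<in>{i\<in>S. R \<le> r i}. exp (b i) * r i) / (v0 + (\<Sum>i\<in>{i\<in>S. R \<le> r i}. exp (b i)))"
proof -
  define S' where "S' = {i\<in>S. R \<le> r i}"
  have pos: "0 < v0 + (\<Sum>i\<in>A. exp (f i))" for A and f :: "'i \<Rightarrow> real"
    using v0 by (intro add_pos_nonneg sum_nonneg) auto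
  have "R * (v0 + (\<Sum>i\<in>S. exp (a i))) = (\<Sum>i\<in>S. exp (a i) * r i)"
    unfolding R_def using pos[of a S] by simp
  hence "R * v0 = (\<Sum>i\<in>S. exp (a i) * (r i - R))"
    by (simp add: algebra_simps sum_subtractf sum_distrib_left)
  also have "\<dots> = (\<Sum>i\<in>S'. exp (a i) * (r i - R)) + (\<Sum>i\<in>S - S'. exp (a i) * (r i - R))"
    using fin by (subst sum.subset_diff[of S' S]) (auto simp: S'_def)
  also have "\<dots> \<le> (\<Sum>i\<in>S'. exp (b i) * (r i - R)) + 0"
  proof (rule add_mono)
    show "(\<Sum>i\<in>S'. exp (a i) * (r i - R)) \<le> (\<Sum>i\<in>S'. exp (b i) * (r i - R))"
      using ab by (intro sum_mono mult_right_mono) (auto simp: S'_def)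
    show "(\<Sum>i\<in>S - S'. exp (a i) * (r i - R)) \<le> 0"
      by (intro sum_nonpos mult_nonneg_nonpos) (auto simp: S'_def)
  qed
  finally have "R * (v0 + (\<Sum>i\<in>S'. exp (b i))) \<le> (\<Sum>i\<in>S'. exp (b i) * r i)"
    by (simp add: algebra_simps sum_subtractf sum_distrib_left)
  thus ?thesis using pos[of b S'] by (simp add: S'_def[symmetric] field_simps)
qed

context choice_model
begin

lemma mean_square_le: "(\<Sum>i\<in>I. p \<theta> i * u i)\<^sup>2 \<le> (\<Sum>i\<in>I. p \<theta> i * (u i)\<^sup>2)"
proof -
  define m where "m = (\<Sum>i\<in>I. p \<theta> i * u i)"
  have "0 \<le> (\<Sum>i\<in>I. p \<theta> i * (u i - m)\<^sup>2)"
    using p_pos[of _ \<theta>, THEN less_imp_le] by (intro sum_nonneg) auto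
  also have "\<dots> = (\<Sum>i\<in>I. p \<theta> i * (u i)\<^sup>2 - 2 * m * (p \<theta> i * u i) + p \<theta> i * m\<^sup>2)"
    by (intro sum.cong refl) (simp add: power2_diff algebra_simps)
  also have "\<dots> = (\<Sum>i\<in>I. p \<theta> i * (u i)\<^sup>2) - m\<^sup>2"
    by (simp only: sum.distrib sum_subtractf sum_distrib_left[symmetric] sum_distrib_right[symmetric] p_sum m_def[symmetric])
       (simp add: power2_eq_square)
  finally show ?thesis by (simp add: m_def)
qed

text \<open>A new probability is the old one times \<open>exp (\<Delta> i) / M\<close>, where
  \<open>M\<close> is the mean of \<open>exp \<Delta>\<close>. The change is thus governed by
  \<open>exp (\<Delta> i) - M\<close>, an average of differences over \<open>j\<close>, from which a
  common shift drops out. Summing \<open>3 * (n i + n j)\<close> over both indices gives the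
  constant 6.\<close>

lemma mean_shift_le:
  assumes r: "\<And>i. i \<in> I \<Longrightarrow> 0 \<le> r i \<and> r i \<le> 1"
    and dev: "\<And>i. i \<in> I \<Longrightarrow> 0 \<le> \<theta>' i - \<theta> i \<and> \<theta>' i - \<theta> i \<le> 1"
    and n: "\<And>i j. i \<in> I \<Longrightarrow> j \<in> I \<Longrightarrow> \<bar>(\<theta>' i - \<theta> i) - (\<theta>' j - \<theta> j)\<bar> \<le> n i + n j"
  shows "(\<Sum>i\<in>I. p \<theta>' i * r i) - (\<Sum>i\<in>I. p \<theta> i * r i) \<le> 6 * (\<Sum>i\<in>I. p \<theta> i * n i)"
proof -
  define \<Delta> where "\<Delta> i = \<theta>' i - \<theta> i" for i
  define M where "M = exp (lse I b \<theta>' - lse I b \<theta>)"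
  have pM: "p \<theta>' i * M = p \<theta> i * exp (\<Delta> i)" if "i \<in> I" for i
    unfolding p_ratio[OF that, of \<theta>' \<theta>] M_def \<Delta>_def by (simp add: exp_diff)
  have "(\<Sum>i\<in>I. p \<theta>' i * M) = (\<Sum>i\<in>I. p \<theta> i * exp (\<Delta> i))" by (intro sum.cong refl pM)
  hence M: "M = (\<Sum>i\<in>I. p \<theta> i * exp (\<Delta> i))" by (simp only: sum_distrib_right[symmetric] p_sum mult_1_left)
  \<comment> \<open>Nonnegative deviations make \<open>M\<close> at least 1, so dividing by
    \<open>M\<close> cannot enlarge the change.\<close>
  have "(\<Sum>i\<in>I. p \<theta> i * 1) \<le> (\<Sum>i\<in>I. p \<theta> i * exp (\<Delta> i))"
    using dev p_pos[of _ \<theta>, THEN less_imp_le] by (intro sum_mono mult_left_mono) (auto simp: \<Delta>_def)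
  hence M1: "1 \<le> M" by (simp add: M p_sum)
  have shift: "(p \<theta>' i - p \<theta> i) * r i \<le> (\<Sum>j\<in>I. p \<theta> i * p \<theta> j * (3 * (n i + n j)))" if i: "i \<in> I" for i
  proof -
    have "exp (\<Delta> i) - M = (\<Sum>j\<in>I. p \<theta> j * (exp (\<Delta> i) - exp (\<Delta> j)))"
      by (simp only: right_diff_distrib sum_subtractf sum_distrib_right[symmetric] p_sum M[symmetric] mult_1_left)
    hence "\<bar>exp (\<Delta> i) - M\<bar> \<le> (\<Sum>j\<in>I. \<bar>p \<theta> j * (exp (\<Delta> i) - exp (\<Delta> j))\<bar>)" by simp
    also have "\<dots> \<le> (\<Sum>j\<in>I. p \<theta> j * (3 * (n i + n j)))"
    proof (rule sum_mono)
      fix j assume j: "j \<in> I"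
      have "\<bar>exp (\<Delta> i) - exp (\<Delta> j)\<bar> \<le> 3 * \<bar>\<Delta> i - \<Delta> j\<bar>"
        using dev[OF i] dev[OF j] by (intro exp_diff_abs_le) (auto simp: \<Delta>_def)
      also have "\<dots> \<le> 3 * (n i + n j)" using n[OF i j] by (simp add: \<Delta>_def)
      finally show "\<bar>p \<theta> j * (exp (\<Delta> i) - exp (\<Delta> j))\<bar> \<le> p \<theta> j * (3 * (n i + n j))"
        using p_pos[OF j, of \<theta>] by (simp add: abs_mult)
    qed
    finally have d: "\<bar>exp (\<Delta> i) - M\<bar> \<le> (\<Sum>j\<in>I. p \<theta> j * (3 * (n i + n j)))" .
    have "p \<theta>' i - p \<theta> i = p \<theta> i * (exp (\<Delta> i) - M) / M"
      using pM[OF i] M1 by (simp add: field_simps)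
    also have "\<bar>\<dots>\<bar> \<le> \<bar>p \<theta> i * (exp (\<Delta> i) - M)\<bar>"
      using M1 divide_left_mono[of 1 M "\<bar>p \<theta> i * (exp (\<Delta> i) - M)\<bar>"] by simp
    also have "\<dots> = p \<theta> i * \<bar>exp (\<Delta> i) - M\<bar>" using p_pos[OF i, of \<theta>] by (simp add: abs_mult)
    also have "\<dots> \<le> p \<theta> i * (\<Sum>j\<in>I. p \<theta> j * (3 * (n i + n j)))"
      using d p_pos[OF i, of \<theta>] by (intro mult_left_mono) auto
    finally have e: "\<bar>p \<theta>' i - p \<theta> i\<bar> \<le> p \<theta> i * (\<Sum>j\<in>I. p \<theta> j * (3 * (n i + n j)))" .
    have "(p \<theta>' i - p \<theta> i) * r i \<le> \<bar>p \<theta>' i - p \<theta> i\<bar> * 1" using r[OF i] by (intro mult_mono) auto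
    thus ?thesis using e by (simp add: sum_distrib_left mult.assoc)
  qed
  have "(\<Sum>i\<in>I. p \<theta>' i * r i) - (\<Sum>i\<in>I. p \<theta> i * r i) = (\<Sum>i\<in>I. (p \<theta>' i - p \<theta> i) * r i)"
    by (simp add: left_diff_distrib sum_subtractf)
  also have "\<dots> \<le> (\<Sum>i\<in>I. \<Sum>j\<in>I. p \<theta> i * p \<theta> j * (3 * (n i + n j)))" by (rule sum_mono[OF shift])
  also have "\<dots> = (\<Sum>i\<in>I. \<Sum>j\<in>I. 3 * (p \<theta> i * n i) * p \<theta> j + p \<theta> i * (3 * (p \<theta> j * n j)))"
    by (intro sum.cong refl) (simp add: algebra_simps)
  also have "\<dots> = 6 * (\<Sum>i\<in>I. p \<theta> i * n i)"
    by (simp only: sum.distrib sum_distrib_left[symmetric] sum_distrib_right[symmetric] p_sum)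
  finally show ?thesis .
qed

end

section \<open>Triangle inequalities and duality for the inverse norm\<close>

lemma inv_norm_triangle:
  assumes H: "pos_def d l H" and u: "u \<in> carrier_vec d" and v: "v \<in> carrier_vec d"
  shows "inv_norm H (u + s \<cdot>\<^sub>v v) \<le> inv_norm H u + \<bar>s\<bar> * inv_norm H v"
proof -
  define B where "B = the (mat_inverse H)"
  have Bs: "sym_form d B" using sym_form_inverse[OF H] by (simp add: B_def)
  have Bi: "bform B y y = isq H y" for y by (simp add: B_def isq_def)
  have nn: "0 \<le> bform B y y" if "y \<in> carrier_vec d" for y using isq_nonneg[OF H that] by (simp add: Bi)
  have nu: "0 \<le> isq H u" "0 \<le> isq H v" using isq_nonneg[OF H] u v by auto
  have "(bform B u v)\<^sup>2 \<le> isq H u * isq H v"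
    using bform_Cauchy_Schwarz[OF Bs nn u v] by (simp add: Bi)
  hence cs: "\<bar>bform B u v\<bar> \<le> sqrt (isq H u) * sqrt (isq H v)"
    by (simp add: real_sqrt_mult[symmetric] real_le_rsqrt)
  have "isq H (u + s \<cdot>\<^sub>v v) = isq H u + 2 * (s * bform B u v) + isq H v * s\<^sup>2"
    using bform_square_add[OF Bs u v, of s] by (simp add: Bi)
  also have "s * bform B u v \<le> \<bar>s\<bar> * (sqrt (isq H u) * sqrt (isq H v))"
    using mult_left_mono[OF cs, of "\<bar>s\<bar>"] by (simp add: abs_mult[symmetric])
  also have "isq H u + 2 * (\<bar>s\<bar> * (sqrt (isq H u) * sqrt (isq H v))) + isq H v * s\<^sup>2
      = (sqrt (isq H u) + \<bar>s\<bar> * sqrt (isq H v))\<^sup>2"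
    using nu by (simp add: power2_sum power_mult_distrib algebra_simps)
  finally have "isq H (u + s \<cdot>\<^sub>v v) \<le> (sqrt (isq H u) + \<bar>s\<bar> * sqrt (isq H v))\<^sup>2" by simp
  thus ?thesis unfolding inv_norm_isq using nu by (intro real_le_lsqrt) auto
qed

lemma inv_norm_diff_le:
  assumes H: "pos_def d l H" and "a \<in> carrier_vec d" "b \<in> carrier_vec d" "y \<in> carrier_vec d"
  shows "inv_norm H (a - b) \<le> inv_norm H (a - y) + inv_norm H (b - y)"
proof -
  have "a - b = (a - y) + (-1) \<cdot>\<^sub>v (b - y)" using assms by auto
  thus ?thesis using inv_norm_triangle[OF H, of "a - y" "b - y" "-1"] assms by simp
qed

lemma inv_norm_reverse_triangle:
  assumes H: "pos_def d l H" and "a \<in> carrier_vec d" "b \<in> carrier_vec d"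
  shows "\<bar>inv_norm H a - inv_norm H b\<bar> \<le> inv_norm H (a - b)"
proof -
  have "a = b + 1 \<cdot>\<^sub>v (a - b)" "b = a + (-1) \<cdot>\<^sub>v (a - b)" using assms by auto
  hence "inv_norm H a \<le> inv_norm H b + inv_norm H (a - b)" "inv_norm H b \<le> inv_norm H a + inv_norm H (a - b)"
    using inv_norm_triangle[OF H, of b "a - b" 1] inv_norm_triangle[OF H, of a "a - b" "-1"] assms by auto
  thus ?thesis by linarith
qed

lemma confidence_dual:
  assumes H: "pos_def d l H" and w: "w \<in> carrier_vec d" and ws: "ws \<in> carrier_vec d"
    and conf: "bform H (ws - w) (ws - w) \<le> B\<^sup>2" and B: "0 \<le> B" and a: "a \<in> carrier_vec d"
  shows "\<bar>a \<bullet> (w - ws)\<bar> \<le> B * inv_norm H a"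
proof -
  have "(a \<bullet> (ws - w))\<^sup>2 \<le> isq H a * bform H (ws - w) (ws - w)"
    using w ws by (intro isq_Cauchy_Schwarz[OF H a]) auto
  also have "\<dots> \<le> isq H a * B\<^sup>2" using conf isq_nonneg[OF H a] by (intro mult_left_mono) auto
  finally have "\<bar>a \<bullet> (ws - w)\<bar> \<le> sqrt (isq H a * B\<^sup>2)" by (intro real_le_rsqrt) simp
  also have "\<dots> = B * inv_norm H a" using B by (simp add: real_sqrt_mult inv_norm_isq)
  also have "\<bar>a \<bullet> (ws - w)\<bar> = \<bar>a \<bullet> (w - ws)\<bar>"
    using a w ws by (simp add: scalar_prod_minus_distrib[of _ d] abs_minus_commute)
  finally show ?thesis .
qed

context mnl_round
begin

lemma exp_rev_eq:
  assumes "w \<in> carrier_vec d" "r' 0 = 0" "\<And>i. i \<in> S \<Longrightarrow> r' i = r i"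
  shows "exp_rev v0 x r S w = (\<Sum>i\<in>I. P w i * r' i)"
proof -
  have "exp_rev v0 x r S w = (\<Sum>i\<in>S. P w i * r' i)"
    unfolding exp_rev_def using assms mnl_prob_eq[OF assms(1)] by (intro sum.cong refl) auto
  thus ?thesis using finS S0 assms(2) by simp
qed

text \<open>The law of reference is the one at the next iterate \<open>w'\<close>, because its
  Hessian is what is added to \<open>H\<close>; accordingly the centre is \<open>zbar w'\<close>.
  Since \<open>w'\<close> is any point of the ball, the bound holds whichever choice is observed.
  The lower bound \<open>kap\<close> is used only when some index error exceeds 1.\<close>

lemma round_regret:
  fixes ws w w' :: "real Matrix.vec" and r :: "nat \<Rightarrow> real" and B \<kappa> :: real
  assumes H: "pos_def d l H" and l: "200 \<le> l" and w: "w \<in> Wset d" and ws: "ws \<in> Wset d" and w': "w' \<in> Wset d"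
    and conf: "bform H (ws - w) (ws - w) \<le> B\<^sup>2" and B: "0 \<le> B"
    and r: "\<And>i. i \<in> S \<Longrightarrow> 0 \<le> r i \<and> r i \<le> 1"
    and \<kappa>: "0 < \<kappa>" and kap: "\<And>i. i \<in> S \<Longrightarrow> \<kappa> \<le> P w' i * P w' 0"
  defines "\<Delta> \<equiv> ln (rmat_det (H + Gmat d v0 x S w')) - ln (rmat_det H)"
  defines "\<alpha> \<equiv> \<lambda>i. x i \<bullet> w + B * inv_norm H (x i)"
  shows "(\<Sum>i\<in>S. exp (\<alpha> i) * r i) / (v0 + (\<Sum>i\<in>S. exp (\<alpha> i))) - exp_rev v0 x r S ws
      \<le> 120 * B * sqrt \<Delta> + 9 * B\<^sup>2 / \<kappa> * \<Delta>"
    and "0 \<le> \<Delta>"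
proof -
  have car: "w \<in> carrier_vec d" "ws \<in> carrier_vec d" "w' \<in> carrier_vec d"
    using w ws w' by (auto simp: Wset_carrier)
  define y where "y = zbar w'"
  have y: "y \<in> carrier_vec d" by (simp add: y_def)
  define n where "n i = inv_norm H (z i - y)" for i
  have n0: "0 \<le> n i" if "i \<in> I" for i
    using isq_nonneg[OF H, of "z i - y"] y that by (simp add: n_def inv_norm_isq)
  have nsq: "(n i)\<^sup>2 = isq H (z i - y)" if "i \<in> I" for i
    using isq_nonneg[OF H, of "z i - y"] y z_car[OF that] by (simp add: n_def inv_norm_isq)
  have sp: "spread H w' y \<le> 21 / 20 * \<Delta>" unfolding \<Delta>_def y_def by (rule potential_step(2)[OF H l car(3)])
  have sp0: "0 \<le> spread H w' y" by (rule spread_nonneg[OF H y])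
  show D0: "0 \<le> \<Delta>" using sp sp0 by simp
  define \<theta>' where "\<theta>' i = z i \<bullet> w + B * inv_norm H (z i)" for i
  define r' where "r' i = (if i = 0 then 0 else r i)" for i
  have r': "0 \<le> r' i \<and> r' i \<le> 1" if "i \<in> I" for i using r that by (auto simp: r'_def)
  have inv0: "inv_norm H (0\<^sub>v d) = 0"
  proof -
    have "isq H (0\<^sub>v d) = 0"
      using isq_upper[OF H, of "0\<^sub>v d"] isq_nonneg[OF H, of "0\<^sub>v d"] by simp
    thus ?thesis by (simp add: inv_norm_isq)
  qed
  have th0: "\<theta>' 0 = 0" using car by (simp add: \<theta>'_def z_def inv0)
  have thS: "\<theta>' i = \<alpha> i" "bw i = 1" "i \<noteq> 0" if "i \<in> S" for i
  proof -
    show "i \<noteq> 0" using that S0 by metis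
    thus "\<theta>' i = \<alpha> i" "bw i = 1" by (auto simp: \<theta>'_def \<alpha>_def z_def bw_def)
  qed
  have Q': "(\<Sum>i\<in>S. exp (\<alpha> i) * r i) / (v0 + (\<Sum>i\<in>S. exp (\<alpha> i))) = (\<Sum>i\<in>I. p \<theta>' i * r' i)"
  proof -
    have "(\<Sum>j\<in>I. bw j * exp (\<theta>' j)) = v0 + (\<Sum>i\<in>S. exp (\<alpha> i))"
      using finS S0 by (simp add: th0 bw_def) (intro sum.cong refl, auto simp: thS)
    moreover have "(\<Sum>i\<in>I. p \<theta>' i * r' i) = (\<Sum>i\<in>S. p \<theta>' i * r' i)"
      using finS S0 by (simp add: r'_def)
    ultimately have "(\<Sum>i\<in>I. p \<theta>' i * r' i) = (\<Sum>i\<in>S. (exp (\<alpha> i) * r i) / (v0 + (\<Sum>i\<in>S. exp (\<alpha> i))))"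
      by (auto simp: softmax_def r'_def thS intro!: sum.cong)
    thus ?thesis by (simp add: sum_divide_distrib)
  qed
  have Q: "exp_rev v0 x r S ws = (\<Sum>i\<in>I. P ws i * r' i)"
    by (rule exp_rev_eq[OF car(2)]) (use S0 in \<open>auto simp: r'_def\<close>)
  note dual = confidence_dual[OF H car(1,2) conf B]
  have dev: "\<theta>' i - \<theta> ws i = z i \<bullet> (w - ws) + B * inv_norm H (z i)" if "i \<in> I" for i
    unfolding \<theta>'_def \<theta>_def using z_car[OF that] car by (simp add: scalar_prod_minus_distrib[of _ d])
  have dev_bd: "0 \<le> \<theta>' i - \<theta> ws i" "\<theta>' i - \<theta> ws i \<le> 2 * B * inv_norm H (z i)" if "i \<in> I" for i
    using dual[OF z_car[OF that]] by (auto simp: dev[OF that])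
  \<comment> \<open>Bonuses enter through a difference of two norms, so the reverse triangle
    inequality turns them into distances to \<open>y\<close>.\<close>
  have dev_diff: "\<bar>(\<theta>' i - \<theta> ws i) - (\<theta>' j - \<theta> ws j)\<bar> \<le> 2 * B * n i + 2 * B * n j"
    if i: "i \<in> I" and j: "j \<in> I" for i j
  proof -
    have "(\<theta>' i - \<theta> ws i) - (\<theta>' j - \<theta> ws j) = (z i - z j) \<bullet> (w - ws) + B * (inv_norm H (z i) - inv_norm H (z j))"
      using dev[OF i] dev[OF j] z_car[OF i] z_car[OF j] car
      by (simp add: minus_scalar_prod_distrib[of _ d] algebra_simps)
    also have "\<bar>\<dots>\<bar> \<le> \<bar>(z i - z j) \<bullet> (w - ws)\<bar> + B * \<bar>inv_norm H (z i) - inv_norm H (z j)\<bar>"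
      using B by (intro order_trans[OF abs_triangle_ineq]) (simp add: abs_mult)
    also have "\<dots> \<le> B * inv_norm H (z i - z j) + B * inv_norm H (z i - z j)"
      using dual[of "z i - z j"] inv_norm_reverse_triangle[OF H z_car[OF i] z_car[OF j]] B z_car[OF i] z_car[OF j]
      by (intro add_mono mult_left_mono) auto
    also have "\<dots> = 2 * B * inv_norm H (z i - z j)" by simp
    also have "\<dots> \<le> 2 * B * (n i + n j)"
      unfolding n_def using inv_norm_diff_le[OF H z_car[OF i] z_car[OF j] y] B by (intro mult_left_mono) auto
    finally show ?thesis by (simp add: algebra_simps)
  qed
  show "(\<Sum>i\<in>S. exp (\<alpha> i) * r i) / (v0 + (\<Sum>i\<in>S. exp (\<alpha> i))) - exp_rev v0 x r S ws
      \<le> 120 * B * sqrt \<Delta> + 9 * B\<^sup>2 / \<kappa> * \<Delta>"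
  proof (cases "\<forall>i\<in>I. \<theta>' i - \<theta> ws i \<le> 1")
    case True
    have "(\<Sum>i\<in>I. p \<theta>' i * r' i) - (\<Sum>i\<in>I. P ws i * r' i) \<le> 6 * (\<Sum>i\<in>I. P ws i * (2 * B * n i))"
      using True dev_bd(1) by (intro mean_shift_le r' dev_diff) auto
    also have "\<dots> = 12 * B * (\<Sum>i\<in>I. P ws i * n i)" by (simp only: sum_distrib_left mult_ac) (simp add: sum_distrib_left)
    also have "\<dots> \<le> 12 * B * (10 * sqrt \<Delta>)"
    proof (intro mult_left_mono)
      have "(\<Sum>i\<in>I. P ws i * n i)\<^sup>2 \<le> (\<Sum>i\<in>I. P ws i * (n i)\<^sup>2)" by (rule mean_square_le)
      also have "\<dots> = spread H ws y" unfolding spread_def by (intro sum.cong refl) (simp only: nsq)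
      \<comment> \<open>Two points of the ball differ by at most 2 in each utility, so the law
        changes by a factor of at most \<open>exp 4\<close>, an absolute constant free of
        \<open>\<kappa>\<close>.\<close>
      also have "\<dots> \<le> exp (2 * 2) * spread H w' y"
        by (rule spread_change[OF H y]) (rule theta_diff_W[OF _ ws w'])
      also have "\<dots> \<le> 81 * (21 / 20 * \<Delta>)"
      proof (rule mult_mono[OF _ sp])
        have "exp (2 * 2 :: real) = exp 1 ^ 4" by (simp add: exp_of_nat_mult[symmetric])
        also have "\<dots> \<le> 3 ^ 4" using exp_le by (intro power_mono) auto
        finally show "exp (2 * 2 :: real) \<le> 81" by simp
      qed (use sp0 in auto)
      also have "\<dots> \<le> 100 * \<Delta>" using D0 by simp
      finally have "(\<Sum>i\<in>I. P ws i * n i) \<le> sqrt (100 * \<Delta>)" by (rule real_le_rsqrt)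
      also have "\<dots> = 10 * sqrt \<Delta>" by (simp add: real_sqrt_mult)
      finally show "(\<Sum>i\<in>I. P ws i * n i) \<le> 10 * sqrt \<Delta>" .
    qed (use B in auto)
    also have "\<dots> \<le> 120 * B * sqrt \<Delta> + 9 * B\<^sup>2 / \<kappa> * \<Delta>" using D0 \<kappa> by simp
    finally show ?thesis unfolding Q Q' .
  next
    case False
    then obtain i where i: "i \<in> I" "1 < \<theta>' i - \<theta> ws i" by force
    have "i \<noteq> 0"
    proof
      assume "i = 0"
      thus False using i(2) th0 car by (simp add: \<theta>_def z_def)
    qed
    hence iS: "i \<in> S" using i by simp
    \<comment> \<open>The outside option has feature 0, so an uncentred norm is a distance to item 0
      and can be routed through \<open>y\<close>.\<close>
    have z0: "z i - z 0 = z i" using z_car[OF i(1)] by (auto simp: z_def)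
    have "1 \<le> 2 * B * inv_norm H (z i)" using i(2) dev_bd(2)[OF i(1)] by simp
    also have "\<dots> \<le> 2 * B * (n i + n 0)"
      using inv_norm_diff_le[OF H z_car[OF i(1)] z_car[of 0] y] B unfolding n_def z0
      by (intro mult_left_mono) auto
    finally have "1 \<le> 2 * B * (n i + n 0)" .
    hence "1\<^sup>2 \<le> (2 * B * (n i + n 0))\<^sup>2" by (intro power_mono) auto
    also have "\<dots> = 4 * B\<^sup>2 * (n i + n 0)\<^sup>2" by (simp add: power_mult_distrib)
    also have "\<dots> \<le> 4 * B\<^sup>2 * (2 * ((n i)\<^sup>2 + (n 0)\<^sup>2))"
    proof (intro mult_left_mono)
      have "0 \<le> (n i - n 0)\<^sup>2" by simp
      thus "(n i + n 0)\<^sup>2 \<le> 2 * ((n i)\<^sup>2 + (n 0)\<^sup>2)" by (simp add: power2_sum power2_diff)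
    qed simp
    \<comment> \<open>\<open>\<kappa>\<close> is a lower bound for \<open>P w' i\<close> and for
      \<open>P w' 0\<close> separately, so these two terms of the spread control both
      squares.\<close>
    also have "(n i)\<^sup>2 + (n 0)\<^sup>2 \<le> spread H w' y / \<kappa>"
    proof -
      have P01: "P w' i \<le> 1" "P w' 0 \<le> 1" "0 < P w' i" "0 < P w' 0"
        using p_le_1[OF i(1)] p_le_1[of 0] p_pos[OF i(1)] p_pos[of 0] by auto
      have "\<kappa> \<le> P w' i * 1" by (rule order_trans[OF kap[OF iS]]) (use P01 in \<open>intro mult_left_mono, auto\<close>)
      moreover have "\<kappa> \<le> 1 * P w' 0" by (rule order_trans[OF kap[OF iS]]) (use P01 in \<open>intro mult_right_mono, auto\<close>)
      ultimately have "\<kappa> * (n i)\<^sup>2 + \<kappa> * (n 0)\<^sup>2 \<le> P w' i * (n i)\<^sup>2 + P w' 0 * (n 0)\<^sup>2"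
        by (intro add_mono mult_right_mono) auto
      also have "\<dots> = (\<Sum>j\<in>{i, 0}. P w' j * (n j)\<^sup>2)" using \<open>i \<noteq> 0\<close> by simp
      also have "\<dots> \<le> (\<Sum>j\<in>I. P w' j * (n j)\<^sup>2)"
        using i(1) finS p_pos[of _ "\<theta> w'", THEN less_imp_le] by (intro sum_mono2) auto
      also have "\<dots> = spread H w' y" unfolding spread_def by (intro sum.cong refl) (simp only: nsq)
      finally show ?thesis using \<kappa> by (simp add: field_simps)
    qed
    also have "spread H w' y / \<kappa> \<le> 21 / 20 * \<Delta> / \<kappa>" using sp \<kappa> by (intro divide_right_mono) auto
    finally have "1 \<le> 4 * B\<^sup>2 * (2 * (21 / 20 * \<Delta> / \<kappa>))" by (simp add: mult_left_mono)
    also have "\<dots> = 42 / 5 * (B\<^sup>2 / \<kappa> * \<Delta>)" by simp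
    also have "\<dots> \<le> 9 * (B\<^sup>2 / \<kappa> * \<Delta>)" using D0 \<kappa> by (intro mult_right_mono) auto
    finally have one: "1 \<le> 9 * B\<^sup>2 / \<kappa> * \<Delta>" by simp
    have "(\<Sum>i\<in>I. p \<theta>' i * r' i) \<le> (\<Sum>i\<in>I. p \<theta>' i * 1)"
      using r' p_pos[of _ \<theta>', THEN less_imp_le] by (intro sum_mono mult_left_mono) auto
    hence "(\<Sum>i\<in>I. p \<theta>' i * r' i) \<le> 1" by (simp only: mult_1_right p_sum)
    moreover have "0 \<le> (\<Sum>i\<in>I. P ws i * r' i)"
      using r' p_pos[of _ "\<theta> ws", THEN less_imp_le] by (intro sum_nonneg mult_nonneg_nonneg) auto
    moreover have "0 \<le> 120 * B * sqrt \<Delta>" using B D0 by simp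
    ultimately show ?thesis unfolding Q Q' using one by linarith
  qed
qed

end

section \<open>Confidence event and regret bound\<close>

text \<open>Converts the \<open>ln ((l + s) / l)\<close> produced by the determinant bound into the
  form with \<open>2 * l\<close> that occurs in \<open>beta\<close>.\<close>

lemma log_le_double_log:
  fixes l s :: real
  assumes "0 < l" "0 \<le> s" "s \<le> t"
  shows "ln (l + s) - ln l \<le> 2 * ln (1 + t / (2 * l))"
proof -
  have a: "0 \<le> t / (2 * l)" using assms by simp
  have "(l + s) / l = 1 + 2 * (s / (2 * l))" using assms by (simp add: field_simps)
  also have "\<dots> \<le> 1 + 2 * (t / (2 * l))" using assms by (intro add_left_mono mult_left_mono divide_right_mono) auto
  also have "\<dots> \<le> (1 + t / (2 * l))\<^sup>2" using a by (simp add: power2_sum)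
  finally have "ln ((l + s) / l) \<le> ln ((1 + t / (2 * l))\<^sup>2)" using assms by (intro ln_mono) auto
  moreover have "ln (l + s) - ln l = ln ((l + s) / l)" using assms by (simp add: ln_div)
  ultimately have "ln (l + s) - ln l \<le> ln ((1 + t / (2 * l))\<^sup>2)" by simp
  also have "\<dots> = 2 * ln (1 + t / (2 * l))" using a by (simp add: ln_realpow)
  finally show ?thesis .
qed

context mnl_bandit
begin

text \<open>The noise term of \<open>beta\<close> at round \<open>n + 1\<close>, the round played
  from a history of length \<open>n\<close>.\<close>

definition "conf_exponent n = 11 * (3 * ln (1 + (real K + 1) * real (n + 1)) + 3) * ln (2 * sqrt (1 + 2 * real (n + 1)) / \<delta>)"

text \<open>Only \<open>4 * ln q\<close> of the exponent is spent, where
  \<open>q = 2 * sqrt (1 + 2 * t) / \<delta>\<close>. As \<open>q ^ 4\<close> grows like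
  \<open>t\<^sup>2\<close>, a bound of telescoping shape results.\<close>

lemma exp_conf_exponent: "exp (- conf_exponent n) \<le> \<delta> / ((real n + 1) * (real n + 2))"
proof -
  define t where "t = real n + 1"
  have t: "1 \<le> t" by (simp add: t_def)
  define q where "q = 2 * sqrt (1 + 2 * t) / \<delta>"
  have "2 * 1 \<le> 2 * sqrt (1 + 2 * t)" using t by (intro mult_left_mono) auto
  hence "\<delta> \<le> 2 * sqrt (1 + 2 * t)" using \<delta> by linarith
  hence q1: "1 \<le> q" using \<delta> by (simp add: q_def field_simps)
  have "4 * ln q \<le> 11 * (3 * ln (1 + (real K + 1) * t) + 3) * ln q"
  proof (rule mult_right_mono)
    have "0 \<le> ln (1 + (real K + 1) * t)" using t by simp
    thus "4 \<le> 11 * (3 * ln (1 + (real K + 1) * t) + 3)" by simp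
  qed (use q1 in simp)
  hence "4 * ln q \<le> conf_exponent n" by (simp add: conf_exponent_def q_def t_def add.commute)
  hence "exp (- conf_exponent n) \<le> exp (- (4 * ln q))" by simp
  also have "4 * ln q = ln (q ^ 4)" using q1 by (simp add: ln_realpow)
  also have "exp (- ln (q ^ 4)) = inverse (q ^ 4)" using q1 by (simp add: exp_minus)
  also have "q ^ 4 = 16 * (1 + 2 * t)\<^sup>2 / \<delta> ^ 4"
  proof -
    have "sqrt (1 + 2 * t) ^ 4 = (sqrt (1 + 2 * t) ^ 2) ^ 2" by (simp only: power_mult[symmetric]) simp
    also have "\<dots> = (1 + 2 * t)\<^sup>2" using t by simp
    finally show ?thesis by (simp add: q_def power_divide power_mult_distrib)
  qed
  also have "inverse (16 * (1 + 2 * t)\<^sup>2 / \<delta> ^ 4) = \<delta> ^ 4 / (16 * (1 + 2 * t)\<^sup>2)" by simp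
  also have "\<dots> \<le> \<delta> / (t * (t + 1))"
  proof (rule frac_le)
    have "\<delta> ^ 4 \<le> \<delta> ^ 1" using \<delta> by (intro power_decreasing) auto
    thus "\<delta> ^ 4 \<le> \<delta>" by simp
    have "t * (t + 1) \<le> (1 + 2 * t) * (1 + 2 * t)" using t by (intro mult_mono) auto
    also have "\<dots> \<le> 16 * (1 + 2 * t)\<^sup>2" by (simp add: power2_eq_square)
    finally show "t * (t + 1) \<le> 16 * (1 + 2 * t)\<^sup>2" .
  qed (use \<delta> t in auto)
  finally show ?thesis by (simp add: t_def add.assoc)
qed

definition "confident h \<longleftrightarrow> wdev h \<le> (beta d K \<delta> (length h + 1))\<^sup>2"

lemma wdev_le_beta:
  assumes h: "valid h" "length h \<le> T" and \<Psi>: "\<Psi> h < \<Psi> [] + conf_exponent (length h)"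
  shows "confident h"
proof -
  define n where "n = length h"
  define t where "t = n + 1"
  define L2 where "L2 = ln (1 + (real t + 1) / (2 * lam d K))"
  define X where "X = 2 * eta K * (conf_exponent n + 2 + sqrt 6 * cconst K * real d * L2) + 4 * lam d K"
  have L2: "0 \<le> L2" using lam0 by (simp add: L2_def)
  \<comment> \<open>Two points of the unit ball are within distance 2; this accounts for the summand
    \<open>4 * lam d K\<close> in \<open>beta\<close>.\<close>
  have init: "wdev [] \<le> 4 * lam d K"
  proof -
    have c: "ws \<in> carrier_vec d" "w1 \<in> carrier_vec d" using ws w1 by (auto simp: Wset_carrier)
    have n1: "vnorm ws \<le> 1" "vnorm w1 \<le> 1" using ws w1 by (auto simp: Wset_def)
    have "\<bar>ws \<bullet> w1\<bar> \<le> 1 * 1"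
      using n1 by (intro order_trans[OF scalar_prod_le_vnorm[OF c]] mult_mono) (auto simp: vnorm_nonneg)
    moreover have "ws \<bullet> ws \<le> 1" "w1 \<bullet> w1 \<le> 1"
      using n1 vnorm_nonneg by (auto simp: vnorm_sq[symmetric] power_le_one)
    moreover have "(ws - w1) \<bullet> (ws - w1) = ws \<bullet> ws - ws \<bullet> w1 - (w1 \<bullet> ws - w1 \<bullet> w1)"
      using c by (simp add: minus_scalar_prod_distrib[of _ d] scalar_prod_minus_distrib[of _ d])
    moreover have "w1 \<bullet> ws = ws \<bullet> w1" using c by (simp add: comm_scalar_prod)
    ultimately have "(ws - w1) \<bullet> (ws - w1) \<le> 4" by linarith
    hence "lam d K * ((ws - w1) \<bullet> (ws - w1)) \<le> lam d K * 4" using lam0 by (intro mult_left_mono) auto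
    thus ?thesis using c by (simp add: bform_smult_mat[of _ d] bform_one)
  qed
  have det0: "ln (rmat_det (Ht [])) = real d * ln (lam d K)" using lam0 by (simp add: ln_realpow)
  have "ln (rmat_det (Ht h)) - ln (rmat_det (Ht [])) \<le> real d * (ln (lam d K + real n) - ln (lam d K))"
    using ln_det_le[OF h] unfolding det0 by (simp add: n_def algebra_simps)
  also have "\<dots> \<le> real d * (2 * L2)"
    unfolding L2_def using lam0 by (intro mult_left_mono log_le_double_log) (auto simp: t_def)
  finally have det: "ln (rmat_det (Ht h)) - ln (rmat_det (Ht [])) \<le> real d * (2 * L2)" .
  have "wdev h / (2 * eta K) < wdev [] / (2 * eta K) + conf_exponent n
       + 7 / 5 * eta K * (ln (rmat_det (Ht h)) - ln (rmat_det (Ht [])))"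
    using \<Psi> unfolding \<Psi>_def n_def by (simp add: algebra_simps)
  also have "7 / 5 * eta K * (ln (rmat_det (Ht h)) - ln (rmat_det (Ht []))) \<le> 7 / 5 * eta K * (real d * (2 * L2))"
    using det eta0 by (intro mult_left_mono) auto
  \<comment> \<open>\<open>2 * 7/5 = 12/5 * 7/6\<close>, and
    \<open>12/5 \<le> sqrt 6\<close>.\<close>
  also have "\<dots> = 12 / 5 * (7 * eta K / 6 * real d * L2)" by simp
  also have "\<dots> \<le> sqrt 6 * (7 * eta K / 6 * real d * L2)"
  proof (rule mult_right_mono)
    show "12 / 5 \<le> sqrt (6 :: real)" by (rule real_le_rsqrt) (simp add: power2_eq_square)
  qed (use eta0 L2 in auto)
  also have "\<dots> = sqrt 6 * cconst K * real d * L2" by (simp add: cconst_def)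
  also have "wdev [] / (2 * eta K) \<le> 4 * lam d K / (2 * eta K)"
    using init eta0 by (intro divide_right_mono) auto
  finally have "wdev h / (2 * eta K) \<le> 4 * lam d K / (2 * eta K) + conf_exponent n + sqrt 6 * cconst K * real d * L2"
    by simp
  hence "2 * eta K * (wdev h / (2 * eta K)) \<le> 2 * eta K * (4 * lam d K / (2 * eta K) + conf_exponent n + sqrt 6 * cconst K * real d * L2)"
    using eta0 by (intro mult_left_mono) auto
  also have "\<dots> = 4 * lam d K + 2 * eta K * (conf_exponent n + sqrt 6 * cconst K * real d * L2)"
    using eta0 by (simp add: distrib_left)
  also have "\<dots> \<le> X" unfolding X_def using eta0 by (simp add: distrib_left)
  finally have wX: "wdev h \<le> X" using eta0 by simp
  have w0: "0 \<le> wdev h"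
    using state_inv[OF h] ws_car by (intro pos_def_nonneg[of d "lam d K"]) (auto simp: Wset_carrier)
  have beta: "beta d K \<delta> (length h + 1) = 4 * eta K / lam d K + sqrt X"
    by (simp add: beta_def X_def conf_exponent_def L2_def t_def n_def)
  have "X = (sqrt X)\<^sup>2" using wX w0 by simp
  also have "\<dots> \<le> (4 * eta K / lam d K + sqrt X)\<^sup>2"
    using eta0 lam0 wX w0 by (intro power_mono) auto
  finally show ?thesis using wX unfolding confident_def beta by linarith
qed

lemma confident_tail:
  assumes n: "n < T"
  shows "measure_pmf.prob (traj v0 E pick ws n) {h. \<not> confident h} \<le> \<delta> / ((real n + 1) * (real n + 2))"
proof -
  have "measure_pmf.prob (traj v0 E pick ws n) {h. \<not> confident h}
     \<le> measure_pmf.prob (traj v0 E pick ws n) {h. \<Psi> [] + conf_exponent n \<le> \<Psi> h}"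
  proof (rule measure_pmf.finite_measure_mono_AE)
    show "AE h in measure_pmf (traj v0 E pick ws n). h \<in> {h. \<not> confident h} \<longrightarrow> h \<in> {h. \<Psi> [] + conf_exponent n \<le> \<Psi> h}"
      unfolding AE_measure_pmf_iff using wdev_le_beta traj_valid[of n] n by force
  qed simp
  also have "\<dots> \<le> exp (- conf_exponent n)" using n by (intro supermartingale_tail) simp
  also have "\<dots> \<le> \<delta> / ((real n + 1) * (real n + 2))" by (rule exp_conf_exponent)
  finally show ?thesis .
qed

text \<open>Confidence is recorded at the start of each round played. The final state is not tested,
  since no regret is incurred from it.\<close>

primrec good :: "hist \<Rightarrow> bool" where
  "good [] = True"
| "good (sc # h) = (good h \<and> confident h)"

text \<open>Histories grow at the head, so events about earlier rounds are preimages under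
  \<open>tl\<close> and keep their probability.\<close>

lemma traj_tl: "map_pmf tl (traj v0 E pick ws (Suc n)) = traj v0 E pick ws n"
  by (simp add: map_bind_pmf map_pmf_comp map_pmf_const bind_return_pmf')

text \<open>The sum of \<open>1 / ((k + 1) * (k + 2))\<close> over \<open>k < n\<close> telescopes
  to \<open>1 - 1 / (n + 1)\<close>, so the total failure stays below \<open>\<delta>\<close> for
  every horizon.\<close>

lemma good_prob:
  assumes "n \<le> T"
  shows "measure_pmf.prob (traj v0 E pick ws n) {h. \<not> good h} \<le> \<delta> * (1 - 1 / (real n + 1))"
  using assms
proof (induction n)
  case (Suc n)
  have "measure_pmf.prob (traj v0 E pick ws (Suc n)) {h. \<not> good h}
     \<le> measure_pmf.prob (traj v0 E pick ws (Suc n)) (tl -` {h. \<not> good h \<or> \<not> confident h})"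
  proof (rule measure_pmf.finite_measure_mono_AE)
    have "h \<in> {h. \<not> good h} \<longrightarrow> h \<in> tl -` {h. \<not> good h \<or> \<not> confident h}" for h by (cases h) auto
    thus "AE h in measure_pmf (traj v0 E pick ws (Suc n)). h \<in> {h. \<not> good h} \<longrightarrow> h \<in> tl -` {h. \<not> good h \<or> \<not> confident h}"
      by simp
  qed simp
  also have "\<dots> = measure_pmf.prob (traj v0 E pick ws n) {h. \<not> good h \<or> \<not> confident h}"
    unfolding traj_tl[symmetric, of n] by simp
  also have "\<dots> \<le> measure_pmf.prob (traj v0 E pick ws n) {h. \<not> good h} + measure_pmf.prob (traj v0 E pick ws n) {h. \<not> confident h}"
    unfolding Collect_disj_eq by (intro measure_Un_le) auto
  also have "\<dots> \<le> \<delta> * (1 - 1 / (real n + 1)) + \<delta> / ((real n + 1) * (real n + 2))"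
    using Suc confident_tail[of n] by (intro add_mono) auto
  also have "\<dots> = \<delta> * (1 - 1 / (real (Suc n) + 1))"
  proof -
    have "1 - 1 / (real n + 1) + 1 / ((real n + 1) * (real n + 2)) = 1 - 1 / (real n + 2)"
      by (simp add: divide_simps) (simp add: algebra_simps)
    hence "\<delta> * (1 - 1 / (real n + 1) + 1 / ((real n + 1) * (real n + 2))) = \<delta> * (1 - 1 / (real n + 2))"
      by simp
    thus ?thesis by (simp add: distrib_left add.commute)
  qed
  finally show ?case .
qed simp

text \<open>The set kept by \<open>optimistic_revenue\<close> is a subset of \<open>S\<close>, hence
  feasible, and the maximality of \<open>pick\<close> applies to it.\<close>

lemma optimism:
  assumes h: "valid h" "length h < T" and conf: "confident h" and b: "0 \<le> beta d K \<delta> (length h + 1)"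
  shows "Max ((\<lambda>S. exp_rev v0 (ft h) (snd (E h)) S ws) ` Assorts N K) \<le> opt_rev d K v0 \<delta> E w1 h (pick h)"
proof (rule Max.boundedI)
  show "finite ((\<lambda>S. exp_rev v0 (ft h) (snd (E h)) S ws) ` Assorts N K)"
    by (rule finite_imageI, rule finite_subset[of _ "Pow {1..N}"]) (auto simp: Assorts_def)
  show "(\<lambda>S. exp_rev v0 (ft h) (snd (E h)) S ws) ` Assorts N K \<noteq> {}"
    by (auto simp: Assorts_def intro!: exI[of _ "{}"])
next
  fix R assume "R \<in> (\<lambda>S. exp_rev v0 (ft h) (snd (E h)) S ws) ` Assorts N K"
  then obtain S where S: "S \<in> Assorts N K" "R = exp_rev v0 (ft h) (snd (E h)) S ws" by auto
  have S': "finite S" "S \<subseteq> {1..N}" "0 \<notin> S" "card S \<le> K"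
    using S(1) by (auto simp: Assorts_def intro: finite_subset)
  note inv = state_inv[OF h(1) less_imp_le[OF h(2)]]
  have "\<theta>i \<bullet> ws \<le> \<theta>i \<bullet> wt h + beta d K \<delta> (length h + 1) * inv_norm (Ht h) \<theta>i" if "\<theta>i \<in> carrier_vec d" for \<theta>i
    using confidence_dual[OF inv(2) Wset_carrier[OF inv(1)] ws_car conf[unfolded confident_def] b that] that
      Wset_carrier[OF inv(1)] ws_car
    by (simp add: scalar_prod_minus_distrib[of _ d] abs_le_iff)
  hence ab: "ft h i \<bullet> ws \<le> ucb_alpha d K v0 \<delta> E w1 h i" if "i \<in> S" for i
    using feat[OF h(2), of i] that S'(2) by (auto simp: ucb_alpha_def split_beta Let_def)
  have R: "R = (\<Sum>i\<in>S. exp (ft h i \<bullet> ws) * snd (E h) i) / (v0 + (\<Sum>i\<in>S. exp (ft h i \<bullet> ws)))"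
  proof -
    have "R = (\<Sum>i\<in>S. exp (ft h i \<bullet> ws) / (v0 + (\<Sum>i\<in>S. exp (ft h i \<bullet> ws))) * snd (E h) i)"
      unfolding S(2) exp_rev_def mnl_prob_def using S'(3) by (intro sum.cong refl) auto
    thus ?thesis by (simp add: sum_divide_distrib)
  qed
  define S1 where "S1 = {i\<in>S. R \<le> snd (E h) i}"
  have "R \<le> opt_rev d K v0 \<delta> E w1 h S1"
    unfolding opt_rev_def S1_def
    using optimistic_revenue[of S v0 "\<lambda>i. ft h i \<bullet> ws" "ucb_alpha d K v0 \<delta> E w1 h" "snd (E h)",
        OF S'(1) v0 ab, folded R] .
  also have "S1 \<in> Assorts N K"
    using S' card_mono[of S S1] by (auto simp: Assorts_def S1_def)
  hence "opt_rev d K v0 \<delta> E w1 h S1 \<le> opt_rev d K v0 \<delta> E w1 h (pick h)"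
    by (rule pick_max[OF h(2)])
  finally show "R \<le> opt_rev d K v0 \<delta> E w1 h (pick h)" .
qed

text \<open>The weight \<open>q\<close> splits \<open>sqrt \<Delta>\<close> by AM-GM, so that the bound telescopes; it is set to \<open>sqrt (T / d)\<close>.\<close>
lemma regret_step:
  assumes h: "valid h" "length h < T" and conf: "confident h" and c: "c \<in> insert 0 (pick h)"
    and b: "0 \<le> beta d K \<delta> (length h + 1)" "beta d K \<delta> (length h + 1) \<le> B" and q: "0 < q"
  defines "\<Delta> \<equiv> ln (rmat_det (Ht ((pick h, c) # h))) - ln (rmat_det (Ht h))"
  shows "Max ((\<lambda>S. exp_rev v0 (ft h) (snd (E h)) S ws) ` Assorts N K) - exp_rev v0 (ft h) (snd (E h)) (pick h) ws
     \<le> (60 * B * q + 9 * B\<^sup>2 / \<kappa>) * \<Delta> + 60 * B / q"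
proof -
  define \<beta> where "\<beta> = beta d K \<delta> (length h + 1)"
  interpret R: mnl_round d v0 "ft h" "pick h" using round[OF h(2)] .
  note inv = state_inv[OF h(1) less_imp_le[OF h(2)]]
  note st = state_step[OF h(2) inv(1,2) c]
  have wc: "wt ((pick h, c) # h) \<in> carrier_vec d" using st(1) by (rule Wset_carrier)
  have Dl: "\<Delta> = ln (rmat_det (Ht h + Gmat d v0 (ft h) (pick h) (wt ((pick h, c) # h)))) - ln (rmat_det (Ht h))"
    unfolding \<Delta>_def st(3) ..
  have r: "0 \<le> snd (E h) i \<and> snd (E h) i \<le> 1" if "i \<in> pick h" for i
    using pick[OF h(2)] that feat[OF h(2), of i] by (auto simp: Assorts_def)
  have k: "\<kappa> \<le> R.P (wt ((pick h, c) # h)) i * R.P (wt ((pick h, c) # h)) 0" if "i \<in> pick h" for i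
    using kap[OF h(2) pick[OF h(2)] that st(1)] R.mnl_prob_eq[OF wc] that by simp
  note rr = R.round_regret[OF inv(2) lam_ge_200[OF d] inv(1) ws st(1) conf[unfolded confident_def] b(1) r \<kappa> k,
      folded Dl \<beta>_def]
  have "opt_rev d K v0 \<delta> E w1 h (pick h) - exp_rev v0 (ft h) (snd (E h)) (pick h) ws
      \<le> 120 * \<beta> * sqrt \<Delta> + 9 * \<beta>\<^sup>2 / \<kappa> * \<Delta>"
    using rr(1) by (simp add: opt_rev_def ucb_alpha_def split_beta Let_def \<beta>_def)
  also have "\<dots> \<le> 60 * B * (q * \<Delta> + 1 / q) + 9 * B\<^sup>2 / \<kappa> * \<Delta>"
  proof (rule add_mono)
    have "sqrt \<Delta> = sqrt ((q * \<Delta>) * (1 / q))" using q by simp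
    also have "\<dots> \<le> (q * \<Delta> + 1 / q) / 2" using q rr(2) by (intro arith_geo_mean_sqrt) auto
    finally have s: "2 * sqrt \<Delta> \<le> q * \<Delta> + 1 / q" by simp
    have "120 * \<beta> * sqrt \<Delta> = 60 * \<beta> * (2 * sqrt \<Delta>)" by simp
    also have "\<dots> \<le> 60 * B * (q * \<Delta> + 1 / q)"
      using s b rr(2) by (intro mult_mono) (auto simp: \<beta>_def)
    finally show "120 * \<beta> * sqrt \<Delta> \<le> 60 * B * (q * \<Delta> + 1 / q)" .
    have "\<beta>\<^sup>2 \<le> B\<^sup>2" using b by (intro power_mono) (auto simp: \<beta>_def)
    thus "9 * \<beta>\<^sup>2 / \<kappa> * \<Delta> \<le> 9 * B\<^sup>2 / \<kappa> * \<Delta>"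
      using rr(2) \<kappa> by (intro mult_right_mono divide_right_mono) auto
  qed
  also have "\<dots> = (60 * B * q + 9 * B\<^sup>2 / \<kappa>) * \<Delta> + 60 * B / q" by (simp add: algebra_simps)
  finally show ?thesis using optimism[OF h conf b(1)] by linarith
qed

lemma regret_le:
  assumes "valid h" "good h" "length h \<le> T"
    and B: "\<And>t. 1 \<le> t \<Longrightarrow> t \<le> T \<Longrightarrow> 0 \<le> beta d K \<delta> t \<and> beta d K \<delta> t \<le> B" and q: "0 < q"
  shows "regret v0 N K E ws h \<le> (60 * B * q + 9 * B\<^sup>2 / \<kappa>) * (ln (rmat_det (Ht h)) - real d * ln (lam d K))
     + 60 * B / q * real (length h)"
  using assms(1-3)
proof (induction h)
  case Nil
  show ?case using lam0 by (simp add: ln_realpow)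
next
  case (Cons sc h)
  obtain c where sc: "sc = (pick h, c)" "c \<in> insert 0 (pick h)" using Cons.prems by (cases sc) auto
  have h: "valid h" "length h < T" "confident h" "good h" using Cons.prems by auto
  have "0 \<le> beta d K \<delta> (length h + 1)" "beta d K \<delta> (length h + 1) \<le> B" using B[of "length h + 1"] h(2) by auto
  note step = regret_step[OF h(1-3) sc(2) this q]
  define M where "M = 60 * B * q + 9 * B\<^sup>2 / \<kappa>"
  define D1 where "D1 = ln (rmat_det (Ht ((pick h, c) # h)))"
  define D0 where "D0 = ln (rmat_det (Ht h))"
  have "regret v0 N K E ws (sc # h) \<le> (M * (D0 - real d * ln (lam d K)) + 60 * B / q * real (length h)) + (M * (D1 - D0) + 60 * B / q)"
    using Cons.IH h step by (simp add: sc(1) M_def D1_def D0_def)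
  also have "\<dots> = M * (D1 - real d * ln (lam d K)) + 60 * B / q * real (length (sc # h))"
    by (simp add: algebra_simps add_divide_distrib)
  finally show ?case by (simp only: M_def D1_def sc(1))
qed

section \<open>Explicit constants and logarithmic factors\<close>

definition "L = ln (exp 1 + real T * real K * real d / \<delta>)"

context
  assumes T: "1 \<le> T"
begin

lemma TK_le: "real T * real K \<le> real T * real K * real d / \<delta>" "real T / \<delta> \<le> real T * real K * real d / \<delta>"
proof -
  have "real T * real K * 1 \<le> real T * real K * (real d / \<delta>)"
    using d \<delta> by (intro mult_left_mono) auto
  thus "real T * real K \<le> real T * real K * real d / \<delta>" by simp
  have "real T * (1 * 1) \<le> real T * (real K * real d)" using d K by (intro mult_left_mono mult_mono) auto
  hence "real T * 1 / \<delta> \<le> real T * (real K * real d) / \<delta>" using \<delta> by (intro divide_right_mono) auto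
  thus "real T / \<delta> \<le> real T * real K * real d / \<delta>" by simp
qed

lemma L_ge: "0 < y \<Longrightarrow> y \<le> exp 1 + real T * real K * real d / \<delta> \<Longrightarrow> ln y \<le> L"
  unfolding L_def by (intro ln_mono) auto

text \<open>With \<open>Y = T K d / \<delta>\<close>, constant multiples of \<open>Y\<close> are
  absorbed by the cross term \<open>2 * exp 1 * Y\<close> of the square, at the price of a factor
  2.\<close>

lemma L_ge_half: "0 < y \<Longrightarrow> y \<le> (exp 1 + real T * real K * real d / \<delta>)\<^sup>2 \<Longrightarrow> ln y \<le> 2 * L"
proof -
  assume y: "0 < y" "y \<le> (exp 1 + real T * real K * real d / \<delta>)\<^sup>2"
  have pos: "0 < exp 1 + real T * real K * real d / \<delta>" using \<delta> by (intro add_pos_nonneg) auto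
  have "ln y \<le> ln ((exp 1 + real T * real K * real d / \<delta>)\<^sup>2)" using y by (intro ln_mono) auto
  thus ?thesis using pos by (simp add: L_def ln_realpow)
qed

lemma exp1_ge_2: "2 \<le> exp (1::real)"
  using exp_ge_add_one_self[of 1] by simp

lemma L_ge_1: "1 \<le> L"
  using L_ge[of "exp 1"] \<delta> by simp

lemma T_ge_1: "1 \<le> real T" using T by simp
lemma K_ge_1: "1 \<le> real K" using K by simp
lemma d_ge_1: "1 \<le> real d" using d by simp

lemma eta_le: "eta K \<le> 3 * L"
proof -
  have "1 * real K \<le> real T * real K" using T_ge_1 by (intro mult_right_mono) auto
  hence "real K + 1 \<le> exp 1 + real T * real K * real d / \<delta>" using TK_le(1) exp1_ge_2 by linarith
  hence "ln (real K + 1) \<le> L" by (intro L_ge) auto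
  thus ?thesis using L_ge_1 by (simp add: eta_def)
qed

lemma lam_le: "lam d K \<le> 378 * (real d * L)"
proof -
  have "sqrt 2 \<le> 3 / (2::real)" by (rule real_le_lsqrt) (auto simp: power2_eq_square)
  hence "84 * sqrt 2 * (real d * eta K) \<le> 126 * (real d * (3 * L))"
    using eta_le eta0 by (intro mult_mono) auto
  thus ?thesis by (simp add: lam_def mult.assoc)
qed

lemma ln_div_lam_le:
  assumes "0 \<le> s" "s \<le> 2 * real T"
  shows "ln (1 + s / (2 * lam d K)) \<le> L"
proof (rule L_ge)
  have "s / (2 * lam d K) \<le> s / 2" using assms lam_ge_200[OF d, of K] by (intro divide_left_mono) auto
  also have "\<dots> \<le> real T * 1" using assms by simp
  also have "\<dots> \<le> real T * real K" using K_ge_1 by (intro mult_left_mono) auto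
  finally show "1 + s / (2 * lam d K) \<le> exp 1 + real T * real K * real d / \<delta>" using TK_le(1) exp1_ge_2 by linarith
  show "0 < 1 + s / (2 * lam d K)" using assms lam0 by (intro add_pos_nonneg) auto
qed

lemma beta_bounds:
  assumes t: "1 \<le> t" "t \<le> T"
  shows "0 \<le> beta d K \<delta> t" and "beta d K \<delta> t \<le> 60 * sqrt (real d) * L\<^sup>2"
proof -
  define Y where "Y = real T * real K * real d / \<delta>"
  have Y: "real T * real K \<le> Y" "real T / \<delta> \<le> Y" using TK_le by (auto simp: Y_def)
  have YT: "1 \<le> Y"
  proof -
    have "1 * 1 \<le> real T * real K" using T_ge_1 K_ge_1 by (intro mult_mono) auto
    thus ?thesis using Y(1) by simp
  qed
  have tT: "real t \<le> real T" "1 \<le> real t" using t by auto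
  define a where "a = ln (1 + (real K + 1) * real t)"
  define b where "b = ln (2 * sqrt (1 + 2 * real t) / \<delta>)"
  define e where "e = ln (1 + (real t + 1) / (2 * lam d K))"
  have a: "0 \<le> a" "a \<le> 2 * L"
  proof -
    show "0 \<le> a" by (simp add: a_def)
    have "(real K + 1) * real t \<le> (2 * real K) * real T" using tT K_ge_1 by (intro mult_mono) auto
    also have "\<dots> \<le> 2 * Y" using Y by (simp add: mult.commute)
    also have "\<dots> \<le> 2 * exp 1 * Y" using YT exp1_ge_2 by (intro mult_right_mono) auto
    finally have "1 + (real K + 1) * real t \<le> 1\<^sup>2 + 2 * exp 1 * Y" by simp
    also have "\<dots> \<le> (exp 1)\<^sup>2 + 2 * exp 1 * Y + Y\<^sup>2"
      using exp1_ge_2 power_mono[of 1 "exp 1 :: real" 2] zero_le_power2[of Y] by linarith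
    also have "\<dots> = (exp 1 + Y)\<^sup>2" by (simp add: power2_sum)
    finally show "a \<le> 2 * L" unfolding a_def Y_def using tT by (intro L_ge_half) (auto intro: add_pos_nonneg)
  qed
  have b: "0 \<le> b" "b \<le> 2 * L"
  proof -
    have s1: "1 \<le> sqrt (1 + 2 * real t)" by simp
    hence "1 * \<delta> \<le> 2 * sqrt (1 + 2 * real t)" using \<delta> by linarith
    hence "1 \<le> 2 * sqrt (1 + 2 * real t) / \<delta>" using \<delta> by (simp add: field_simps)
    thus "0 \<le> b" by (simp add: b_def)
    have "sqrt (1 + 2 * real t) \<le> 2 * real t"
    proof (rule real_le_lsqrt)
      have "real t * 1 \<le> real t * real t" using tT by (intro mult_left_mono) auto
      thus "1 + 2 * real t \<le> (2 * real t)\<^sup>2" using tT unfolding power2_eq_square by linarith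
    qed auto
    hence "2 * sqrt (1 + 2 * real t) / \<delta> \<le> (2 * 2) * real T / \<delta>" using tT \<delta> by (intro divide_right_mono) auto
    also have "\<dots> \<le> 2 * 2 * Y" using Y by simp
    also have "\<dots> \<le> 2 * exp 1 * Y" using YT exp1_ge_2 by (intro mult_right_mono mult_left_mono) auto
    also have "\<dots> \<le> (exp 1)\<^sup>2 + 2 * exp 1 * Y + Y\<^sup>2" by simp
    also have "\<dots> = (exp 1 + Y)\<^sup>2" by (simp add: power2_sum)
    finally show "b \<le> 2 * L" unfolding b_def Y_def using tT \<delta> by (intro L_ge_half) auto
  qed
  have e: "0 \<le> e" "e \<le> L"
  proof -
    show "0 \<le> e" using lam0 by (simp add: e_def)
    show "e \<le> L" unfolding e_def using tT T_ge_1 by (intro ln_div_lam_le) auto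
  qed
  define X where "X = 2 * eta K * (11 * (3 * a + 3) * b + 2 + sqrt 6 * cconst K * real d * e) + 4 * lam d K"
  have beta: "beta d K \<delta> t = 4 * eta K / lam d K + sqrt X"
    by (simp add: beta_def X_def a_def b_def e_def)
  have c0: "0 \<le> cconst K" using eta0 by (simp add: cconst_def)
  have X0: "0 \<le> X" unfolding X_def using eta0 a b e c0 lam0 by simp
  show "0 \<le> beta d K \<delta> t" unfolding beta using X0 eta0 lam0 by simp
  have L1: "1 \<le> L" by (rule L_ge_1)
  have L0: "0 \<le> L" using L1 by simp
  have LL: "1 \<le> L\<^sup>2" "L \<le> L\<^sup>2" "1 \<le> L ^ 3" "L \<le> L ^ 4" "L ^ 3 \<le> L ^ 4"
    using L1 power_increasing[of 1 2 L] power_increasing[of 1 4 L] power_increasing[of 3 4 L] by (auto simp: one_le_power)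
  have dL: "real d * L\<^sup>2 \<ge> L\<^sup>2" using d_ge_1 mult_right_mono[of 1 "real d" "L\<^sup>2"] by simp
  \<comment> \<open>\<open>219\<close> exceeds \<open>198 + 2 + 35/4\<close>. Then
    \<open>6 * 219 + 4 * 378 = 2826\<close> is below \<open>3481 = 59^2\<close>, and the other
    summand of \<open>beta\<close> is at most 1, which makes 60.\<close>
  have "X \<le> 2 * (3 * L) * (219 * (real d * L\<^sup>2)) + 4 * (378 * (real d * L))"
    unfolding X_def
  proof (intro add_mono mult_left_mono mult_mono lam_le eta_le)
    have "3 * a + 3 \<le> 9 * L" using a L1 by linarith
    hence "11 * (3 * a + 3) * b \<le> 11 * (9 * L) * (2 * L)" using a b L1 by (intro mult_mono) auto
    hence "11 * (3 * a + 3) * b \<le> 198 * L\<^sup>2" by (simp add: power2_eq_square)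
    hence t1: "11 * (3 * a + 3) * b \<le> 198 * (real d * L\<^sup>2)" using dL by linarith
    have t2: "2 \<le> 2 * (real d * L\<^sup>2)" using dL LL by linarith
    have s6: "sqrt 6 \<le> (5 / 2 :: real)" by (rule real_le_lsqrt) (auto simp: power2_eq_square)
    have c: "cconst K \<le> 7 / 2 * L" using eta_le by (simp add: cconst_def)
    have "sqrt 6 * cconst K * real d * e \<le> 5 / 2 * (7 / 2 * L) * real d * L"
      using s6 c c0 e L0 by (intro mult_mono) auto
    also have "\<dots> = 35 / 4 * (real d * L\<^sup>2)" by (simp add: power2_eq_square)
    finally show "11 * (3 * a + 3) * b + 2 + sqrt 6 * cconst K * real d * e \<le> 219 * (real d * L\<^sup>2)"
      using t1 t2 dL LL by linarith
  qed (use a b e c0 L0 in auto)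
  also have "\<dots> = real d * (1314 * L ^ 3 + 1512 * L)" by (simp add: power2_eq_square power3_eq_cube algebra_simps)
  also have "\<dots> \<le> real d * (3481 * L ^ 4)" using LL L0 by (intro mult_left_mono) auto
  also have "\<dots> = (59 * sqrt (real d) * L\<^sup>2)\<^sup>2" by (simp add: power_mult_distrib power_mult[symmetric])
  finally have "sqrt X \<le> 59 * sqrt (real d) * L\<^sup>2" using L0 by (intro real_le_lsqrt) auto
  moreover have "4 * eta K / lam d K \<le> 1" using lam_ge_eta[OF d, of K] lam0 eta0 by (simp add: field_simps)
  moreover have "1 * 1 \<le> sqrt (real d) * L\<^sup>2" using d_ge_1 LL by (intro mult_mono) auto
  ultimately show "beta d K \<delta> t \<le> 60 * sqrt (real d) * L\<^sup>2" unfolding beta by (simp add: algebra_simps)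
qed

lemma regret_bound:
  assumes h: "valid h" "good h" "length h = T"
  shows "regret v0 N K E ws h \<le> 64800 * L ^ 5 * (real d * sqrt (real T) + (real d)\<^sup>2 / \<kappa>)"
proof -
  define B where "B = 60 * sqrt (real d) * L\<^sup>2"
  \<comment> \<open>As \<open>B\<close> is of order \<open>sqrt d\<close>, this weight makes both
    parts of the split of order \<open>d * sqrt T\<close>.\<close>
  define q where "q = sqrt (real T) / sqrt (real d)"
  have q: "0 < q" using T_ge_1 d_ge_1 by (simp add: q_def)
  have L1: "1 \<le> L" by (rule L_ge_1)
  have B0: "0 \<le> B" by (simp add: B_def)
  have "ln (rmat_det (Ht h)) - real d * ln (lam d K) \<le> real d * (ln (lam d K + real T) - ln (lam d K))"
    using ln_det_le[OF h(1)] h(3) by (simp add: algebra_simps)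
  also have "ln (lam d K + real T) - ln (lam d K) \<le> 2 * ln (1 + real T / (2 * lam d K))"
    using lam0 by (intro log_le_double_log) auto
  also have "\<dots> \<le> 2 * L" using ln_div_lam_le[of "real T"] by simp
  finally have det: "ln (rmat_det (Ht h)) - real d * ln (lam d K) \<le> 2 * (real d * L)" by (simp add: mult_left_mono)
  have "regret v0 N K E ws h \<le> (60 * B * q + 9 * B\<^sup>2 / \<kappa>) * (ln (rmat_det (Ht h)) - real d * ln (lam d K)) + 60 * B / q * real T"
    using regret_le[OF h(1,2) _ _ q, of B] beta_bounds h(3) by (simp add: B_def)
  also have "\<dots> \<le> (60 * B * q + 9 * B\<^sup>2 / \<kappa>) * (2 * (real d * L)) + 60 * B / q * real T"
    using det B0 q \<kappa> by (intro add_right_mono mult_left_mono) auto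
  also have "\<dots> = 7200 * L ^ 3 * (real d * sqrt (real T)) + 64800 * L ^ 5 * ((real d)\<^sup>2 / \<kappa>) + 3600 * L\<^sup>2 * (real d * sqrt (real T))"
  proof -
    have "B * q = 60 * L\<^sup>2 * sqrt (real T)" using d_ge_1 by (simp add: B_def q_def)
    moreover have "B\<^sup>2 = 3600 * real d * L ^ 4" by (simp add: B_def power_mult_distrib power_mult[symmetric])
    moreover have "B / q * real T = 60 * L\<^sup>2 * (real d * sqrt (real T))"
    proof -
      have "B / q = 60 * L\<^sup>2 * real d / sqrt (real T)" using d_ge_1 by (simp add: B_def q_def field_simps)
      moreover have "real T / sqrt (real T) = sqrt (real T)" using T_ge_1 by (simp add: real_div_sqrt)
      moreover have "60 * L\<^sup>2 * real d / sqrt (real T) * real T = 60 * L\<^sup>2 * (real d * (real T / sqrt (real T)))"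
        by simp
      ultimately show ?thesis by simp
    qed
    moreover have "(60 * B * q + 9 * B\<^sup>2 / \<kappa>) * (2 * (real d * L)) + 60 * B / q * real T
       = 120 * (B * q) * real d * L + 18 * B\<^sup>2 / \<kappa> * real d * L + 60 * (B / q * real T)"
      by (simp add: algebra_simps)
    ultimately show ?thesis by (simp add: power2_eq_square eval_nat_numeral)
  qed
  also have "\<dots> \<le> 7200 * L ^ 5 * (real d * sqrt (real T)) + 64800 * L ^ 5 * ((real d)\<^sup>2 / \<kappa>) + 3600 * L ^ 5 * (real d * sqrt (real T))"
    using L1 by (intro add_mono mult_right_mono mult_left_mono power_increasing) auto
  also have "\<dots> \<le> 64800 * L ^ 5 * (real d * sqrt (real T) + (real d)\<^sup>2 / \<kappa>)"
    using L1 by (simp add: algebra_simps)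
  finally show ?thesis .
qed

end
end

theorem theorem4:
  shows "\<exists>p::nat. \<forall>v0::real. v0 > 0 \<longrightarrow> (\<exists>C::real. \<forall>(d::nat) (N::nat) (K::nat) (T::nat) (\<delta>::real) (\<kappa>::real)
            (wstar::real Matrix.vec) (w1::real Matrix.vec) (E::env) (pick::hist \<Rightarrow> nat set).
      d \<ge> 1 \<and> N \<ge> 1 \<and> K \<ge> 1 \<and> 0 < \<delta> \<and> \<delta> \<le> 1 \<and> \<kappa> > 0
      \<and> wstar \<in> Wset d \<and> w1 \<in> Wset d
      \<and> (\<forall>h. length h < T \<longrightarrow> (\<forall>i\<in>{1..N}.
            fst (E h) i \<in> carrier_vec d \<and> vnorm (fst (E h) i) \<le> 1
            \<and> 0 \<le> snd (E h) i \<and> snd (E h) i \<le> 1))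
      \<and> (\<forall>h. length h < T \<longrightarrow> (\<forall>S\<in>Assorts N K. \<forall>i\<in>S. \<forall>w\<in>Wset d.
            mnl_prob v0 (fst (E h)) S w i * mnl_prob v0 (fst (E h)) S w 0 \<ge> \<kappa>))
      \<and> (\<forall>h. length h < T \<longrightarrow> pick h \<in> Assorts N K
            \<and> (\<forall>S\<in>Assorts N K. opt_rev d K v0 \<delta> E w1 h S \<le> opt_rev d K v0 \<delta> E w1 h (pick h)))
      \<longrightarrow> measure_pmf.prob (traj v0 E pick wstar T)
            {h. regret v0 N K E wstar h
                  \<le> C * (ln (exp 1 + real T * real K * real d / \<delta>)) ^ p
                      * (real d * sqrt (real T) + (real d)^2 / \<kappa>)}
          \<ge> 1 - \<delta>)"
\<comment> \<open>The power 5 is \<open>L ^ 4\<close> from \<open>B\<^sup>2\<close> times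
  \<open>L\<close> from the log-determinant, and \<open>64800 = 2 * 9 * 60^2\<close>. The constant
  is absolute: \<open>v0\<close> acts only through the choice probabilities, hence through
  \<open>\<kappa>\<close>.\<close>
proof (intro exI[of _ "5::nat"] exI[of _ "64800::real"] allI impI, elim conjE)
  fix v0 :: real and d N K T :: nat and \<delta> \<kappa> :: real and wstar w1 :: "real Matrix.vec"
    and E :: env and pick :: "hist \<Rightarrow> nat set"
  assume v0: "v0 > 0" and d: "d \<ge> 1" and K: "K \<ge> 1" and \<delta>: "0 < \<delta>" "\<delta> \<le> 1" and \<kappa>: "\<kappa> > 0"
    and W: "wstar \<in> Wset d" "w1 \<in> Wset d"
    and feat: "\<forall>h. length h < T \<longrightarrow> (\<forall>i\<in>{1..N}.
            fst (E h) i \<in> carrier_vec d \<and> vnorm (fst (E h) i) \<le> 1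
            \<and> 0 \<le> snd (E h) i \<and> snd (E h) i \<le> 1)"
    and kap: "\<forall>h. length h < T \<longrightarrow> (\<forall>S\<in>Assorts N K. \<forall>i\<in>S. \<forall>w\<in>Wset d.
            mnl_prob v0 (fst (E h)) S w i * mnl_prob v0 (fst (E h)) S w 0 \<ge> \<kappa>)"
    and pick: "\<forall>h. length h < T \<longrightarrow> pick h \<in> Assorts N K
            \<and> (\<forall>S\<in>Assorts N K. opt_rev d K v0 \<delta> E w1 h S \<le> opt_rev d K v0 \<delta> E w1 h (pick h))"
  interpret B: mnl_bandit v0 d N K T \<delta> \<kappa> wstar w1 E pick
    by unfold_locales (use v0 d K \<delta> \<kappa> W feat kap pick in auto)
  let ?M = "measure_pmf (traj v0 E pick wstar T)"
  let ?R = "{h. regret v0 N K E wstar h \<le> 64800 * (ln (exp 1 + real T * real K * real d / \<delta>)) ^ 5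
                      * (real d * sqrt (real T) + (real d)^2 / \<kappa>)}"
  have sub: "h \<in> - {h. \<not> B.good h} \<longrightarrow> h \<in> ?R" if h: "h \<in> set_pmf (traj v0 E pick wstar T)" for h
  \<comment> \<open>The logarithmic estimates assume a positive horizon; without rounds the regret
    is 0.\<close>
  proof (cases "T = 0")
    case True
    thus ?thesis using h \<kappa> by simp
  next
    case False
    thus ?thesis using B.traj_valid[OF _ h] B.regret_bound[of h] by (simp add: B.L_def)
  qed
  have "1 / (real T + 1) \<ge> 0" by simp
  hence "\<delta> * (1 - 1 / (real T + 1)) \<le> \<delta> * 1" using \<delta> by (intro mult_left_mono) auto
  hence "measure_pmf.prob (traj v0 E pick wstar T) {h. \<not> B.good h} \<le> \<delta>"
    using B.good_prob[of T] by simp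
  hence "1 - \<delta> \<le> 1 - measure_pmf.prob (traj v0 E pick wstar T) {h. \<not> B.good h}" by simp
  also have "\<dots> = measure_pmf.prob (traj v0 E pick wstar T) (- {h. \<not> B.good h})"
    using measure_pmf.prob_compl[of "{h. \<not> B.good h}" "traj v0 E pick wstar T"] by (simp add: Compl_eq_Diff_UNIV)
  also have "\<dots> \<le> measure_pmf.prob (traj v0 E pick wstar T) ?R"
    using sub by (intro measure_pmf.finite_measure_mono_AE) (auto simp: AE_measure_pmf_iff)
  finally show "1 - \<delta> \<le> measure_pmf.prob (traj v0 E pick wstar T) ?R" .
qed

end
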